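(* Let $a,b,c,d$ be nonnegative integers with $d\le b\le c$. Then $$\frac{M(H_{2a,b,c;d})}{M(H_{2a,b,c})}=\prod_{k=0}^{d-1} \frac{(k+\frac{1}{2})_{b-2k}\,(a+k+1)_{b-2k-1}\,(b-k+\frac{1}{2})_{\lfloor\frac{c-b}{2}\rfloor}\,(c-k)_{-\lfloor\frac{c-b}{2}\rfloor}}{(a+k+\frac{1}{2})_{b-2k}\,(k+1)_{b-2k-1}\,(a+b-k+\frac{1}{2})_{\lfloor\frac{c-b}{2}\rfloor}\,(a+c-k)_{-\lfloor\frac{c-b}{2}\rfloor}}$$ and $$\frac{M(H_{2a+1,b,c;d})}{M(H_{2a+1,b,c})}=\frac{1}{4^d}\prod_{k=0}^{d-1} \frac{(a+k+1)_{c-2k}\,(k+\frac{3}{2})_{c-2k-2}\,(b-k)_{\lfloor\frac{c-b}{2}\rfloor}\,(c-k-\frac{1}{2})_{-\lfloor\frac{c-b}{2}\rfloor}}{(k+1)_{c-2k-1}\,(a+k+\frac{3}{2})_{c-2k-1}\,(a+b-k+1)_{\lfloor\frac{c-b}{2}\rfloor}\,(a+c-k+\frac{1}{2})_{-\lfloor\frac{c-b}{2}\rfloor}}.$$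
   Context: Work on the triangular lattice of unit equilateral triangles in which one family of lattice lines is vertical. For nonnegative integers $p,b,c$, $H_{p,b,c}$ denotes the hexagon on this lattice whose side lengths, listed clockwise starting from the (vertical) left side, are $p,b,c,p,b,c$. For nonnegative integers $p,b,c,d$ such that the construction makes sense (in particular whenever $d\le\min(b,c)$), let $\ell$ be the perpendicular bisector (a horizontal line) of the left side of $H_{p,b,c}$, label the unit triangles of $H_{p,b,c}$ whose interiors meet $\ell$ by $1,2,3,\dots$ from left to right, and let $H_{p,b,c;d}$ be the region obtained from $H_{p,b,c}$ by deleting the unit triangles labeled $1,2,\dots,2d$ (so $H_{p,b,c;0}=H_{p,b,c}$). When $p$ is even the deleted triangles form $d$ consecutive lozenges along $\ell$; when $p$ is odd they form $d$ consecutive bowties. For a region $R$, $M(R)$ denotes the number of lozenge tilings of $R$ (a lozenge being the union of two unit triangles sharing an edge), with $M(R)=1$ if $R$ is empty. Shifted factorial: for $x$ a positive integer or positive half-integer and $n$ an integer with $x+n>0$, $(x)_n=x(x+1)\cdots(x+n-1)$ if $n>0$, $(x)_0=1$, and $(x)_n=\frac{1}{(x-1)(x-2)\cdots(x+n)}$ if $n<0$ (equivalently $(x)_n=\Gamma(x+n)/\Gamma(x)$). Empty products equal $1$. By MacMahon's theorem $M(H_{p,b,c})=\prod_{i=1}^{p}\prod_{j=1}^{b}\prod_{k=1}^{c}\frac{i+j+k-1}{i+j+k-2}$. *)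

theory Defs
  imports Complex_Main
begin

text \<open>Triangular lattice with a vertical family of lines. A lattice point (i,j)
  stands for the Euclidean point i*(sqrt 3/2, 1/2) + j*(0,1); the three line
  families are i = const (vertical), j = const and i + j = const.
  Unit triangles: Rt i j has vertices (i,j),(i,j+1),(i+1,j) (vertical edge on the left);
  Lt i j has vertices (i+1,j),(i+1,j+1),(i,j+1) (vertical edge on the right).\<close>

datatype tri = Rt int int | Lt int int

fun verts :: "tri \<Rightarrow> (int \<times> int) set" where
  "verts (Rt i j) = {(i,j), (i,j+1), (i+1,j)}"
| "verts (Lt i j) = {(i+1,j), (i+1,j+1), (i,j+1)}"

text \<open>Column (left x-coordinate, in units of sqrt 3/2) of a unit triangle.\<close>
fun col :: "tri \<Rightarrow> int" where
  "col (Rt i j) = i"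
| "col (Lt i j) = i"

text \<open>Twice the Euclidean height of a lattice point.\<close>
fun yy :: "int \<times> int \<Rightarrow> int" where
  "yy (i,j) = i + 2*j"

text \<open>The closed hexagon with vertices (0,0),(0,p),(b,p),(b+c,p-c),(b+c,-c),(c,-c):
  side lengths clockwise from the vertical left side are p,b,c,p,b,c.\<close>
definition in_hex :: "nat \<Rightarrow> nat \<Rightarrow> nat \<Rightarrow> int \<times> int \<Rightarrow> bool" where
  "in_hex p b c v = (case v of (i,j) \<Rightarrow>
      0 \<le> i \<and> i \<le> int b + int c \<and> - int c \<le> j \<and> j \<le> int p
      \<and> 0 \<le> i + j \<and> i + j \<le> int b + int p)"

definition hexagon :: "nat \<Rightarrow> nat \<Rightarrow> nat \<Rightarrow> tri set" where
  "hexagon p b c = {t. \<forall>v\<in>verts t. in_hex p b c v}"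

text \<open>The interior of t meets the horizontal line through height p/2
  (perpendicular bisector of the left side).\<close>
definition meets_line :: "nat \<Rightarrow> tri \<Rightarrow> bool" where
  "meets_line p t = (Min (yy ` verts t) < int p \<and> int p < Max (yy ` verts t))"

definition line_tris :: "nat \<Rightarrow> nat \<Rightarrow> nat \<Rightarrow> tri set" where
  "line_tris p b c = {t \<in> hexagon p b c. meets_line p t}"

text \<open>Triangles labelled 1..2d (labels increase left to right along the line;
  the label of t is 1 + the number of labelled triangles strictly to its left).\<close>
definition deleted :: "nat \<Rightarrow> nat \<Rightarrow> nat \<Rightarrow> nat \<Rightarrow> tri set" where
  "deleted p b c d = {t \<in> line_tris p b c.
      card {t' \<in> line_tris p b c. col t' < col t} < 2 * d}"

definition hexagon_del :: "nat \<Rightarrow> nat \<Rightarrow> nat \<Rightarrow> nat \<Rightarrow> tri set" where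
  "hexagon_del p b c d = hexagon p b c - deleted p b c d"

definition is_lozenge :: "tri set \<Rightarrow> bool" where
  "is_lozenge X = (\<exists>t t'. X = {t, t'} \<and> card (verts t \<inter> verts t') = 2)"

definition tilings :: "tri set \<Rightarrow> tri set set set" where
  "tilings R = {T. (\<forall>X\<in>T. is_lozenge X \<and> X \<subseteq> R) \<and> \<Union>T = R \<and> pairwise disjnt T}"

definition M :: "tri set \<Rightarrow> nat" where
  "M R = card (tilings R)"

definition sfact :: "real \<Rightarrow> int \<Rightarrow> real" where
  "sfact x n = (if 0 \<le> n then pochhammer x (nat n)
               else 1 / (\<Prod>i=1..nat (- n). (x - real i)))"

end

theory Submission
  imports Defs "Jordan_Normal_Form.Determinant"
begin

text \<open>No bijection with families of paths is built. The determinant formula is proved by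
  removing triangles from the right end of the region: the two possible partners of a triangle are
  the two summands of a column, and a conflict is a repeated column. The obstacle is the odd side,
  where a path is born at the tip and the number of columns changes. To the left of the tip the
  determinant is therefore taken with a unit column inserted in advance, and the position of that
  column stays a free parameter until the tip is reached.

  The formulas of the theorem resist recursion: they contain a floor and are not visibly symmetric
  in \<open>b\<close> and \<open>c\<close>. Each factor is rewritten as a product over
  \<open>i < a\<close> of rational functions symmetric in \<open>b\<close> and \<open>c\<close>, so
  that one fraction identity gives the other by exchange.

  In the relation for \<open>E (d + 1)\<close> all three even terms are unknown, so a whole starting
  row \<open>b = d + 1\<close> is required. There \<open>E (d + 1)\<close> and \<open>O d\<close>
  share a block that is never evaluated in general; only their quotient is computed, and it is a
  quotient of two half-line determinants.\<close>

text \<open>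
  A tiling is a family of non-intersecting paths of lozenges running from left to right, so the number
  of tilings is a determinant. The removed triangles act as a wall on the axis during the first
  \<open>2 d\<close> columns. Write \<open>E d b c\<close> and \<open>O d b c\<close> for the number of tilings of the
  regions with left side \<open>2 a\<close> and \<open>2 a + 1\<close>. The paths of \<open>E d\<close>, as well as those of
  \<open>E (d + 1)\<close>, become the paths of \<open>O d\<close> when one path is added at the tip of the wall, hence a
  three-term Pluecker relation gives
  \<open>E b c * O b c = E b (c + 1) * O b (c - 1) + E (b + 1) c * O (b - 1) c\<close>
  for both pairs \<open>(E d, O d)\<close> and \<open>(E (d + 1), O d)\<close>. Starting from MacMahon's formula, which follows
  from the same relation, this determines \<open>O 0, E 1, O 1, E 2, \<dots>\<close> in turn from their values at the
  smallest \<open>b\<close> and \<open>c\<close>, where the upper and the lower paths decouple into walks on a half line.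
  Along the product formulas the two terms on the right are the fractions \<open>(c - d) / (b + c - 2 d)\<close>
  and \<open>(b - d) / (b + c - 2 d)\<close> of the left-hand side in the first case, and
  \<open>(a + c - d) / (2 a + b + c - 2 d)\<close> and \<open>(a + b - d) / (2 a + b + c - 2 d)\<close> in the second.
\<close>

section \<open>Determinants and the three-term Pluecker relation\<close>

definition fdet :: "nat \<Rightarrow> (nat \<Rightarrow> nat \<Rightarrow> real) \<Rightarrow> real" where
  "fdet n f = det (mat n n (\<lambda>(i,j). f i j))"

lemma fdet_cong:
  assumes "\<And>i j. i < n \<Longrightarrow> j < n \<Longrightarrow> f i j = g i j"
  shows "fdet n f = fdet n g"
proof -
  have "mat n n (\<lambda>(i,j). f i j) = mat n n (\<lambda>(i,j). g i j)"
    by (rule eq_matI) (auto simp: assms)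
  then show ?thesis by (simp add: fdet_def)
qed

lemma fdet_transpose: "fdet n (\<lambda>i j. f j i) = fdet n f"
proof -
  have "transpose_mat (mat n n (\<lambda>(i,j). f i j)) = mat n n (\<lambda>(i,j). f j i)"
    by (rule eq_matI) auto
  moreover have "det (transpose_mat (mat n n (\<lambda>(i,j). f i j))) = det (mat n n (\<lambda>(i,j). f i j))"
    by (rule det_transpose) auto
  ultimately show ?thesis by (simp add: fdet_def)
qed

lemma fdet_0 [simp]: "fdet 0 f = 1"
  by (simp add: fdet_def)

lemma fdet_1 [simp]: "fdet (Suc 0) f = f 0 0"
  unfolding fdet_def by (subst det_single) auto

lemma fdet_identical_columns:
  assumes "j < k" "k < n" "\<And>i. i < n \<Longrightarrow> f i j = f i k"
  shows "fdet n f = 0"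
  unfolding fdet_def
  by (rule det_identical_columns[of _ n j k]) (use assms in \<open>auto intro!: eq_vecI\<close>)

text \<open>Enumerates the indices other than \<open>r\<close> in increasing order, so that minors
  are again indexed from 0.\<close>

definition skip :: "nat \<Rightarrow> nat \<Rightarrow> nat" where
  "skip r i = (if i < r then i else Suc i)"

lemma fdet_laplace_column:
  assumes "k \<le> n"
  shows "fdet (Suc n) f = (\<Sum>i\<le>n. (-1)^(i+k) * f i k *
           fdet n (\<lambda>i' j'. f (skip i i') (skip k j')))"
proof -
  let ?A = "mat (Suc n) (Suc n) (\<lambda>(i,j). f i j)"
  have "fdet (Suc n) f = (\<Sum>i<Suc n. ?A $$ (i,k) * cofactor ?A i k)"
    unfolding fdet_def by (rule laplace_expansion_column) (use assms in auto)
  also have "\<dots> = (\<Sum>i\<le>n. (-1)^(i+k) * f i k *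
           fdet n (\<lambda>i' j'. f (skip i i') (skip k j')))"
    unfolding lessThan_Suc_atMost
  proof (rule sum.cong, simp)
    fix i assume "i \<in> {..n}"
    then have "mat_delete ?A i k = mat n n (\<lambda>(i',j'). f (skip i i') (skip k j'))"
      unfolding mat_delete_def skip_def by (intro eq_matI) (use assms in auto)
    then show "?A $$ (i,k) * cofactor ?A i k = (-1)^(i+k) * f i k *
           fdet n (\<lambda>i' j'. f (skip i i') (skip k j'))"
      using \<open>i \<in> {..n}\<close> assms by (simp add: cofactor_def fdet_def)
  qed
  finally show ?thesis .
qed

lemma fdet_column_add:
  assumes "k < n" "\<And>i. i < n \<Longrightarrow> f i k = g i k + h i k"
    and "\<And>i j. i < n \<Longrightarrow> j < n \<Longrightarrow> j \<noteq> k \<Longrightarrow> f i j = g i j"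
    and "\<And>i j. i < n \<Longrightarrow> j < n \<Longrightarrow> j \<noteq> k \<Longrightarrow> f i j = h i j"
  shows "fdet n f = fdet n g + fdet n h"
proof -
  obtain m where n: "n = Suc m" using assms(1) by (cases n) auto
  have g: "fdet m (\<lambda>i' j'. f (skip i i') (skip k j'))
      = fdet m (\<lambda>i' j'. g (skip i i') (skip k j'))" if "i \<le> m" for i
    by (rule fdet_cong) (use assms n that in \<open>auto simp: skip_def\<close>)
  have h: "fdet m (\<lambda>i' j'. f (skip i i') (skip k j'))
      = fdet m (\<lambda>i' j'. h (skip i i') (skip k j'))" if "i \<le> m" for i
    by (rule fdet_cong) (use assms n that in \<open>auto simp: skip_def\<close>)
  have k: "k \<le> m" using assms n by simp
  show ?thesis
    unfolding n fdet_laplace_column[OF k] sum.distrib[symmetric]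
  proof (rule sum.cong, simp)
    fix i assume "i \<in> {..m}"
    then have i: "i \<le> m" "i < n" using n by auto
    show "(-1)^(i+k) * f i k * fdet m (\<lambda>i' j'. f (skip i i') (skip k j'))
      = (-1)^(i+k) * g i k * fdet m (\<lambda>i' j'. g (skip i i') (skip k j'))
      + (-1)^(i+k) * h i k * fdet m (\<lambda>i' j'. h (skip i i') (skip k j'))"
      unfolding g[OF i(1), symmetric] h[OF i(1), symmetric] assms(2)[OF i(2)] by (simp only: distrib_left distrib_right)
  qed
qed

lemma fdet_unit_column:
  assumes "k \<le> n" "r \<le> n" "\<And>i. i \<le> n \<Longrightarrow> f i k = (if i = r then 1 else 0)"
  shows "fdet (Suc n) f = (-1)^(r+k) *
           fdet n (\<lambda>i' j'. f (skip r i') (skip k j'))"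
proof -
  have "fdet (Suc n) f = (\<Sum>i\<le>n. if i = r then (-1)^(r+k) *
           fdet n (\<lambda>i' j'. f (skip r i') (skip k j')) else 0)"
    unfolding fdet_laplace_column[OF assms(1)] by (rule sum.cong) (use assms in auto)
  then show ?thesis using assms(2) by simp
qed

lemma fdet_mult: "fdet n f * fdet n g = fdet n (\<lambda>i j. \<Sum>l<n. f i l * g l j)"
proof -
  have "mat n n (\<lambda>(i,j). f i j) * mat n n (\<lambda>(i,j). g i j) = mat n n (\<lambda>(i,j). \<Sum>l<n. f i l * g l j)"
    by (rule eq_matI) (auto simp: scalar_prod_def lessThan_atLeast0)
  then show ?thesis unfolding fdet_def by (subst det_mult[symmetric, of _ n]) auto
qed

lemma fdet_lower_unitriangular:
  assumes "\<And>i j. i < j \<Longrightarrow> j < n \<Longrightarrow> f i j = 0" "\<And>i. i < n \<Longrightarrow> f i i = 1"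
  shows "fdet n f = 1"
proof -
  have "fdet n f = prod_list (diag_mat (mat n n (\<lambda>(i,j). f i j)))"
    unfolding fdet_def by (rule det_lower_triangular[of n]) (use assms in auto)
  also have "diag_mat (mat n n (\<lambda>(i,j). f i j)) = map (\<lambda>_. 1) [0..<n]"
    unfolding diag_mat_def by (auto simp: assms)
  finally show ?thesis by (simp add: map_replicate_const)
qed

lemma fdet_upper_unitriangular:
  assumes "\<And>i j. j < i \<Longrightarrow> i < n \<Longrightarrow> f i j = 0" "\<And>i. i < n \<Longrightarrow> f i i = 1"
  shows "fdet n f = 1"
  using fdet_lower_unitriangular[of n "\<lambda>i j. f j i"] assms by (metis fdet_transpose)

lemma fdet_block:
  assumes "\<And>i j. r \<le> i \<Longrightarrow> i < r + s \<Longrightarrow> j < r \<Longrightarrow> f i j = 0"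
  shows "fdet (r + s) f = fdet r f * fdet s (\<lambda>i j. f (r + i) (r + j))"
proof -
  have "mat (r+s) (r+s) (\<lambda>(i,j). f i j) =
     four_block_mat (mat r r (\<lambda>(i,j). f i j)) (mat r s (\<lambda>(i,j). f i (r+j))) (0\<^sub>m s r)
       (mat s s (\<lambda>(i,j). f (r+i) (r+j)))"
    by (rule eq_matI) (auto simp: assms)
  then show ?thesis
    unfolding fdet_def by (simp, subst det_four_block_mat_lower_left_zero[of _ r _ s]) auto
qed

text \<open>The vectors \<open>x 0, ..., x n\<close> live in dimension \<open>n\<close>, and their
  signed maximal minors are the coefficients of a linear dependency. Each coordinate of it is the
  Laplace expansion of a determinant in which that coordinate occurs twice.\<close>

lemma cramer_relation:
  fixes x :: "nat \<Rightarrow> nat \<Rightarrow> real"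
  assumes "i < n"
  shows "(\<Sum>k\<le>n. (-1)^k * fdet n (\<lambda>i j. x (skip k j) i) * x k i) = 0"
proof -
  define f where "f = (\<lambda>k i'. if i' = 0 then x k i else x k (i' - 1))"
  have "fdet (Suc n) f = 0"
    by (rule fdet_identical_columns[of 0 "Suc i"]) (use assms in \<open>auto simp: f_def\<close>)
  moreover have "fdet (Suc n) f = (\<Sum>k\<le>n. (-1)^k * fdet n (\<lambda>i j. x (skip k j) i) * x k i)"
    unfolding fdet_laplace_column[OF le0]
  proof (rule sum.cong, simp)
    fix k assume "k \<in> {..n}"
    have "fdet n (\<lambda>i' j'. f (skip k i') (skip 0 j'))
        = fdet n (\<lambda>i j. x (skip k i) j)"
      by (rule fdet_cong) (auto simp: f_def skip_def)
    also have "\<dots> = fdet n (\<lambda>i j. x (skip k j) i)"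
      by (rule fdet_transpose[symmetric])
    finally show "(-1)^(k+0) * f k 0 * fdet n (\<lambda>i' j'. f (skip k i') (skip 0 j'))
       = (-1)^k * fdet n (\<lambda>i j. x (skip k j) i) * x k i"
      by (simp add: f_def)
  qed
  ultimately show ?thesis by simp
qed

text \<open>Apply the linear form
  \<open>v \<mapsto> det (e, v, x 2, \<dots>, x m)\<close> to the linear dependency of
  the \<open>m + 2\<close> vectors \<open>x 0, \<dots>, x (m + 1)\<close>.\<close>

lemma plucker_three_term:
  fixes x :: "nat \<Rightarrow> nat \<Rightarrow> real" and e :: "nat \<Rightarrow> real"
  assumes "m \<ge> 1"

  shows "fdet (Suc m) (\<lambda>i j. x (if j = 0 then 0 else Suc j) i) * fdet (Suc m) (\<lambda>i j. if j = 0 then e i else x j i)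
    = fdet (Suc m) (\<lambda>i j. x (Suc j) i) * fdet (Suc m) (\<lambda>i j. if j = 0 then e i else x (if j = 1 then 0 else j) i)
     + fdet (Suc m) (\<lambda>i j. x j i) * fdet (Suc m) (\<lambda>i j. if j = 0 then e i else x (Suc j) i)"
proof -
  define L where "L v = fdet (Suc m) (\<lambda>i j. if j = 0 then e i else if j = 1 then v i else x j i)" for v :: "nat \<Rightarrow> real"
  define c where "c i = (-1)^(i+1) * fdet m (\<lambda>i' j'. if j' = 0 then e (skip i i')
                                                    else x (Suc j') (skip i i'))" for i
  have L: "L v = (\<Sum>i\<le>m. v i * c i)" for v
  proof -
    have "L v = (\<Sum>i\<le>m. (-1)^(i+1) * v i * fdet m (\<lambda>i' j'. if j' = 0 then e (skip i i')
                                                    else x (Suc j') (skip i i')))"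
      unfolding L_def by (subst fdet_laplace_column[of 1]) (use assms in \<open>auto intro!: sum.cong fdet_cong simp: skip_def\<close>)
    then show ?thesis by (simp add: c_def algebra_simps)
  qed
  define D where "D k = fdet (Suc m) (\<lambda>i j. x (skip k j) i)" for k
  have "(\<Sum>k\<le>Suc m. (-1)^k * D k * L (x k)) = (\<Sum>i\<le>m. c i * (\<Sum>k\<le>Suc m. (-1)^k * D k * x k i))"
    unfolding L sum_distrib_left by (subst sum.swap) (auto intro!: sum.cong simp: algebra_simps)
  also have "\<dots> = 0"
    using cramer_relation[of _ "Suc m" x] by (simp add: D_def)
  finally have S: "(\<Sum>k\<le>Suc m. (-1)^k * D k * L (x k)) = 0" .
  have z: "L (x k) = 0" if "2 \<le> k" "k \<le> m" for k
    unfolding L_def by (rule fdet_identical_columns[of 1 k]) (use that in auto)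
  have "(\<Sum>k\<le>Suc m. (-1)^k * D k * L (x k)) = (\<Sum>k\<in>{0,1,Suc m}. (-1)^k * D k * L (x k))"
    by (rule sum.mono_neutral_right) (use assms z in auto)
  also have "\<dots> = D 0 * L (x 0) - D 1 * L (x 1) + (-1)^Suc m * D (Suc m) * L (x (Suc m))"
    using assms by simp
  finally have eq: "D 1 * L (x 1) = D 0 * L (x 0) + (-1)^Suc m * D (Suc m) * L (x (Suc m))"
    using S by simp
  define h where "h = (\<lambda>i j. if j = 0 then e i else x (Suc j) i)"
  \<comment> \<open>In \<open>L\<close> the vector \<open>x (Suc m)\<close> stands in position 1.
    Moving it behind \<open>x m\<close> takes \<open>m - 1\<close> transpositions, which have the
    sign \<open>(-1)^Suc m\<close>.\<close>
  have front: "(-1)^Suc m * L (x (Suc m)) = fdet (Suc m) h"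
  proof -
    obtain q where m: "m = Suc q" using assms by (cases m) auto
    define A where "A = mat (Suc m) (Suc m) (\<lambda>(i,j). h i j)"
    have "det A = (-1)^(q*1) * det (mat (Suc m) (Suc m) (\<lambda>(i, j). A $$ (i, if j < 1 then j else if j < 1 + 1 then j + q else j - 1)))"
      by (rule det_swap_final_cols) (auto simp: A_def m)
    also have "mat (Suc m) (Suc m) (\<lambda>(i, j). A $$ (i, if j < 1 then j else if j < 1 + 1 then j + q else j - 1))
       = mat (Suc m) (Suc m) (\<lambda>(i,j). if j = 0 then e i else if j = 1 then x (Suc m) i else x j i)"
      by (rule eq_matI) (auto simp: A_def h_def m)
    finally show ?thesis
      by (simp add: fdet_def A_def L_def flip: m) (simp add: m)
  qed
  have D0: "D 0 = fdet (Suc m) (\<lambda>i j. x (Suc j) i)" by (simp add: D_def skip_def)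
  have D1: "D 1 = fdet (Suc m) (\<lambda>i j. x (if j = 0 then 0 else Suc j) i)"
    unfolding D_def by (rule fdet_cong) (auto simp: skip_def)
  have Dm: "D (Suc m) = fdet (Suc m) (\<lambda>i j. x j i)"
    unfolding D_def by (rule fdet_cong) (auto simp: skip_def)
  have L0: "L (x 0) = fdet (Suc m) (\<lambda>i j. if j = 0 then e i else x (if j = 1 then 0 else j) i)"
    unfolding L_def by (rule fdet_cong) auto
  have L1: "L (x 1) = fdet (Suc m) (\<lambda>i j. if j = 0 then e i else x j i)"
    unfolding L_def by (rule fdet_cong) auto
  have "D 1 * L (x 1) = D 0 * L (x 0) + D (Suc m) * fdet (Suc m) h"
    unfolding eq front[symmetric] by (simp only: mult.assoc mult.left_commute)
  then show ?thesis unfolding D0 D1 Dm L0 L1 h_def .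
qed

text \<open>The passage from \<open>f\<close> to \<open>h\<close> is right multiplication by an
  upper unitriangular matrix with the entries \<open>t l j\<close> above the diagonal.\<close>

lemma fdet_add_earlier_columns:
  assumes "\<And>i j. i < n \<Longrightarrow> j < n \<Longrightarrow> h i j = f i j + (\<Sum>l<j. t l j * f i l)"
  shows "fdet n h = fdet n f"
proof -
  define T where "T l j = (if l < j then t l j else if l = j then 1 else 0)" for l j
  have "fdet n T = 1"
    by (rule fdet_upper_unitriangular) (auto simp: T_def)
  moreover have "fdet n f * fdet n T = fdet n h"
    unfolding fdet_mult
  proof (rule fdet_cong)
    fix i j assume ij: "i < n" "j < n"
    have "(\<Sum>l<n. f i l * T l j) = (\<Sum>l<Suc j. f i l * T l j)"
      by (rule sum.mono_neutral_right) (use ij in \<open>auto simp: T_def\<close>)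
    also have "\<dots> = (\<Sum>l<j. t l j * f i l) + f i j"
      by (simp add: T_def mult.commute)
    finally show "(\<Sum>l<n. f i l * T l j) = h i j" using assms[OF ij] by simp
  qed
  ultimately show ?thesis by simp
qed

lemma fdet_add_earlier_rows:
  assumes "\<And>i j. i < n \<Longrightarrow> j < n \<Longrightarrow> h i j = f i j + (\<Sum>l<i. t l i * f l j)"
  shows "fdet n h = fdet n f"
  using fdet_add_earlier_columns[of n "\<lambda>i j. h j i" "\<lambda>i j. f j i" t] assms
  by (metis fdet_transpose)

lemma fdet_add_later_rows:
  assumes "\<And>i j. i < n \<Longrightarrow> j < n \<Longrightarrow> h i j = f i j + (\<Sum>l\<in>{i<..<n}. t l i * f l j)"
  shows "fdet n h = fdet n f"
proof -
  define T where "T i l = (if i < l then t l i else if l = i then 1 else 0)" for l i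
  have "fdet n T = 1"
    by (rule fdet_upper_unitriangular) (auto simp: T_def)
  moreover have "fdet n T * fdet n f = fdet n h"
    unfolding fdet_mult
  proof (rule fdet_cong)
    fix i j assume ij: "i < n" "j < n"
    have "(\<Sum>l<n. T i l * f l j) = (\<Sum>l\<in>{i..<n}. T i l * f l j)"
      by (rule sum.mono_neutral_right) (use ij in \<open>auto simp: T_def\<close>)
    also have "{i..<n} = insert i {i<..<n}" using ij by auto
    also have "(\<Sum>l\<in>\<dots>. T i l * f l j) = f i j + (\<Sum>l\<in>{i<..<n}. t l i * f l j)"
      by (simp add: T_def)
    finally show "(\<Sum>l<n. T i l * f l j) = h i j" using assms[OF ij] by simp
  qed
  ultimately show ?thesis by simp
qed

section \<open>The three-term relation for determinants of evolving states\<close>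

definition hop :: "(int \<Rightarrow> real) \<Rightarrow> int \<Rightarrow> real" where
  "hop g z = g (z - 1) + g (z + 1)"

text \<open>A path of lozenges crosses vertical unit edges, whose doubled heights change by one at each step;
  \<open>(hop ^^ N) g\<close> is the state \<open>g\<close> after \<open>N\<close> columns. Columns of the determinant are consecutive edges
  on one vertical line, so their doubled heights have step two.\<close>

definition wdet :: "nat \<Rightarrow> (nat \<Rightarrow> int \<Rightarrow> real) \<Rightarrow> nat \<Rightarrow> int \<Rightarrow> real" where
  "wdet n g N z = fdet n (\<lambda>i k. (hop ^^ N) (g i) (z + 2 * int k))"

lemma wdet_cong:
  assumes "\<And>i. i < n \<Longrightarrow> g i = h i"
  shows "wdet n g N z = wdet n h N z"
  unfolding wdet_def by (rule fdet_cong) (simp add: assms)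

lemma wdet_0 [simp]: "wdet 0 g N z = 1"
  by (simp add: wdet_def)

lemma wdet_skip_column:
  fixes c :: "nat \<Rightarrow> nat \<Rightarrow> real"
  assumes "r \<le> m"
  shows "fdet (Suc m) (\<lambda>i j. if j = 0 then (if i = r then 1 else 0) else c j i)
       = (-1)^r * fdet m (\<lambda>i j. c (Suc j) (skip r i))"
  by (subst fdet_unit_column[of 0 m r]) (use assms in \<open>auto simp: skip_def intro!: fdet_cong\<close>)

text \<open>One more step replaces each column by the sum of two neighbouring columns, which makes
  all six determinants maximal minors of few vectors. The extra vector of the Pluecker relation is
  the unit vector of row \<open>r\<close>; expanding along it deletes that row and so turns
  \<open>m + 1\<close> paths into \<open>m\<close>.\<close>

theorem wdet_three_term:
  fixes g :: "nat \<Rightarrow> int \<Rightarrow> real"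
  assumes r: "r \<le> m"
  defines "g' \<equiv> (\<lambda>i. g (skip r i))"
  shows "wdet m g' N (z + 2) * wdet (Suc m) g (Suc N) (z + 1) =
         wdet m g' (Suc N) (z + 1) * wdet (Suc m) g N (z + 2) +
         wdet m g' (Suc N) (z + 3) * wdet (Suc m) g N z"
proof (cases m)
  case 0
  then show ?thesis by (simp add: wdet_def) (simp add: hop_def add.commute)
next
  case (Suc m')
  define v where "v k i = (hop ^^ N) (g i) (z + 2 * int k)" for k i
  define u where "u k i = v k i + v (Suc k) i" for k i
  have u: "u k i = (hop ^^ Suc N) (g i) (z + 1 + 2 * int k)" for k i
    by (simp add: u_def v_def hop_def algebra_simps)
  \<comment> \<open>The vectors are \<open>u 0, v 1, u 1, ..., u m\<close>. Without
    \<open>v 1\<close> they are consecutive columns after \<open>Suc N\<close> steps. Without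
    \<open>u 0\<close> or without \<open>u m\<close> the single \<open>v 1\<close> allows the sums
    \<open>u k = v k + v (Suc k)\<close> to be reduced to consecutive columns after \<open>N\<close>
    steps.\<close>
  define x where "x k = (if k = 0 then u 0 else if k = 1 then v 1 else u (k - 1))" for k
  define e :: "nat \<Rightarrow> real" where "e i = (if i = r then 1 else 0)" for i
  have m: "m \<ge> 1" using Suc by simp
  note P = plucker_three_term[OF m, of x e]
  have O1: "fdet (Suc m) (\<lambda>i j. x (if j = 0 then 0 else Suc j) i) = wdet (Suc m) g (Suc N) (z + 1)"
    unfolding wdet_def by (rule fdet_cong) (auto simp: x_def u algebra_simps)
  have O2: "fdet (Suc m) (\<lambda>i j. x (Suc j) i) = wdet (Suc m) g N (z + 2)"
    unfolding wdet_def
    by (rule fdet_add_earlier_columns[where t = "\<lambda>l j. if Suc l = j then 1 else 0"])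
       (auto simp: x_def u_def v_def algebra_simps sum.delta gr0_conv_Suc sum.lessThan_Suc)
  have O3: "fdet (Suc m) (\<lambda>i j. x j i) = wdet (Suc m) g N z"
  proof -
    \<comment> \<open>In \<open>x 0 = v 0 + v 1\<close> the summand \<open>v 1\<close> repeats the
      column \<open>x 1\<close>.\<close>
    define y where "y j = (if j = 0 then v 0 else x j)" for j
    have "fdet (Suc m) (\<lambda>i j. x j i) = fdet (Suc m) (\<lambda>i j. y j i) + fdet (Suc m) (\<lambda>i j. if j = 0 then v 1 i else x j i)"
      by (rule fdet_column_add[of 0]) (auto simp: y_def x_def u_def)
    also have "fdet (Suc m) (\<lambda>i j. if j = 0 then v 1 i else x j i) = 0"
      by (rule fdet_identical_columns[of 0 1]) (use m in \<open>auto simp: x_def\<close>)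
    also have "fdet (Suc m) (\<lambda>i j. y j i) = wdet (Suc m) g N z"
      unfolding wdet_def
      by (rule fdet_add_earlier_columns[where t = "\<lambda>l j. if Suc l = j \<and> 2 \<le> j then 1 else 0"])
         (auto simp: y_def x_def u_def v_def gr0_conv_Suc sum.lessThan_Suc algebra_simps)
    finally show ?thesis by simp
  qed
  have E1: "fdet (Suc m) (\<lambda>i j. if j = 0 then e i else x j i) = (-1)^r * wdet m g' N (z + 2)"
    unfolding e_def wdet_skip_column[OF r] wdet_def g'_def
    by (rule arg_cong[where f = "(*) _"], rule fdet_add_earlier_columns[where t = "\<lambda>l j. if Suc l = j then 1 else 0"])
       (auto simp: x_def u_def v_def gr0_conv_Suc sum.lessThan_Suc algebra_simps)
  have E2: "fdet (Suc m) (\<lambda>i j. if j = 0 then e i else x (if j = 1 then 0 else j) i) = (-1)^r * wdet m g' (Suc N) (z + 1)"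
    unfolding e_def wdet_skip_column[OF r, of "\<lambda>j i. x (if j = 1 then 0 else j) i"] wdet_def g'_def
    by (rule arg_cong[where f = "(*) _"], rule fdet_cong) (auto simp: x_def u algebra_simps)
  have E3: "fdet (Suc m) (\<lambda>i j. if j = 0 then e i else x (Suc j) i) = (-1)^r * wdet m g' (Suc N) (z + 3)"
    unfolding e_def wdet_skip_column[OF r, of "\<lambda>j i. x (Suc j) i"] wdet_def g'_def
    by (rule arg_cong[where f = "(*) _"], rule fdet_cong) (auto simp: x_def u algebra_simps)
  have "(-1)^r * (wdet m g' N (z + 2) * wdet (Suc m) g (Suc N) (z + 1)) =
        (-1)^r * (wdet m g' (Suc N) (z + 1) * wdet (Suc m) g N (z + 2) +
         wdet m g' (Suc N) (z + 3) * wdet (Suc m) g N z)"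
    using P unfolding O1 O2 O3 E1 E2 E3 by (simp add: distrib_left mult_ac)
  then show ?thesis by simp
qed

section \<open>Lattice walks on the line\<close>

lemma fdet_zero_row:
  assumes "r < n" "\<And>j. j < n \<Longrightarrow> f r j = 0"
  shows "fdet n f = 0"
proof -
  obtain m where n: "n = Suc m" using assms(1) by (cases n) auto
  have "fdet n (\<lambda>i j. f j i) = 0"
    unfolding n by (subst fdet_laplace_column[of r]) (use assms n in auto)
  then show ?thesis by (metis fdet_transpose)
qed

text \<open>The first \<open>a + 1\<close> columns are supported on only \<open>a\<close>
  rows.\<close>

lemma fdet_zero_block:
  assumes "a < n" "\<And>i j. a \<le> i \<Longrightarrow> i < n \<Longrightarrow> j \<le> a \<Longrightarrow> f i j = 0"
  shows "fdet n f = 0"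
proof -
  have "fdet (Suc a + (n - Suc a)) f = fdet (Suc a) f * fdet (n - Suc a) (\<lambda>i j. f (Suc a + i) (Suc a + j))"
    by (rule fdet_block) (use assms in auto)
  moreover have "fdet (Suc a) f = 0"
    by (rule fdet_zero_row[of a]) (use assms in auto)
  ultimately show ?thesis using assms(1) by simp
qed

lemma fdet_reverse: "fdet n (\<lambda>i j. f (n - 1 - i) (n - 1 - j)) = fdet n f"
proof -
  define J :: "nat \<Rightarrow> nat \<Rightarrow> real" where "J i j = (if i + j = n - 1 then 1 else 0)" for i j
  have J1: "(\<Sum>l<n. J i l * g l) = g (n - 1 - i)" if "i < n" for i g
  proof -
    have "(\<Sum>l<n. J i l * g l) = (\<Sum>l<n. if l = n - 1 - i then g l else 0)"
      by (rule sum.cong) (use that in \<open>auto simp: J_def\<close>)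
    also have "\<dots> = g (n - 1 - i)" using that by simp
    finally show ?thesis .
  qed
  have J2: "(\<Sum>l<n. g l * J l i) = g (n - 1 - i)" if "i < n" for i g
    using J1[OF that, of g] by (simp add: J_def add.commute mult.commute)
  have "fdet n J * fdet n J = fdet n (\<lambda>i j. if i = j then 1 else 0)"
    unfolding fdet_mult by (rule fdet_cong) (auto simp: J1, auto simp: J_def)
  also have "\<dots> = 1" by (rule fdet_lower_unitriangular) auto
  finally have JJ: "fdet n J * fdet n J = 1" .
  have "fdet n J * fdet n f * fdet n J = fdet n (\<lambda>i j. f (n - 1 - i) (n - 1 - j))"
    unfolding fdet_mult by (rule fdet_cong) (auto simp: J1 J2)
  moreover have "fdet n J * fdet n f * fdet n J = (fdet n J * fdet n J) * fdet n f" by (simp only: mult_ac)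
  ultimately show ?thesis using JJ by simp
qed

lemma hop_pow_Suc: "(hop ^^ Suc N) f z = (hop ^^ N) f (z - 1) + (hop ^^ N) f (z + 1)"
  unfolding funpow.simps o_apply by (rule hop_def)

lemma hop_pow_add: "(hop ^^ N) (\<lambda>z. f z + g z) = (\<lambda>z. (hop ^^ N) f z + (hop ^^ N) g z)"
  by (induction N) (auto simp: hop_def fun_eq_iff)

lemma hop_pow_scale: "(hop ^^ N) (\<lambda>z. c * f z) = (\<lambda>z. c * (hop ^^ N) f z)"
  by (induction N) (auto simp: hop_def fun_eq_iff algebra_simps)

lemma hop_pow_0 [simp]: "(hop ^^ N) (\<lambda>z. 0) = (\<lambda>z. 0)"
  by (induction N) (auto simp: hop_def fun_eq_iff)

lemma hop_pow_sum: "finite S \<Longrightarrow> (hop ^^ N) (\<lambda>z. \<Sum>l\<in>S. t l * f l z) = (\<lambda>z. \<Sum>l\<in>S. t l * (hop ^^ N) (f l) z)"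
  by (induction S rule: finite_induct) (auto simp: hop_pow_add hop_pow_scale)

lemma hop_pow_Suc_right: "(hop ^^ N) (hop g) = (hop ^^ Suc N) g"
  by (simp add: funpow_swap1)

lemma hop_pow_reflect: "(hop ^^ N) (\<lambda>z. g (- z)) z = (hop ^^ N) g (- z)"
proof (induction N arbitrary: z)
  case (Suc N)
  then show ?case by (simp add: hop_pow_Suc del: funpow.simps add.commute)
qed simp

lemma hop_pow_cong:
  assumes "\<And>w. \<bar>w - z\<bar> \<le> int N \<Longrightarrow> f w = g w"
  shows "(hop ^^ N) f z = (hop ^^ N) g z"
  using assms
proof (induction N arbitrary: z)
  case (Suc N)
  have "(hop ^^ N) f (z - 1) = (hop ^^ N) g (z - 1)" "(hop ^^ N) f (z + 1) = (hop ^^ N) g (z + 1)"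
    by (rule Suc.IH, rule Suc.prems, simp)+
  then show ?case by (simp add: hop_pow_Suc del: funpow.simps)
qed simp

lemma hop_pow_outside:
  assumes "\<And>w. \<bar>w - z\<bar> \<le> int N \<Longrightarrow> f w = 0"
  shows "(hop ^^ N) f z = 0"
  using hop_pow_cong[of z N f "\<lambda>z. 0"] assms by simp

definition delta :: "int \<Rightarrow> int \<Rightarrow> real" where
  "delta s z = (if z = s then 1 else 0)"

text \<open>A start and its negative mirror image. \<open>hop\<close> preserves odd functions, which
  vanish at 0, so on the side of \<open>s\<close> the evolution counts walks absorbed at 0.\<close>

definition odd_pair :: "int \<Rightarrow> int \<Rightarrow> real" where
  "odd_pair s z = delta s z - delta (- s) z"

lemma hop_dlt: "hop (delta s) = (\<lambda>z. delta (s - 1) z + delta (s + 1) z)"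
  by (auto simp: hop_def delta_def fun_eq_iff)

lemma hop_anti: "hop (odd_pair s) = (\<lambda>z. odd_pair (s - 1) z + odd_pair (s + 1) z)"
  by (auto simp: hop_def odd_pair_def delta_def fun_eq_iff)

lemma odd_pair_0 [simp]: "odd_pair 0 = (\<lambda>z. 0)"
  by (auto simp: odd_pair_def)

lemma odd_pair_uminus: "odd_pair (- s) z = odd_pair s (- z)"
  by (auto simp: odd_pair_def delta_def)

lemma hop_pow_anti_odd: "(hop ^^ N) (odd_pair s) (- z) = - (hop ^^ N) (odd_pair s) z"
proof -
  have "odd_pair s (- z) = - 1 * odd_pair s z" for z by (auto simp: odd_pair_def delta_def)
  then have "(hop ^^ N) (\<lambda>z. odd_pair s (- z)) z = (hop ^^ N) (\<lambda>z. - 1 * odd_pair s z) z" by simp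
  then show ?thesis unfolding hop_pow_reflect hop_pow_scale by simp
qed

lemma hop_pow_anti_at_0 [simp]: "(hop ^^ N) (odd_pair s) 0 = 0"
  using hop_pow_anti_odd[of N s 0] by simp

lemma hop_pow_anti_parity: "odd (s + int N + z) \<Longrightarrow> (hop ^^ N) (odd_pair s) z = 0"
proof (induction N arbitrary: z)
  case 0
  then show ?case by (auto simp: odd_pair_def delta_def)
next
  case (Suc N)
  have e: "s + int N + (z - 1) = s + int (Suc N) + z - 2" "s + int N + (z + 1) = s + int (Suc N) + z"
    by simp_all
  have "odd (s + int N + (z - 1))" "odd (s + int N + (z + 1))"
    unfolding e using Suc.prems by presburger+
  then have "(hop ^^ N) (odd_pair s) (z - 1) = 0" "(hop ^^ N) (odd_pair s) (z + 1) = 0"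
    using Suc.IH by blast+
  then show ?case by (simp add: hop_pow_Suc del: funpow.simps)
qed

lemma hop_pow_dlt_extreme:
  "(hop ^^ N) (delta s) (s + int N) = 1" "(hop ^^ N) (delta s) (s - int N) = 1"
proof -
  show "(hop ^^ N) (delta s) (s + int N) = 1"
  proof (induction N)
    case (Suc N)
    have "(hop ^^ N) (delta s) (s + int N + 2) = 0"
      by (rule hop_pow_outside) (auto simp: delta_def)
    then show ?case using Suc by (simp add: hop_pow_Suc algebra_simps del: funpow.simps)
  qed (simp add: delta_def)
  show "(hop ^^ N) (delta s) (s - int N) = 1"
  proof (induction N)
    case (Suc N)
    have "(hop ^^ N) (delta s) (s - int N - 2) = 0"
      by (rule hop_pow_outside) (auto simp: delta_def)
    then show ?case using Suc by (simp add: hop_pow_Suc algebra_simps del: funpow.simps)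
  qed (simp add: delta_def)
qed

text \<open>By the reflection principle this counts the walks of length \<open>t\<close> from \<open>s\<close> to \<open>z\<close> that avoid \<open>0\<close>.
  For \<open>s = 0\<close> it is the state of the path that starts at the tip of the row of bowties.\<close>

definition walled :: "nat \<Rightarrow> int \<Rightarrow> int \<Rightarrow> real" where
  "walled t s z = (if s = 0 then delta 0 z else if 0 < s * z then (hop ^^ t) (odd_pair s) z else 0)"

lemma walled_uminus: "walled t (- s) = (\<lambda>z. walled t s (- z))"
proof
  fix z
  have "odd_pair (- s) = (\<lambda>z. odd_pair s (- z))" by (auto simp: odd_pair_uminus)
  then show "walled t (- s) z = walled t s (- z)"
    by (simp add: walled_def delta_def hop_pow_reflect)
qed

lemma walled_0: "walled 0 s = delta s"
  by (auto simp: walled_def fun_eq_iff odd_pair_def delta_def mult_pos_pos mult_neg_neg zero_less_mult_iff)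

lemma hop_Psi_pos:
  assumes "s > 0"
  shows "hop (walled t s) z = (if z > 0 then (hop ^^ Suc t) (odd_pair s) z else if z = 0 then (hop ^^ t) (odd_pair s) 1 else 0)"
proof -
  consider "z > 1" | "z = 1" | "z = 0" | "z < 0" by linarith
  then show ?thesis
    by cases (use assms in \<open>auto simp: hop_def walled_def zero_less_mult_iff\<close>)
qed

text \<open>A free step after the wall amounts to the same step taken at the start, except for the
  walks that land on the axis. This leakage is a multiple of \<open>delta 0\<close>, the state of
  the path that starts at the tip, so a row operation can remove it.\<close>

lemma hop_Psi_pos_step:
  assumes "s > 0"
  shows "hop (walled t s) = (\<lambda>z. (if s > 1 then walled t (s - 1) z else 0) + walled t (s + 1) z + (hop ^^ t) (odd_pair s) 1 * delta 0 z)"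
proof
  fix z
  have "(hop ^^ Suc t) (odd_pair s) z = (hop ^^ t) (odd_pair (s - 1)) z + (hop ^^ t) (odd_pair (s + 1)) z"
    unfolding hop_pow_Suc_right[symmetric] hop_anti hop_pow_add ..
  moreover have "s = 1 \<or> s > 1" using assms by linarith
  ultimately show "hop (walled t s) z = (if s > 1 then walled t (s - 1) z else 0) + walled t (s + 1) z + (hop ^^ t) (odd_pair s) 1 * delta 0 z"
    unfolding hop_Psi_pos[OF assms] using assms
    by (auto simp: walled_def delta_def zero_less_mult_iff)
qed

lemma hop_Psi_neg_step:
  assumes "s < 0"
  shows "hop (walled t s) = (\<lambda>z. (if s < -1 then walled t (s + 1) z else 0) + walled t (s - 1) z + (hop ^^ t) (odd_pair (- s)) 1 * delta 0 z)"
proof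
  fix z
  have "hop (walled t s) z = hop (walled t (- s)) (- z)"
    using hop_pow_reflect[of 1 "walled t (- s)" z] walled_uminus[of t "- s"] by simp
  also have "\<dots> = (if - s > 1 then walled t (- s - 1) (- z) else 0) + walled t (- s + 1) (- z) + (hop ^^ t) (odd_pair (- s)) 1 * delta 0 (- z)"
    using hop_Psi_pos_step[of "- s" t] assms by simp
  also have "walled t (- s - 1) (- z) = walled t (s + 1) z"
    using walled_uminus[of t "- s - 1"] by (simp add: fun_eq_iff add.commute)
  also have "walled t (- s + 1) (- z) = walled t (s - 1) z"
    using walled_uminus[of t "- s + 1"] by (simp add: fun_eq_iff)
  finally show "hop (walled t s) z = (if s < -1 then walled t (s + 1) z else 0) + walled t (s - 1) z + (hop ^^ t) (odd_pair (- s)) 1 * delta 0 z"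
    by (simp add: delta_def)
qed

lemma walled_Suc_pos:
  assumes "s > 0"
  shows "walled (Suc t) s = (\<lambda>z. (if s > 1 then walled t (s - 1) z else 0) + walled t (s + 1) z)"
proof
  fix z
  have "(hop ^^ Suc t) (odd_pair s) z = (hop ^^ t) (odd_pair (s - 1)) z + (hop ^^ t) (odd_pair (s + 1)) z"
    unfolding hop_pow_Suc_right[symmetric] hop_anti hop_pow_add ..
  moreover have "s = 1 \<or> s > 1" using assms by linarith
  ultimately show "walled (Suc t) s z = (if s > 1 then walled t (s - 1) z else 0) + walled t (s + 1) z"
    using assms by (auto simp: walled_def zero_less_mult_iff)
qed

lemma walled_Suc_neg:
  assumes "s < 0"
  shows "walled (Suc t) s = (\<lambda>z. (if s < -1 then walled t (s + 1) z else 0) + walled t (s - 1) z)"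
proof
  fix z
  have "walled (Suc t) s z = walled (Suc t) (- s) (- z)"
    using walled_uminus[of "Suc t" "- s"] by simp
  also have "\<dots> = (if - s > 1 then walled t (- s - 1) (- z) else 0) + walled t (- s + 1) (- z)"
    using walled_Suc_pos[of "- s" t] assms by simp
  also have "walled t (- s - 1) (- z) = walled t (s + 1) z"
    using walled_uminus[of t "- s - 1"] by (simp add: fun_eq_iff add.commute)
  also have "walled t (- s + 1) (- z) = walled t (s - 1) z"
    using walled_uminus[of t "- s + 1"] by (simp add: fun_eq_iff)
  finally show "walled (Suc t) s z = (if s < -1 then walled t (s + 1) z else 0) + walled t (s - 1) z"
    by simp
qed

text \<open>After \<open>t\<close> steps the walk is at a height of the parity of
  \<open>s + t\<close>, hence even and nonzero. Its next step cannot reach 0, so free and walled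
  steps agree.\<close>

lemma hop_Psi_even:
  assumes "even (s + int t)" "s \<noteq> 0"
  shows "hop (walled t s) = walled (Suc t) s"
proof (cases "s > 0")
  case True
  have "(hop ^^ t) (odd_pair s) 1 = 0" by (rule hop_pow_anti_parity) (use assms in auto)
  then show ?thesis using hop_Psi_pos_step[OF True, of t] walled_Suc_pos[OF True, of t] by simp
next
  case False
  then have s: "s < 0" using assms by simp
  have "(hop ^^ t) (odd_pair (- s)) 1 = 0" by (rule hop_pow_anti_parity) (use assms in auto)
  then show ?thesis using hop_Psi_neg_step[OF s, of t] walled_Suc_neg[OF s, of t] by simp
qed

lemma wdet_add_earlier_rows:
  assumes "\<And>i. i < n \<Longrightarrow> g i = (\<lambda>z. f i z + (\<Sum>l<i. t l i * f l z))"
  shows "wdet n g N z = wdet n f N z"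
  unfolding wdet_def
  by (rule fdet_add_earlier_rows[where t = t]) (simp add: assms hop_pow_add hop_pow_sum)

lemma wdet_add_later_rows:
  assumes "\<And>i. i < n \<Longrightarrow> g i = (\<lambda>z. f i z + (\<Sum>l\<in>{i<..<n}. t l i * f l z))"
  shows "wdet n g N z = wdet n f N z"
  unfolding wdet_def
  by (rule fdet_add_later_rows[where t = t]) (simp add: assms hop_pow_add hop_pow_sum)

lemma wdet_hop: "wdet n (\<lambda>i. hop (g i)) N z = wdet n g (Suc N) z"
  unfolding wdet_def hop_pow_Suc_right ..

section \<open>The starting rows of even and odd hexagons span each other's states\<close>

definition rowstate :: "nat \<Rightarrow> nat \<Rightarrow> nat \<Rightarrow> int \<Rightarrow> real" where
  "rowstate p t i = walled t (2 * int i + 1 - int p)"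

text \<open>The starting points on the left side have doubled heights \<open>2 i + 1 - p\<close> relative to the axis, and
  the first \<open>2 d\<close> steps are walled.\<close>

definition rows_det :: "nat \<Rightarrow> nat \<Rightarrow> nat \<Rightarrow> int \<Rightarrow> real" where
  "rows_det p d N z = wdet p (rowstate p (2 * d)) N z"

text \<open>One step after the last wall, the states of the \<open>2 a\<close> paths together with a new path at height \<open>0\<close>
  span the same space as the states of the \<open>2 a + 1\<close> paths of the odd hexagon.\<close>

lemma hop_rows_even_to_odd:
  defines "g \<equiv> (\<lambda>a t j. if j = a then delta 0 else hop (rowstate (2 * a) t (if j < a then j else j - 1)))"
  shows "wdet (2 * a + 1) (g a t) N z = wdet (2 * a + 1) (rowstate (2 * a + 1) t) N z"
proof -
  define q where "q = rowstate (2 * a + 1) t"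
  have q: "q j = walled t (2 * int j - 2 * int a)" for j
    by (simp add: q_def rowstate_def)
  have qa: "q a = delta 0" by (simp add: q walled_def fun_eq_iff)
  \<comment> \<open>Halfway stage: only the rows below the axis are already reduced. Each row
    contains its neighbour nearer to the axis, so rows below the axis are reduced by later rows and
    rows above it by earlier rows. On both sides row \<open>a\<close>, which is
    \<open>delta 0\<close>, absorbs the leakage \<open>c\<close>.\<close>
  define f where "f j = (if j < a then q j else g a t j)" for j
  define c where "c i = (hop ^^ t) (odd_pair (\<bar>2 * int i + 1 - 2 * int a\<bar>)) 1" for i
  define t1 where "t1 l i = (if l = Suc i \<and> Suc i < a then 1 else 0) + (if l = a \<and> i < a then c i else 0)" for l i
  define t2 where "t2 l i = (if l = i - 1 \<and> Suc a < i then 1 else 0) + (if l = a \<and> a < i then c (i - 1) else 0)" for l i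
  have "wdet (2 * a + 1) (g a t) N z = wdet (2 * a + 1) f N z"
  proof (rule wdet_add_later_rows[where t = t1])
    fix i assume i: "i < 2 * a + 1"
    show "g a t i = (\<lambda>z. f i z + (\<Sum>l\<in>{i<..<2*a+1}. t1 l i * f l z))"
    proof (cases "i < a")
      case False
      then show ?thesis by (auto simp: f_def t1_def)
    next
      case True
      have s: "2 * int i + 1 - 2 * int a < 0" using True by linarith
      have "(\<Sum>l\<in>{i<..<2*a+1}. t1 l i * f l z) = (if Suc i < a then q (Suc i) z else 0) + c i * delta 0 z" for z
      proof -
        have "(\<Sum>l\<in>{i<..<2*a+1}. t1 l i * f l z) =
          (\<Sum>l\<in>{i<..<2*a+1}. if l = Suc i then (if Suc i < a then f l z else 0) else 0) +
          (\<Sum>l\<in>{i<..<2*a+1}. if l = a then c i * f l z else 0)"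
          unfolding sum.distrib[symmetric] by (rule sum.cong) (use True in \<open>auto simp: t1_def algebra_simps\<close>)
        also have "\<dots> = (if Suc i < a then q (Suc i) z else 0) + c i * delta 0 z"
          using True by (auto simp: f_def g_def)
        finally show ?thesis .
      qed
      moreover have "g a t i = (\<lambda>z. (if Suc i < a then q (Suc i) z else 0) + q i z + c i * delta 0 z)"
      proof -
        have e: "2 * int i + 1 - 2 * int a + 1 = 2 * int (Suc i) - 2 * int a"
          "2 * int i + 1 - 2 * int a - 1 = 2 * int i - 2 * int a"
          "- (2 * int i + 1 - 2 * int a) = \<bar>2 * int i + 1 - 2 * int a\<bar>" using s by simp_all
        have b: "(2 * int i + 1 - 2 * int a < -1) = (Suc i < a)" by linarith
        have "g a t i = hop (walled t (2 * int i + 1 - 2 * int a))"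
          using True by (simp add: g_def rowstate_def)
        then show ?thesis unfolding hop_Psi_neg_step[OF s] e b q c_def .
      qed
      ultimately show ?thesis using True by (simp add: f_def fun_eq_iff)
    qed
  qed
  also have "\<dots> = wdet (2 * a + 1) q N z"
  proof (rule wdet_add_earlier_rows[where t = t2])
    fix i assume i: "i < 2 * a + 1"
    show "f i = (\<lambda>z. q i z + (\<Sum>l<i. t2 l i * q l z))"
    proof (cases "a < i")
      case False
      then show ?thesis by (cases "i = a") (auto simp: f_def t2_def g_def qa)
    next
      case True
      have s: "2 * int (i - 1) + 1 - 2 * int a > 0" using True by linarith
      have i1: "int (i - 1) = int i - 1" using True by linarith
      have "(\<Sum>l<i. t2 l i * q l z) = (if Suc a < i then q (i - 1) z else 0) + c (i - 1) * delta 0 z" for z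
      proof -
        have "(\<Sum>l<i. t2 l i * q l z) =
          (\<Sum>l<i. if l = i - 1 then (if Suc a < i then q l z else 0) else 0) +
          (\<Sum>l<i. if l = a then c (i - 1) * q l z else 0)"
          unfolding sum.distrib[symmetric] by (rule sum.cong) (use True in \<open>auto simp: t2_def algebra_simps\<close>)
        also have "\<dots> = (if Suc a < i then q (i - 1) z else 0) + c (i - 1) * delta 0 z"
          using True by (auto simp: qa)
        finally show ?thesis .
      qed
      moreover have "f i = (\<lambda>z. (if Suc a < i then q (i - 1) z else 0) + q i z + c (i - 1) * delta 0 z)"
      proof -
        have e: "2 * int (i - 1) + 1 - 2 * int a - 1 = 2 * int (i - 1) - 2 * int a"
          "2 * int (i - 1) + 1 - 2 * int a + 1 = 2 * int i - 2 * int a" using i1 by simp_all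
        have e': "\<bar>2 * int (i - 1) + 1 - 2 * int a\<bar> = 2 * int (i - 1) + 1 - 2 * int a" using s by simp
        have b: "(2 * int (i - 1) + 1 - 2 * int a > 1) = (Suc a < i)" using True by linarith
        have "f i = hop (walled t (2 * int (i - 1) + 1 - 2 * int a))"
          using True by (simp add: f_def g_def rowstate_def)
        then show ?thesis unfolding hop_Psi_pos_step[OF s] c_def e' b unfolding e q .
      qed
      ultimately show ?thesis using True by (simp add: fun_eq_iff)
    qed
  qed
  finally show ?thesis by (simp add: q_def)
qed

text \<open>The deleted row is that of the tip path. The remaining rows are the even ones after one
  \<open>hop\<close>, which is why the even determinants carry one step more.\<close>

theorem rows_det_three_term_same_depth:
  "rows_det (2 * a) d (Suc N) (z + 2) * rows_det (2 * a + 1) d (Suc N) (z + 1) =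
   rows_det (2 * a) d (Suc (Suc N)) (z + 1) * rows_det (2 * a + 1) d N (z + 2) +
   rows_det (2 * a) d (Suc (Suc N)) (z + 3) * rows_det (2 * a + 1) d N z"
proof -
  define g where "g j = (if j = a then delta 0 else hop (rowstate (2 * a) (2 * d) (if j < a then j else j - 1)))" for j
  have O: "wdet (Suc (2 * a)) g N z = rows_det (2 * a + 1) d N z" for N z
    using hop_rows_even_to_odd[of a "2 * d" N z] unfolding g_def rows_det_def by simp
  have E: "wdet (2 * a) (\<lambda>i. g (skip a i)) N z = rows_det (2 * a) d (Suc N) z" for N z
    unfolding rows_det_def wdet_hop[symmetric] by (rule wdet_cong) (auto simp: g_def skip_def)
  show ?thesis
    using wdet_three_term[of a "2 * a" g N z] unfolding O E by simp
qed

text \<open>The walls force the first step, which moves the \<open>2 a\<close> starting points away from the axis onto the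
  starting points of the odd hexagon except its middle one.\<close>

lemma rows_det_Suc_depth:
  "rows_det (2 * a) (Suc d) N z = wdet (2 * a) (\<lambda>i. rowstate (2 * a + 1) (2 * d) (skip a i)) (Suc N) z"
proof -
  define q where "q = rowstate (2 * a + 1) (2 * d)"
  define Q where "Q i = walled (Suc (2 * d)) (2 * int (skip a i) - 2 * int a)" for i
  define g where "g i = rowstate (2 * a) (2 * Suc d) i" for i
  have hq: "hop (q (skip a i)) = Q i" for i
  proof -
    have "hop (q (skip a i)) = hop (walled (2 * d) (2 * int (skip a i) - 2 * int a))"
      by (simp add: q_def rowstate_def)
    also have "\<dots> = Q i" unfolding Q_def
      by (rule hop_Psi_even) (auto simp: skip_def)
    finally show ?thesis .
  qed
  have g: "g i = walled (Suc (Suc (2 * d))) (2 * int i + 1 - 2 * int a)" for i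
    by (simp add: g_def rowstate_def)
  \<comment> \<open>Again the two sides of the axis require opposite orders of elimination; inside
    the wall there is no leakage.\<close>
  define f where "f i = (if i < a then Q i else g i)" for i
  have "wdet (2 * a) g N z = wdet (2 * a) f N z"
  proof (rule wdet_add_later_rows[where t = "\<lambda>l i. if l = Suc i \<and> Suc i < a then 1 else 0"])
    fix i assume i: "i < 2 * a"
    show "g i = (\<lambda>z. f i z + (\<Sum>l\<in>{i<..<2*a}. (if l = Suc i \<and> Suc i < a then 1 else 0) * f l z))"
    proof (cases "i < a")
      case False
      then show ?thesis by (auto simp: f_def)
    next
      case True
      have s: "2 * int i + 1 - 2 * int a < 0" using True by linarith
      have "(\<Sum>l\<in>{i<..<2*a}. (if l = Suc i \<and> Suc i < a then 1 else 0) * f l z) = (if Suc i < a then Q (Suc i) z else 0)" for z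
      proof -
        have "(\<Sum>l\<in>{i<..<2*a}. (if l = Suc i \<and> Suc i < a then 1 else 0) * f l z) =
          (\<Sum>l\<in>{i<..<2*a}. if l = Suc i then (if Suc i < a then f l z else 0) else 0)"
          by (rule sum.cong) auto
        also have "\<dots> = (if Suc i < a then Q (Suc i) z else 0)"
          using True by (auto simp: f_def)
        finally show ?thesis .
      qed
      moreover have "g i = (\<lambda>z. (if Suc i < a then Q (Suc i) z else 0) + Q i z)"
      proof -
        have e: "2 * int i + 1 - 2 * int a + 1 = 2 * int (Suc i) - 2 * int a"
          "2 * int i + 1 - 2 * int a - 1 = 2 * int i - 2 * int a" by simp_all
        have b: "(2 * int i + 1 - 2 * int a < -1) = (Suc i < a)" by linarith
        show ?thesis using True unfolding g walled_Suc_neg[OF s] b unfolding e by (auto simp: Q_def skip_def)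
      qed
      ultimately show ?thesis using True by (simp add: f_def fun_eq_iff)
    qed
  qed
  also have "\<dots> = wdet (2 * a) Q N z"
  proof (rule wdet_add_earlier_rows[where t = "\<lambda>l i. if l = i - 1 \<and> a < i then 1 else 0"])
    fix i assume i: "i < 2 * a"
    show "f i = (\<lambda>z. Q i z + (\<Sum>l<i. (if l = i - 1 \<and> a < i then 1 else 0) * Q l z))"
    proof (cases "a \<le> i")
      case False
      then show ?thesis by (auto simp: f_def)
    next
      case True
      have s: "2 * int i + 1 - 2 * int a > 0" using True by linarith
      have "(\<Sum>l<i. (if l = i - 1 \<and> a < i then 1 else 0) * Q l z) = (if a < i then Q (i - 1) z else 0)" for z
      proof -
        have "(\<Sum>l<i. (if l = i - 1 \<and> a < i then 1 else 0) * Q l z) =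
          (\<Sum>l<i. if l = i - 1 then (if a < i then Q l z else 0) else 0)"
          by (rule sum.cong) auto
        also have "\<dots> = (if a < i then Q (i - 1) z else 0)"
          by auto
        finally show ?thesis .
      qed
      moreover have "g i = (\<lambda>z. (if a < i then Q (i - 1) z else 0) + Q i z)"
      proof -
        have e: "2 * int i + 1 - 2 * int a - 1 = 2 * int i - 2 * int a"
          "2 * int i + 1 - 2 * int a + 1 = 2 * int (Suc i) - 2 * int a" by simp_all
        have b: "(2 * int i + 1 - 2 * int a > 1) = (a < i)" by linarith
        show ?thesis using True unfolding g walled_Suc_pos[OF s] b unfolding e by (auto simp: Q_def skip_def fun_eq_iff)
      qed
      ultimately show ?thesis using True by (simp add: f_def fun_eq_iff)
    qed
  qed
  also have "\<dots> = wdet (2 * a) (\<lambda>i. hop (q (skip a i))) N z"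
    unfolding hq ..
  finally show ?thesis unfolding wdet_hop rows_det_def q_def g_def .
qed

theorem rows_det_three_term_next_depth:
  "rows_det (2 * a) (Suc d) N (z + 2) * rows_det (2 * a + 1) d (Suc (Suc N)) (z + 1) =
   rows_det (2 * a) (Suc d) (Suc N) (z + 1) * rows_det (2 * a + 1) d (Suc N) (z + 2) +
   rows_det (2 * a) (Suc d) (Suc N) (z + 3) * rows_det (2 * a + 1) d (Suc N) z"
  using wdet_three_term[of a "2 * a" "rowstate (2 * a + 1) (2 * d)" "Suc N" z]
  unfolding rows_det_Suc_depth by (simp add: rows_det_def)

text \<open>One step turns the \<open>p\<close> starting points into sums of neighbours among the
  \<open>p + 1\<close> starting points of the longer side. Adjoining the lowest of these,
  \<open>- int p\<close>, recovers their whole span.\<close>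

theorem rows_det_three_term_undented:
  "rows_det p 0 (Suc N) (z + 2) * rows_det (Suc p) 0 (Suc N) (z + 1) =
   rows_det p 0 (Suc (Suc N)) (z + 1) * rows_det (Suc p) 0 N (z + 2) +
   rows_det p 0 (Suc (Suc N)) (z + 3) * rows_det (Suc p) 0 N z"
proof -
  define g where "g j = (if j = 0 then delta (- int p) else hop (rowstate p 0 (j - 1)))" for j
  have O: "wdet (Suc p) g N z = rows_det (Suc p) 0 N z" for N z
    unfolding rows_det_def
  proof (rule wdet_add_earlier_rows[where t = "\<lambda>l i. if l = i - 1 then 1 else 0"])
    fix i
    show "g i = (\<lambda>z. rowstate (Suc p) (2 * 0) i z + (\<Sum>l<i. (if l = i - 1 then 1 else 0) * rowstate (Suc p) (2 * 0) l z))"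
    proof (cases i)
      case 0
      then show ?thesis by (simp add: g_def rowstate_def walled_0)
    next
      case (Suc j)
      have "(\<Sum>l<i. (if l = i - 1 then 1 else 0) * rowstate (Suc p) (2 * 0) l z) = (\<Sum>l<i. if l = j then rowstate (Suc p) 0 l z else 0)" for z
        by (rule sum.cong) (auto simp: Suc)
      then show ?thesis using Suc by (simp add: g_def rowstate_def walled_0 hop_dlt fun_eq_iff algebra_simps)
    qed
  qed
  have E: "wdet p (\<lambda>i. g (skip 0 i)) N z = rows_det p 0 (Suc N) z" for N z
    unfolding rows_det_def wdet_hop[symmetric] by (rule wdet_cong) (auto simp: g_def skip_def)
  show ?thesis
    using wdet_three_term[of 0 p g N z] unfolding O E by simp
qed

section \<open>Determinants of walks above a fixed axis\<close>

definition hl_det :: "nat \<Rightarrow> nat \<Rightarrow> int \<Rightarrow> real" where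
  "hl_det a N z = wdet a (\<lambda>i. odd_pair (2 * int i + 2)) N z"

text \<open>Only after two steps are the walks back at even heights: \<open>hop (hop (q j))\<close>
  is \<open>q (j + 1) + 2 * q j + q (j - 1)\<close>, where the last term is absent for
  \<open>j = 0\<close> because \<open>odd_pair 0\<close> vanishes. With the lowest start adjoined,
  the states of \<open>a\<close> walks two steps later span those of \<open>a + 1\<close>
  walks.\<close>

theorem hl_det_three_term:
  "hl_det a (Suc (Suc N)) (z + 2) * hl_det (Suc a) (Suc N) (z + 1) =
   hl_det a (Suc (Suc (Suc N))) (z + 1) * hl_det (Suc a) N (z + 2) +
   hl_det a (Suc (Suc (Suc N))) (z + 3) * hl_det (Suc a) N z"
proof -
  define q where "q i = odd_pair (2 * int i + 2)" for i :: nat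
  define g where "g j = (if j = 0 then odd_pair 2 else hop (hop (q (j - 1))))" for j
  have O: "wdet (Suc a) g N z = hl_det (Suc a) N z" for N z
    unfolding hl_det_def q_def[symmetric]
  proof (rule wdet_add_earlier_rows[where t = "\<lambda>l i. (if l = i - 1 then 2 else 0) + (if Suc (Suc l) = i then 1 else 0)"])
    fix i
    show "g i = (\<lambda>z. q i z + (\<Sum>l<i. ((if l = i - 1 then 2 else 0) + (if Suc (Suc l) = i then 1 else 0)) * q l z))"
    proof (cases i)
      case 0
      then show ?thesis by (simp add: g_def q_def)
    next
      case (Suc j)
      have "(\<Sum>l<i. ((if l = i - 1 then 2 else 0) + (if Suc (Suc l) = i then 1 else 0)) * q l z)
         = 2 * q j z + (if j = 0 then 0 else q (j - 1) z)" for z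
      proof -
        have "(\<Sum>l<i. ((if l = i - 1 then 2 else 0) + (if Suc (Suc l) = i then 1 else 0)) * q l z)
         = (\<Sum>l<i. if l = j then 2 * q l z else 0) + (\<Sum>l<i. if l = j - 1 then (if j = 0 then 0 else q l z) else 0)"
          unfolding sum.distrib[symmetric] by (rule sum.cong) (auto simp: Suc)
        also have "\<dots> = 2 * q j z + (if j = 0 then 0 else q (j - 1) z)" by (auto simp: Suc)
        finally show ?thesis .
      qed
      moreover have "hop (hop (q j)) = (\<lambda>z. q (Suc j) z + (2 * q j z + (if j = 0 then 0 else q (j - 1) z)))"
        by (cases j) (auto simp: hop_def q_def odd_pair_def delta_def fun_eq_iff)
      ultimately show ?thesis using Suc by (simp add: g_def add.commute)
    qed
  qed
  have E: "wdet a (\<lambda>i. g (skip 0 i)) N z = hl_det a (Suc (Suc N)) z" for N z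
    unfolding hl_det_def wdet_hop[symmetric] by (rule wdet_cong) (auto simp: g_def skip_def q_def)
  show ?thesis
    using wdet_three_term[of 0 a g N z] unfolding O E by simp
qed

section \<open>Degenerate windows\<close>

lemma hl_det_zero: "hl_det (Suc a) N 0 = 0"
proof -
  have "fdet (Suc a) (\<lambda>k i. (hop ^^ N) (odd_pair (2 * int i + 2)) (0 + 2 * int k)) = 0"
    by (rule fdet_zero_row[of 0]) auto
  then show ?thesis unfolding hl_det_def wdet_def by (subst fdet_transpose[symmetric])
qed

lemma hl_det_extreme: "hl_det a N (int N + 2) = 1"
  unfolding hl_det_def wdet_def
proof (rule fdet_lower_unitriangular)
  fix i j :: nat assume "i < j"
  then show "(hop ^^ N) (odd_pair (2 * int i + 2)) (int N + 2 + 2 * int j) = 0"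
    by (intro hop_pow_outside) (auto simp: odd_pair_def delta_def)
next
  fix i :: nat
  have "(hop ^^ N) (odd_pair (2 * int i + 2)) (int N + 2 + 2 * int i) = (hop ^^ N) (delta (2 * int i + 2)) (int N + 2 + 2 * int i)"
    by (rule hop_pow_cong) (auto simp: odd_pair_def delta_def)
  also have "\<dots> = 1"
    using hop_pow_dlt_extreme(1)[of N "2 * int i + 2"] by (simp add: algebra_simps)
  finally show "(hop ^^ N) (odd_pair (2 * int i + 2)) (int N + 2 + 2 * int i) = 1" .
qed

text \<open>This window belongs to \<open>c = 0\<close>, where every step is forced upwards; the
  next lemma is its mirror image for \<open>b = 0\<close>.\<close>

lemma rows_det_extreme_up: "rows_det p 0 N (int N + 1 - int p) = 1"
  unfolding rows_det_def wdet_def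
proof (rule fdet_lower_unitriangular)
  fix i j :: nat assume "i < j"
  then show "(hop ^^ N) (rowstate p (2 * 0) i) (int N + 1 - int p + 2 * int j) = 0"
    by (intro hop_pow_outside) (auto simp: rowstate_def walled_0 delta_def)
next
  fix i :: nat
  show "(hop ^^ N) (rowstate p (2 * 0) i) (int N + 1 - int p + 2 * int i) = 1"
    using hop_pow_dlt_extreme(1)[of N "2 * int i + 1 - int p"]
    by (simp add: rowstate_def walled_0 algebra_simps)
qed

lemma rows_det_extreme_down: "rows_det p 0 N (1 - int N - int p) = 1"
  unfolding rows_det_def wdet_def
proof (rule fdet_upper_unitriangular)
  fix i j :: nat assume "j < i"
  then show "(hop ^^ N) (rowstate p (2 * 0) i) (1 - int N - int p + 2 * int j) = 0"
    by (intro hop_pow_outside) (auto simp: rowstate_def walled_0 delta_def)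
next
  fix i :: nat
  show "(hop ^^ N) (rowstate p (2 * 0) i) (1 - int N - int p + 2 * int i) = 1"
    using hop_pow_dlt_extreme(2)[of N "2 * int i + 1 - int p"]
    by (simp add: rowstate_def walled_0 algebra_simps)
qed

lemma walled_nonneg_support: "s \<ge> 0 \<Longrightarrow> w < 0 \<Longrightarrow> walled t s w = 0"
  by (auto simp: walled_def delta_def zero_less_mult_iff)

lemma walled_nonpos_support: "s \<le> 0 \<Longrightarrow> w > 0 \<Longrightarrow> walled t s w = 0"
  by (auto simp: walled_def delta_def zero_less_mult_iff)

text \<open>The \<open>a + 1\<close> paths that leave the wall at height 0 or above descend at most
  to \<open>- N\<close>, below which lie the \<open>a + 1\<close> lowest end points.\<close>

lemma rows_det_odd_vanish_up: "rows_det (2 * a + 1) d N (- int N - 2 - 2 * int a) = 0"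
  unfolding rows_det_def wdet_def
proof (rule fdet_zero_block[of a])
  fix i j assume "a \<le> i" "j \<le> a"
  then show "(hop ^^ N) (rowstate (2 * a + 1) (2 * d) i) (- int N - 2 - 2 * int a + 2 * int j) = 0"
    unfolding rowstate_def by (intro hop_pow_outside walled_nonneg_support) auto
qed simp

lemma rows_det_odd_vanish_down: "rows_det (2 * a + 1) d N (int N + 2 - 2 * int a) = 0"
proof -
  have "fdet (2 * a + 1) (\<lambda>j i. (hop ^^ N) (rowstate (2 * a + 1) (2 * d) i) (int N + 2 - 2 * int a + 2 * int j)) = 0"
  proof (rule fdet_zero_block[of a])
    fix i j assume "a \<le> i" "j \<le> a"
    then show "(hop ^^ N) (rowstate (2 * a + 1) (2 * d) j) (int N + 2 - 2 * int a + 2 * int i) = 0"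
      unfolding rowstate_def by (intro hop_pow_outside walled_nonpos_support) auto
  qed simp
  then show ?thesis unfolding rows_det_def wdet_def by (subst fdet_transpose[symmetric])
qed

text \<open>Only heights \<open>w\<close> with \<open>0 <= w\<close> influence the value, and there
  the cut-off state agrees with the odd function, at 0 because both vanish. Hence the reflection
  principle stays valid for the \<open>N\<close> steps after the wall.\<close>

lemma hop_Psi_far:
  assumes "s > 0" "y \<ge> int N"
  shows "(hop ^^ N) (walled t s) y = (hop ^^ (N + t)) (odd_pair s) y"
proof -
  have "(hop ^^ N) (walled t s) y = (hop ^^ N) ((hop ^^ t) (odd_pair s)) y"
  proof (rule hop_pow_cong)
    fix w assume "\<bar>w - y\<bar> \<le> int N"
    then have "w \<ge> 0" using assms by linarith
    then show "walled t s w = (hop ^^ t) (odd_pair s) w"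
      using assms by (cases "w = 0") (auto simp: walled_def zero_less_mult_iff)
  qed
  then show ?thesis by (simp add: funpow_add)
qed

text \<open>Reflection in the axis; reversing rows and columns restores their increasing
  order.\<close>

lemma lower_rows_Kw:
  assumes "y \<ge> int N"
  shows "fdet a (\<lambda>i k. (hop ^^ N) (walled t (2 * int i - 2 * int a)) (- y - 2 * int (a - 1) + 2 * int k)) = hl_det a (N + t) y"
proof -
  let ?f = "\<lambda>i k. (hop ^^ N) (walled t (2 * int i - 2 * int a)) (- y - 2 * int (a - 1) + 2 * int k)"
  have "fdet a (\<lambda>i k. ?f (a - 1 - i) (a - 1 - k)) = hl_det a (N + t) y"
    unfolding hl_det_def wdet_def
  proof (rule fdet_cong)
    fix i k assume ik: "i < a" "k < a"
    have e: "2 * int (a - 1 - i) - 2 * int a = - (2 * int i + 2)"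
      "- y - 2 * int (a - 1) + 2 * int (a - 1 - k) = - (y + 2 * int k)" using ik by auto
    have "?f (a - 1 - i) (a - 1 - k) = (hop ^^ N) (walled t (2 * int i + 2)) (y + 2 * int k)"
      unfolding e walled_uminus hop_pow_reflect by (simp add: add.commute)
    also have "\<dots> = (hop ^^ (N + t)) (odd_pair (2 * int i + 2)) (y + 2 * int k)"
      by (rule hop_Psi_far) (use assms in auto)
    finally show "?f (a - 1 - i) (a - 1 - k) = (hop ^^ (N + t)) (odd_pair (2 * int i + 2)) (y + 2 * int k)" .
  qed
  then show ?thesis using fdet_reverse[of a ?f] by simp
qed

text \<open>The paths above the axis, with the same end points in both splittings below. Since it is
  a common factor there, a closed value is given only for \<open>N = 0\<close>.\<close>

definition upper_block :: "nat \<Rightarrow> nat \<Rightarrow> nat \<Rightarrow> real" where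
  "upper_block a d N = fdet a (\<lambda>i k. (hop ^^ N) (walled (2 * d) (2 * int i + 2)) (2 - int N + 2 * int k))"

text \<open>The \<open>a\<close> lowest end points lie below \<open>- N\<close>, out of reach of the
  tip path and of the upper paths, so the matrix is block triangular. The next end point,
  \<open>- N\<close>, is reached only by the tip path descending all the time, which leaves a unit
  column in the second block.\<close>

lemma rows_det_odd_split:
  "rows_det (2 * a + 1) d N (- int N - 2 * int a) = hl_det a (N + 2 * d) (int N + 2) * upper_block a d N"
proof -
  let ?f = "\<lambda>i k. (hop ^^ N) (walled (2 * d) (2 * int i - 2 * int a)) (- int N - 2 * int a + 2 * int k)"
  have r: "rowstate (2 * a + 1) t i = walled t (2 * int i - 2 * int a)" for t i
    by (simp add: rowstate_def)
  have "fdet (a + (a + 1)) ?f = fdet a ?f * fdet (a + 1) (\<lambda>i k. ?f (a + i) (a + k))"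
  proof (rule fdet_block)
    fix i j assume "a \<le> i" "i < a + (a + 1)" "j < a"
    then show "?f i j = 0"
      by (intro hop_pow_outside walled_nonneg_support) auto
  qed
  moreover have "fdet a ?f = hl_det a (N + 2 * d) (int N + 2)"
  proof -
    have "fdet a ?f = fdet a (\<lambda>i k. (hop ^^ N) (walled (2 * d) (2 * int i - 2 * int a)) (- (int N + 2) - 2 * int (a - 1) + 2 * int k))"
      by (rule fdet_cong) (auto simp: algebra_simps)
    then show ?thesis using lower_rows_Kw[of N "int N + 2" a "2 * d"] by simp
  qed
  moreover have "fdet (Suc a) (\<lambda>i k. ?f (a + i) (a + k)) = upper_block a d N"
  proof (subst fdet_unit_column[of 0 a 0])
    fix i assume "i \<le> a"
    show "?f (a + i) (a + 0) = (if i = 0 then 1 else 0)"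
    proof (cases "i = 0")
      case True
      have "walled (2 * d) 0 = delta 0" by (simp add: walled_def fun_eq_iff)
      then show ?thesis using True hop_pow_dlt_extreme(2)[of N 0] by simp
    next
      case False
      have "?f (a + i) (a + 0) = 0"
      proof (rule hop_pow_outside)
        fix w assume "\<bar>w - (- int N - 2 * int a + 2 * int (a + 0))\<bar> \<le> int N"
        then have "w \<le> 0" by simp
        then show "walled (2 * d) (2 * int (a + i) - 2 * int a) w = 0"
          using False by (auto simp: walled_def zero_less_mult_iff)
      qed
      then show ?thesis using False by simp
    qed
  qed (auto simp: skip_def upper_block_def algebra_simps intro!: fdet_cong)
  moreover have "rows_det (2 * a + 1) d N (- int N - 2 * int a) = fdet (a + (a + 1)) ?f"
    unfolding rows_det_def wdet_def r by (rule arg_cong[where f = "\<lambda>n. fdet n _"]) simp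
  ultimately show ?thesis by (simp only: Suc_eq_plus1)
qed

text \<open>In terms of \<open>rows_det_Suc_depth\<close> the tip path is missing and so is its end
  point \<open>- N\<close> between the two groups. The lower walks now end two units closer to the
  axis, while the upper block is the same as before.\<close>

lemma rows_det_even_split:
  assumes "N \<ge> 1"
  shows "rows_det (2 * a) (Suc d) (N - 1) (2 - int N - 2 * int a) = hl_det a (N + 2 * d) (int N) * upper_block a d N"
proof -
  let ?f = "\<lambda>i k. (hop ^^ N) (walled (2 * d) (2 * int (skip a i) - 2 * int a)) (2 - int N - 2 * int a + 2 * int k)"
  have r: "rowstate (2 * a + 1) t i = walled t (2 * int i - 2 * int a)" for t i
    by (simp add: rowstate_def)
  have "fdet (a + a) ?f = fdet a ?f * fdet a (\<lambda>i k. ?f (a + i) (a + k))"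
  proof (rule fdet_block)
    fix i j assume ij: "a \<le> i" "i < a + a" "j < a"
    show "?f i j = 0"
    proof (rule hop_pow_outside)
      fix w assume "\<bar>w - (2 - int N - 2 * int a + 2 * int j)\<bar> \<le> int N"
      then have "w \<le> 0" using ij by linarith
      then show "walled (2 * d) (2 * int (skip a i) - 2 * int a) w = 0"
        using ij by (auto simp: walled_def skip_def zero_less_mult_iff)
    qed
  qed
  moreover have "fdet a ?f = hl_det a (N + 2 * d) (int N)"
  proof -
    have "fdet a ?f = fdet a (\<lambda>i k. (hop ^^ N) (walled (2 * d) (2 * int i - 2 * int a)) (- int N - 2 * int (a - 1) + 2 * int k))"
      by (rule fdet_cong) (auto simp: skip_def algebra_simps)
    then show ?thesis using lower_rows_Kw[of N "int N" a "2 * d"] by simp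
  qed
  moreover have "fdet a (\<lambda>i k. ?f (a + i) (a + k)) = upper_block a d N"
    unfolding upper_block_def by (rule fdet_cong) (auto simp: skip_def algebra_simps)
  moreover have "rows_det (2 * a) (Suc d) (N - 1) (2 - int N - 2 * int a) = fdet (a + a) ?f"
  proof -
    have N: "Suc (N - 1) = N" using assms by simp
    show ?thesis
      unfolding rows_det_Suc_depth wdet_def r N by (rule arg_cong[where f = "\<lambda>n. fdet n _"]) simp
  qed
  ultimately show ?thesis by (simp only:)
qed

lemma upper_block_0: "upper_block a d 0 = hl_det a (2 * d) 2"
  unfolding upper_block_def hl_det_def wdet_def
  by (rule fdet_cong) (auto simp: walled_def zero_less_mult_iff)

section \<open>Walks on the half line\<close>

text \<open>Quotient of the counts of \<open>a + 1\<close> and of \<open>a\<close> half-line walks,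
  each with \<open>u\<close> steps up and \<open>v\<close> steps down. For \<open>a = 0\<close> it
  is the ballot number binomial(u+v, v) - binomial(u+v, v-2) given by the reflection
  principle.\<close>

definition hl_ratio :: "nat \<Rightarrow> nat \<Rightarrow> nat \<Rightarrow> real" where
  "hl_ratio a u v = fact a * fact (u + v + 2 * a + 1) * fact (u + a + 1) * (\<Prod>i<Suc a. real u - real v + real a + 2 + real i)
     / (fact (v + a) * fact (u + 2 * a + 1) * fact (u + 2 * a + 2))"

definition hl_count :: "nat \<Rightarrow> nat \<Rightarrow> nat \<Rightarrow> real" where
  "hl_count a u v = (\<Prod>i<a. hl_ratio i u v)"

lemma prod_shift_down:
  fixes s :: real
  shows "(\<Prod>i<Suc n. s - 1 + real i) * (s + real n) = (\<Prod>i<Suc n. s + real i) * (s - 1)"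
proof -
  have "(\<Prod>i<Suc n. s - 1 + real i) = (s - 1) * (\<Prod>i<n. s + real i)"
    unfolding prod.lessThan_Suc_shift by simp
  then show ?thesis by simp
qed

lemma hl_ratio_pos: "v \<le> Suc u \<Longrightarrow> hl_ratio a u v > 0"
  unfolding hl_ratio_def by (intro divide_pos_pos mult_pos_pos prod_pos) auto

lemma hl_count_pos: "v \<le> Suc u \<Longrightarrow> hl_count a u v > 0"
  unfolding hl_count_def by (intro prod_pos) (simp add: hl_ratio_pos)

lemma hl_count_0 [simp]: "hl_count 0 u v = 1" by (simp add: hl_count_def)
lemma hl_count_Suc: "hl_count (Suc a) u v = hl_count a u v * hl_ratio a u v" by (simp add: hl_count_def)

lemma ratio_step:
  fixes A :: real
  assumes "A = X * p * P1 / (Y * q)" "B = X * P0 / Y" "P1 * t = P0 * r" "q \<noteq> 0"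
  shows "A * (q * t) = B * (p * r)"
proof -
  have "A * (q * t) = (X * p / Y) * (P1 * t)" using assms(1,4) by simp
  moreover have "B * (p * r) = (X * p / Y) * (P0 * r)" using assms(2) by simp
  ultimately show ?thesis using assms(3) by simp
qed

lemma hl_ratio_Suc_v:
  "hl_ratio a u (Suc v) * ((real v + real a + 1) * (real u - real v + 2 * real a + 2)) =
   hl_ratio a u v * ((real u + real v + 2 * real a + 2) * (real u - real v + real a + 1))"
proof -
  define s where "s = real u - real v"
  have P: "(\<Prod>i<Suc a. real u - real (Suc v) + real a + 2 + real i) * (s + 2 * real a + 2)
     = (\<Prod>i<Suc a. real u - real v + real a + 2 + real i) * (s + real a + 1)"
    using prod_shift_down[of "s + real a + 2" a] by (simp add: s_def algebra_simps del: prod.lessThan_Suc)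
  define P1 where "P1 = (\<Prod>i<Suc a. real u - real (Suc v) + real a + 2 + real i)"
  define P0 where "P0 = (\<Prod>i<Suc a. real u - real v + real a + 2 + real i)"
  define X :: real where "X = fact a * fact (u + v + 2 * a + 1) * fact (u + a + 1)"
  define Y :: real where "Y = fact (v + a) * fact (u + 2 * a + 1) * fact (u + 2 * a + 2)"
  have f1: "(fact (u + Suc v + 2 * a + 1) :: real) = (real u + real v + 2 * real a + 2) * fact (u + v + 2 * a + 1)"
    by (simp add: algebra_simps)
  have f2: "(fact (Suc v + a) :: real) = (real v + real a + 1) * fact (v + a)"
    by (simp add: algebra_simps)
  have "hl_ratio a u (Suc v) = X * (real u + real v + 2 * real a + 2) * P1 / (Y * (real v + real a + 1))"
    unfolding hl_ratio_def P1_def[symmetric] f1 f2 X_def Y_def by (simp add: mult_ac)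
  moreover have "hl_ratio a u v = X * P0 / Y"
    unfolding hl_ratio_def P0_def[symmetric] X_def Y_def by (simp add: mult_ac)
  moreover have "real v + real a + 1 \<noteq> 0" by linarith
  ultimately show ?thesis
    using P[folded P1_def P0_def] unfolding s_def by (intro ratio_step)
qed

lemma hl_ratio_Suc_u:
  "hl_ratio a (Suc u) v * ((real u + 2 * real a + 2) * (real u + 2 * real a + 3) * (real u - real v + real a + 2)) =
   hl_ratio a u v * ((real u + real v + 2 * real a + 2) * (real u + real a + 2) * (real u - real v + 2 * real a + 3))"
proof -
  define s where "s = real u - real v"
  have P: "(\<Prod>i<Suc a. real (Suc u) - real v + real a + 2 + real i) * (s + real a + 2)
     = (\<Prod>i<Suc a. real u - real v + real a + 2 + real i) * (s + 2 * real a + 3)"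
    using prod_shift_down[of "s + real a + 3" a] by (simp add: s_def algebra_simps del: prod.lessThan_Suc)
  define P1 where "P1 = (\<Prod>i<Suc a. real (Suc u) - real v + real a + 2 + real i)"
  define P0 where "P0 = (\<Prod>i<Suc a. real u - real v + real a + 2 + real i)"
  define X :: real where "X = fact a * fact (u + v + 2 * a + 1) * fact (u + a + 1)"
  define Y :: real where "Y = fact (v + a) * fact (u + 2 * a + 1) * fact (u + 2 * a + 2)"
  have f1: "(fact (Suc u + v + 2 * a + 1) :: real) = (real u + real v + 2 * real a + 2) * fact (u + v + 2 * a + 1)"
    by (simp add: algebra_simps)
  have f2: "(fact (Suc u + a + 1) :: real) = (real u + real a + 2) * fact (u + a + 1)"
    by (simp add: algebra_simps)
  have f3: "(fact (Suc u + 2 * a + 1) :: real) = (real u + 2 * real a + 2) * fact (u + 2 * a + 1)"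
    by (simp add: algebra_simps)
  have f4: "(fact (Suc u + 2 * a + 2) :: real) = (real u + 2 * real a + 3) * fact (u + 2 * a + 2)"
    by (simp add: algebra_simps)
  have "hl_ratio a (Suc u) v = X * ((real u + real v + 2 * real a + 2) * (real u + real a + 2)) * P1 / (Y * ((real u + 2 * real a + 2) * (real u + 2 * real a + 3)))"
    unfolding hl_ratio_def P1_def[symmetric] f1 f2 f3 f4 X_def Y_def by (simp add: mult_ac)
  moreover have "hl_ratio a u v = X * P0 / Y"
    unfolding hl_ratio_def P0_def[symmetric] X_def Y_def by (simp add: mult_ac)
  moreover have "(real u + 2 * real a + 2) * (real u + 2 * real a + 3) \<noteq> 0" by simp
  ultimately show ?thesis
    using P[folded P1_def P0_def] unfolding s_def by (intro ratio_step)
qed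

lemma theta_step1:
  fixes n :: real
  assumes IH: "n * t1 * X * Y = w * t2 * X0 * Y0" and r1: "f1 * (q * t2) = f0 * (m * t1)"
    and r2: "g0 * (q * t4) = g1 * (m * t3)" and nz: "q \<noteq> 0" "m \<noteq> 0" "t2 \<noteq> 0"
  shows "n * t3 * (X * f1) * (Y * g1) = w * t4 * (X0 * f0) * (Y0 * g0)"
proof -
  have "(q * t2 * m) * (n * t3 * (X * f1) * (Y * g1)) = (f1 * (q * t2)) * (g1 * (m * t3)) * n * X * Y"
    by (simp only: mult_ac)
  also have "\<dots> = (n * t1 * X * Y) * (f0 * m * (g0 * (q * t4)))"
    unfolding r1 r2[symmetric] by (simp only: mult_ac)
  also have "\<dots> = (q * t2 * m) * (w * t4 * (X0 * f0) * (Y0 * g0))"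
    unfolding IH by (simp only: mult_ac)
  finally show ?thesis using nz by simp
qed

lemma theta_step2:
  fixes n :: real
  assumes IH: "n * t1 * X * Y = w * t2 * X0 * Y0" and r1: "f1 * (q * t3) = f0 * (m * t4)"
    and r2: "g0 * (q * t1) = g1 * (m * t2)" and nz: "q \<noteq> 0" "m \<noteq> 0" "t2 \<noteq> 0"
  shows "n * t3 * (X * f1) * (Y * g1) = w * t4 * (X0 * f0) * (Y0 * g0)"
proof -
  have "(q * t2 * m) * (n * t3 * (X * f1) * (Y * g1)) = (f1 * (q * t3)) * (g1 * (m * t2)) * n * X * Y"
    by (simp only: mult_ac)
  also have "\<dots> = (n * t1 * X * Y) * (f0 * m * t4 * (g0 * q))"
    unfolding r1 r2[symmetric] by (simp only: mult_ac)
  also have "\<dots> = (q * t2 * m) * (w * t4 * (X0 * f0) * (Y0 * g0))"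
    unfolding IH by (simp only: mult_ac)
  finally show ?thesis using nz by simp
qed

text \<open>Expresses the first summand of \<open>hl_det_three_term\<close> as a rational fraction
  of its left-hand side. In the induction on \<open>a\<close> the quotients from
  \<open>hl_ratio_Suc_v\<close> cancel except for the two factors that contain \<open>a\<close>.
  \<open>hl_count_theta2\<close> does the same for the second summand, using
  \<open>hl_ratio_Suc_u\<close>.\<close>

lemma hl_count_theta1:
  assumes "v \<le> u"
  shows "(real u + real v + 2) * (real u - real v + real a + 1) * hl_count a (Suc u) (Suc (Suc v)) * hl_count (Suc a) u v =
         (real v + 1) * (real u - real v + 2 * real a + 2) * hl_count a (Suc u) (Suc v) * hl_count (Suc a) u (Suc v)"
proof (induction a)
  case 0
  show ?case using hl_ratio_Suc_v[of 0 u v] by (simp add: hl_count_Suc mult_ac)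
next
  case (Suc a)
  have "real u - real v \<ge> 0" using assms by simp
  then have nz: "real v + real a + 2 \<noteq> 0" "real u + real v + 2 * real a + 4 \<noteq> 0" "real u - real v + 2 * real a + 2 \<noteq> 0"
    by linarith+
  have "(real u + real v + 2) * (real u - real v + real a + 2) * (hl_count a (Suc u) (Suc (Suc v)) * hl_ratio a (Suc u) (Suc (Suc v)))
      * (hl_count (Suc a) u v * hl_ratio (Suc a) u v) =
     (real v + 1) * (real u - real v + 2 * real a + 4) * (hl_count a (Suc u) (Suc v) * hl_ratio a (Suc u) (Suc v))
      * (hl_count (Suc a) u (Suc v) * hl_ratio (Suc a) u (Suc v))"
  proof (rule theta_step1[OF Suc.IH _ _ nz])
    show "hl_ratio a (Suc u) (Suc (Suc v)) * ((real v + real a + 2) * (real u - real v + 2 * real a + 2)) =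
      hl_ratio a (Suc u) (Suc v) * ((real u + real v + 2 * real a + 4) * (real u - real v + real a + 1))"
      using hl_ratio_Suc_v[of a "Suc u" "Suc v"] by (simp add: algebra_simps)
    show "hl_ratio (Suc a) u (Suc v) * ((real v + real a + 2) * (real u - real v + 2 * real a + 4)) =
      hl_ratio (Suc a) u v * ((real u + real v + 2 * real a + 4) * (real u - real v + real a + 2))"
      using hl_ratio_Suc_v[of "Suc a" u v] by (simp add: algebra_simps)
  qed
  then show ?case by (simp add: hl_count_Suc add_ac)
qed

lemma hl_count_theta2:
  assumes "v \<le> Suc u"
  shows "(real u + real v + 2) * (real u - real v + real a + 3) * hl_count a (Suc (Suc (Suc u))) v * hl_count (Suc a) u v =
         (real u + 2 - real v) * (real u + real a + 3) * hl_count a (Suc (Suc u)) v * hl_count (Suc a) (Suc u) v"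
proof (induction a)
  case 0
  have "real u + 2 \<noteq> 0" by linarith
  moreover have "(real u + 2) * (hl_ratio 0 (Suc u) v * ((real u + 3) * (real u - real v + 2))) =
     (real u + 2) * (hl_ratio 0 u v * ((real u + real v + 2) * (real u - real v + 3)))"
    using hl_ratio_Suc_u[of 0 u v] by (simp only: mult_ac) (simp add: mult_ac)
  ultimately have "hl_ratio 0 (Suc u) v * ((real u + 3) * (real u - real v + 2)) = hl_ratio 0 u v * ((real u + real v + 2) * (real u - real v + 3))"
    using mult_left_cancel by blast
  then show ?case by (simp add: hl_count_Suc mult_ac add_ac algebra_simps)
next
  case (Suc a)
  have "real u - real v \<ge> -1" using assms by simp
  then have nz: "(real u + 2 * real a + 4) * (real u + 2 * real a + 5) \<noteq> 0"
     "(real u + real v + 2 * real a + 4) * (real u - real v + 2 * real a + 5) \<noteq> 0" "real u + real a + 3 \<noteq> 0"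
    by (simp_all add: add_eq_0_iff)
  have "(real u + real v + 2) * (real u - real v + real a + 4) * (hl_count a (Suc (Suc (Suc u))) v * hl_ratio a (Suc (Suc (Suc u))) v)
      * (hl_count (Suc a) u v * hl_ratio (Suc a) u v) =
     (real u + 2 - real v) * (real u + real a + 4) * (hl_count a (Suc (Suc u)) v * hl_ratio a (Suc (Suc u)) v)
      * (hl_count (Suc a) (Suc u) v * hl_ratio (Suc a) (Suc u) v)"
  proof (rule theta_step2[OF Suc.IH _ _ nz])
    show "hl_ratio a (Suc (Suc (Suc u))) v * ((real u + 2 * real a + 4) * (real u + 2 * real a + 5) * (real u - real v + real a + 4)) =
      hl_ratio a (Suc (Suc u)) v * ((real u + real v + 2 * real a + 4) * (real u - real v + 2 * real a + 5) * (real u + real a + 4))"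
      using hl_ratio_Suc_u[of a "Suc (Suc u)" v] by (simp add: algebra_simps)
    show "hl_ratio (Suc a) (Suc u) v * ((real u + 2 * real a + 4) * (real u + 2 * real a + 5) * (real u - real v + real a + 3)) =
      hl_ratio (Suc a) u v * ((real u + real v + 2 * real a + 4) * (real u - real v + 2 * real a + 5) * (real u + real a + 3))"
      using hl_ratio_Suc_u[of "Suc a" u v] by (simp add: algebra_simps)
  qed
  then show ?case by (simp add: hl_count_Suc add_ac)
qed

lemma hl_count_v0: "hl_count a u 0 = 1"
proof -
  have "hl_ratio a u 0 = 1" for a
  proof -
    have "fact (u + a + 1) * (\<Prod>i<n. real u + real a + 2 + real i) = fact (u + a + 1 + n)" for n
    proof (induction n)
      case (Suc n)
      have "(fact (u + a + 1 + Suc n) :: real) = fact (u + a + 1 + n) * (real u + real a + 2 + real n)"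
        using fact_Suc[of "u + a + 1 + n", where 'a = real] by (simp add: mult_ac add_ac)
      then show ?case by (simp only: prod.lessThan_Suc mult.assoc[symmetric] Suc.IH)
    qed simp
    moreover have "u + a + 1 + Suc a = u + 2 * a + 2" by simp
    ultimately have "fact (u + a + 1) * (\<Prod>i<Suc a. real u + real a + 2 + real i) = fact (u + 2 * a + 2)"
      by metis
    then have "fact a * fact (u + 0 + 2 * a + 1) * fact (u + a + 1) * (\<Prod>i<Suc a. real u - real 0 + real a + 2 + real i)
        = fact a * fact (u + 2 * a + 1) * fact (u + 2 * a + 2)"
      by (simp only: mult.assoc of_nat_0 diff_zero add_0_right)
    then show ?thesis unfolding hl_ratio_def by (simp only: add_0_left) simp
  qed
  then show ?thesis by (simp add: hl_count_def)
qed

text \<open>If the two summands are the fractions \<open>t1 / c\<close> and \<open>t2 / c\<close> of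
  \<open>k * y\<close> and these add up to 1, cancelling \<open>k\<close> identifies the unknown
  factor \<open>x\<close> with its conjectured value \<open>y\<close>.\<close>

lemma solve_three_term:
  fixes c :: real
  assumes "k * x = p + q" "c * p = t1 * (k * y)" "c * q = t2 * (k * y)" "t1 + t2 = c" "c \<noteq> 0" "k \<noteq> 0"
  shows "x = y"
proof -
  have "c * (k * x) = c * (k * y)"
    unfolding assms(1) distrib_left assms(2,3) using assms(4) by (metis distrib_right)
  then show ?thesis using assms(5,6) by simp
qed

theorem hl_det_closed_form: "v \<le> Suc u \<Longrightarrow> hl_det a (u + v) (int u - int v + 2) = hl_count a u v"
proof (induction a arbitrary: u v)
  case 0
  then show ?case by (simp add: hl_det_def)
next
  case (Suc a)
  note IH = Suc.IH
  from Suc.prems show ?case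
  proof (induction "u + v" arbitrary: u v)
    case 0
    then show ?case using hl_det_extreme[of "Suc a" 0] by (simp add: hl_count_v0)
  next
    case (Suc n)
    show ?case
    proof (cases v)
      case 0
      then show ?thesis using hl_det_extreme[of "Suc a" u] by (simp add: hl_count_v0)
    next
      case (Suc v')
      have vu: "v' \<le> u" using Suc.prems Suc by simp
      define N where "N = u + v'"
      have *: "hl_det a (Suc (Suc N)) (int u - int v' + 2) * hl_det (Suc a) (Suc N) (int u - int v' + 1) =
         hl_det a (Suc (Suc (Suc N))) (int u - int v' + 1) * hl_det (Suc a) N (int u - int v' + 2) +
         hl_det a (Suc (Suc (Suc N))) (int u - int v' + 3) * hl_det (Suc a) N (int u - int v')"
        using hl_det_three_term[of a N "int u - int v'"] .
      have k1: "hl_det a (Suc (Suc N)) (int u - int v' + 2) = hl_count a (Suc u) (Suc v')"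
        using IH[of "Suc v'" "Suc u"] vu by (simp add: N_def)
      have k2: "hl_det a (Suc (Suc (Suc N))) (int u - int v' + 1) = hl_count a (Suc u) (Suc (Suc v'))"
        using IH[of "Suc (Suc v')" "Suc u"] vu by (simp add: N_def add.commute)
      have k3: "hl_det a (Suc (Suc (Suc N))) (int u - int v' + 3) = hl_count a (Suc (Suc u)) (Suc v')"
        using IH[of "Suc v'" "Suc (Suc u)"] vu by (simp add: N_def algebra_simps)
      have k4: "hl_det (Suc a) N (int u - int v' + 2) = hl_count (Suc a) u v'"
        using Suc.hyps(1)[of u v'] Suc.hyps(2) Suc vu by (simp add: N_def)
      let ?n = "real u + real v' + 2" and ?s = "real u - real v'"
      have T1: "?n * (?s + real a + 1) * (hl_count a (Suc u) (Suc (Suc v')) * hl_count (Suc a) u v') =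
         (real v' + 1) * (?s + 2 * real a + 2) * (hl_count a (Suc u) (Suc v') * hl_count (Suc a) u (Suc v'))"
        using hl_count_theta1[OF vu, of a] by (simp add: mult_ac)
      have T2: "?n * (?s + real a + 1) * (hl_count a (Suc (Suc u)) (Suc v') * hl_det (Suc a) N (int u - int v')) =
         ?s * (real u + real a + 2) * (hl_count a (Suc u) (Suc v') * hl_count (Suc a) u (Suc v'))"
      \<comment> \<open>For \<open>u = v'\<close> the window starts at height 0 and leaves the range
        of the closed form; the determinant vanishes there, and so does the factor
        \<open>u - v'\<close>.\<close>
      proof (cases "u = v'")
        case True
        then show ?thesis by (simp add: hl_det_zero)
      next
        case False
        then obtain u' where u': "u = Suc u'" using vu by (cases u) auto
        have "hl_det (Suc a) N (int u - int v') = hl_count (Suc a) u' (Suc v')"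
          using Suc.hyps(1)[of u' "Suc v'"] Suc.hyps(2) Suc vu False u' by (simp add: N_def add_diff_eq)
        moreover have "Suc v' \<le> Suc u'" using False vu u' by simp
        ultimately show ?thesis using hl_count_theta2[of "Suc v'" u' a] u'
          by (simp add: algebra_simps)
      qed
      have pos: "?n * (?s + real a + 1) > 0" using vu by (intro mult_pos_pos) auto
      have kpos: "hl_count a (Suc u) (Suc v') > 0" using vu by (intro hl_count_pos) auto
      have "hl_det (Suc a) (Suc N) (int u - int v' + 1) = hl_count (Suc a) u (Suc v')"
      proof (rule solve_three_term[OF *[unfolded k1 k2 k3 k4] T1 T2])
        show "(real v' + 1) * (?s + 2 * real a + 2) + ?s * (real u + real a + 2) = ?n * (?s + real a + 1)"
          by (simp add: algebra_simps)
      qed (use pos kpos in auto)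
      then show ?thesis using Suc by (simp add: N_def add.commute)
    qed
  qed
qed

section \<open>Closed forms\<close>

text \<open>One layer of MacMahon's triple product: the products over \<open>j\<close> and
  \<open>k\<close>, telescoped to factorials, with the first index counted from 0.\<close>

definition box_ratio :: "nat \<Rightarrow> nat \<Rightarrow> nat \<Rightarrow> real" where
  "box_ratio i b c = fact (i + b + c) * fact i / (fact (i + b) * fact (i + c))"

definition boxes :: "nat \<Rightarrow> nat \<Rightarrow> nat \<Rightarrow> real" where
  "boxes p b c = (\<Prod>i<p. box_ratio i b c)"

lemma boxes_sym: "boxes p b c = boxes p c b"
  by (simp add: boxes_def box_ratio_def add_ac mult_ac)

lemma boxes_0 [simp]: "boxes 0 b c = 1" by (simp add: boxes_def)
lemma boxes_Suc: "boxes (Suc p) b c = boxes p b c * box_ratio p b c" by (simp add: boxes_def)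
lemma boxes_pos: "boxes p b c > 0"
  unfolding boxes_def box_ratio_def by (intro prod_pos) simp

lemma boxes_c0: "boxes p b 0 = 1" "boxes p 0 c = 1"
  by (simp_all add: boxes_def box_ratio_def)

lemma box_ratio_Suc: "box_ratio i b (Suc c) * (real i + real c + 1) = box_ratio i b c * (real i + real b + real c + 1)"
proof -
  have f: "(fact (i + b + Suc c) :: real) = (real i + real b + real c + 1) * fact (i + b + c)"
    "(fact (i + Suc c) :: real) = (real i + real c + 1) * fact (i + c)"
    by (simp_all add: algebra_simps)
  have "real i + real c + 1 \<noteq> 0" by linarith
  then show ?thesis unfolding box_ratio_def f by (simp add: mult_ac)
qed

text \<open>With \<open>Suc c\<close> in the role of \<open>c\<close>, the first summand is the
  fraction \<open>c / (b + c)\<close> of the left-hand side. The fraction does not depend on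
  \<open>p\<close>, because the layers \<open>p\<close> and \<open>p + 1\<close> contribute equal
  cross products.\<close>

lemma boxes_theta:
  "(real b + real c + 1) * (boxes p b (Suc (Suc c)) * boxes (Suc p) b c) =
   (real c + 1) * (boxes p b (Suc c) * boxes (Suc p) b (Suc c))"
proof (induction p)
  case 0
  show ?case using box_ratio_Suc[of 0 b c] by (simp add: boxes_Suc mult_ac)
next
  case (Suc p)
  let ?q = "real p + real c + 2" and ?m = "real p + real b + real c + 2"
  have 1: "box_ratio p b (Suc (Suc c)) * ?q = box_ratio p b (Suc c) * ?m"
    using box_ratio_Suc[of p b "Suc c"] by (simp add: add_ac)
  have 2: "box_ratio (Suc p) b (Suc c) * ?q = box_ratio (Suc p) b c * ?m"
    using box_ratio_Suc[of "Suc p" b c] by (simp add: add_ac)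
  have nz: "?q \<noteq> 0" "?m \<noteq> 0" by linarith+
  have "?q * ?m * (box_ratio p b (Suc (Suc c)) * box_ratio (Suc p) b c) = (box_ratio p b (Suc (Suc c)) * ?q) * (box_ratio (Suc p) b c * ?m)"
    by (simp only: mult_ac)
  also have "\<dots> = ?q * ?m * (box_ratio p b (Suc c) * box_ratio (Suc p) b (Suc c))"
    unfolding 1 2[symmetric] by (simp only: mult_ac)
  finally have 3: "box_ratio p b (Suc (Suc c)) * box_ratio (Suc p) b c = box_ratio p b (Suc c) * box_ratio (Suc p) b (Suc c)"
    using nz by simp
  have "(real b + real c + 1) * (boxes (Suc p) b (Suc (Suc c)) * boxes (Suc (Suc p)) b c) =
    ((real b + real c + 1) * (boxes p b (Suc (Suc c)) * boxes (Suc p) b c)) * (box_ratio p b (Suc (Suc c)) * box_ratio (Suc p) b c)"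
    unfolding boxes_Suc by (simp only: mult_ac)
  also have "\<dots> = (real c + 1) * (boxes (Suc p) b (Suc c) * boxes (Suc (Suc p)) b (Suc c))"
    unfolding Suc.IH 3 by (simp only: boxes_Suc mult_ac)
  finally show ?case .
qed

text \<open>The end points are the edges of the right side, the lowest at doubled height
  \<open>b - c + 1 - p\<close> above the axis. Of the \<open>b + c\<close> steps,
  \<open>2 * d\<close> are already contained in the starting states.\<close>

definition path_det :: "nat \<Rightarrow> nat \<Rightarrow> nat \<Rightarrow> nat \<Rightarrow> real" where
  "path_det p d b c = rows_det p d (b + c - 2 * d) (int b - int c + 1 - int p)"

lemma path_det_undented_three_term:
  "path_det p 0 (Suc b) (Suc c) * path_det (Suc p) 0 (Suc b) (Suc c) =
   path_det p 0 (Suc b) (Suc (Suc c)) * path_det (Suc p) 0 (Suc b) c + path_det p 0 (Suc (Suc b)) (Suc c) * path_det (Suc p) 0 b (Suc c)"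
  using rows_det_three_term_undented[of p "Suc (b + c)" "int b - int c - 1 - int p"]
  by (simp add: path_det_def algebra_simps)

theorem macmahon_det: "path_det p 0 b c = boxes p b c"
proof (induction p arbitrary: b c)
  case 0
  show ?case by (simp add: path_det_def rows_det_def)
next
  case (Suc p)
  note IH = Suc.IH
  show ?case
  proof (induction "b + c" arbitrary: b c rule: less_induct)
    case less
    consider "c = 0" | "b = 0" | b' c' where "b = Suc b'" "c = Suc c'"
      by (metis not0_implies_Suc)
    then show ?case
    proof cases
      case 1
      then show ?thesis using rows_det_extreme_up[of "Suc p" b] by (simp add: path_det_def boxes_c0)
    next
      case 2
      have "path_det (Suc p) 0 0 c = 1"
        using rows_det_extreme_down[of "Suc p" c] by (simp add: path_det_def)
      then show ?thesis using 2 by (simp add: boxes_c0)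
    next
      case 3
      have i1: "path_det (Suc p) 0 b c' = boxes (Suc p) b c'" and i2: "path_det (Suc p) 0 b' c = boxes (Suc p) b' c"
        using less 3 by auto
      have 0: "boxes p b c * path_det (Suc p) 0 b c = boxes p b (Suc c) * boxes (Suc p) b c' + boxes p (Suc b) c * boxes (Suc p) b' c"
        using path_det_undented_three_term[of p b' c'] unfolding IH 3[symmetric] i1 i2 .
      show ?thesis
      proof (rule solve_three_term[OF 0])
        show "(real b + real c) * (boxes p b (Suc c) * boxes (Suc p) b c') = real c * (boxes p b c * boxes (Suc p) b c)"
          using boxes_theta[of b c' p] 3 by (simp add: algebra_simps)
        show "(real b + real c) * (boxes p (Suc b) c * boxes (Suc p) b' c) = real b * (boxes p b c * boxes (Suc p) b c)"
          using boxes_theta[of c b' p] 3 unfolding boxes_sym[of _ c] by (simp add: algebra_simps)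
      qed (use 3 boxes_pos[of p b c] in auto)
    qed
  qed
qed

text \<open>The quotient of the \<open>k\<close>-th factor of the theorem at \<open>i + 1\<close>
  and at \<open>i\<close>. The two terms with the floor of \<open>(c - b) / 2\<close> multiply to an
  expression in \<open>b + c\<close> (\<open>half_diff_product\<close>), so the floor disappears and
  symmetry in \<open>b\<close> and \<open>c\<close> becomes visible.\<close>

definition even_step :: "nat \<Rightarrow> nat \<Rightarrow> nat \<Rightarrow> nat \<Rightarrow> real" where
  "even_step i k b c = 2 * (real i + real b - real k) * (real i + real c - real k) * (2 * real i + 2 * real k + 1) /
     ((real i + real k + 1) * ((2 * real i + real b + real c - 2 * real k) * (2 * real i + real b + real c - 2 * real k + 1)))"

definition even_ratio :: "nat \<Rightarrow> nat \<Rightarrow> nat \<Rightarrow> nat \<Rightarrow> real" where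
  "even_ratio a k b c = (\<Prod>i<a. even_step i k b c)"

definition odd_step :: "nat \<Rightarrow> nat \<Rightarrow> nat \<Rightarrow> nat \<Rightarrow> real" where
  "odd_step i k b c = 2 * (real i + real b - real k + 1) * (real i + real c - real k + 1) * (2 * real i + 2 * real k + 3) /
     ((real i + real k + 1) * ((2 * real i + real b + real c - 2 * real k + 1) * (2 * real i + real b + real c - 2 * real k + 2)))"

text \<open>For \<open>a = 0\<close> a single path from the tip remains, with binomial(b+c-2d, b-d)
  choices; the prefactor is the quotient of two consecutive such numbers.\<close>

definition odd_ratio :: "nat \<Rightarrow> nat \<Rightarrow> nat \<Rightarrow> nat \<Rightarrow> real" where
  "odd_ratio a k b c = (real b - real k) * (real c - real k) / ((real b + real c - 2 * real k) * (real b + real c - 2 * real k - 1))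
     * (\<Prod>i<a. odd_step i k b c)"

definition evens :: "nat \<Rightarrow> nat \<Rightarrow> nat \<Rightarrow> nat \<Rightarrow> real" where
  "evens a d b c = boxes (2 * a) b c * (\<Prod>k<d. even_ratio a k b c)"

definition odds :: "nat \<Rightarrow> nat \<Rightarrow> nat \<Rightarrow> nat \<Rightarrow> real" where
  "odds a d b c = boxes (2 * a + 1) b c * (\<Prod>k<d. odd_ratio a k b c)"

lemma evens_Suc: "evens a (Suc d) b c = evens a d b c * even_ratio a d b c"
  by (simp add: evens_def)

lemma odds_Suc: "odds a (Suc d) b c = odds a d b c * odd_ratio a d b c"
  by (simp add: odds_def)

lemma evens_sym: "evens a d b c = evens a d c b"
proof -
  have "even_step i k b c = even_step i k c b" for i k by (simp only: even_step_def mult_ac add_ac)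
  then show ?thesis by (simp add: evens_def even_ratio_def boxes_sym[of _ b])
qed

lemma odds_sym: "odds a d b c = odds a d c b"
proof -
  have "odd_step i k b c = odd_step i k c b" for i k by (simp only: odd_step_def mult_ac add_ac)
  then show ?thesis by (simp only: odds_def odd_ratio_def boxes_sym[of _ b] mult_ac add_ac)
qed

lemma even_ratio_pos: "k < b \<Longrightarrow> k < c \<Longrightarrow> even_ratio a k b c > 0"
  unfolding even_ratio_def even_step_def by (intro prod_pos ballI divide_pos_pos mult_pos_pos) auto

lemma odd_ratio_pos: "k < b \<Longrightarrow> k < c \<Longrightarrow> odd_ratio a k b c > 0"
  unfolding odd_ratio_def odd_step_def by (intro prod_pos ballI divide_pos_pos mult_pos_pos) auto

lemma evens_pos: "d \<le> b \<Longrightarrow> d \<le> c \<Longrightarrow> evens a d b c > 0"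
  unfolding evens_def by (intro mult_pos_pos boxes_pos prod_pos ballI even_ratio_pos) auto

lemma odds_pos: "d \<le> b \<Longrightarrow> d \<le> c \<Longrightarrow> odds a d b c > 0"
  unfolding odds_def by (intro mult_pos_pos boxes_pos prod_pos ballI odd_ratio_pos) auto

lemma frac_shift:
  fixes X :: real
  assumes "D \<noteq> 0" "D + 2 \<noteq> 0"
  shows "X * (C + 1) / (k * ((D + 1) * (D + 2))) * (C * (D + 2)) = X * C / (k * (D * (D + 1))) * ((C + 1) * D)"
proof -
  have "X * (C + 1) / (k * ((D + 1) * (D + 2))) * (C * (D + 2)) = X * (C + 1) * C / (k * (D + 1))"
    using assms by simp
  moreover have "X * C / (k * (D * (D + 1))) * ((C + 1) * D) = X * (C + 1) * C / (k * (D + 1))"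
    using assms by simp
  ultimately show ?thesis by simp
qed

lemma telescope_step:
  fixes R :: real
  assumes "R * (c0 * ta) = R0 * (ca * t0)" "f1 * (ca * tb) = f0 * (cb * ta)" "ca \<noteq> 0" "ta \<noteq> 0"
  shows "(R * f1) * (c0 * tb) = (R0 * f0) * (cb * t0)"
proof -
  have "(ca * ta) * ((R * f1) * (c0 * tb)) = (R * (c0 * ta)) * (f1 * (ca * tb))" by (simp only: mult_ac)
  also have "\<dots> = (ca * ta) * ((R0 * f0) * (cb * t0))" unfolding assms(1,2) by (simp only: mult_ac)
  finally show ?thesis using assms(3,4) by simp
qed

text \<open>Put \<open>C = i + c - k\<close> and \<open>D = 2 * i + b + c - 2 * k\<close>. Raising
  \<open>c\<close> by one multiplies factor \<open>i\<close> by
  \<open>(C + 1) * D / (C * (D + 2))\<close>, and \<open>C + 1\<close> and \<open>D + 2\<close> are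
  the values of \<open>C\<close> and \<open>D\<close> at \<open>i + 1\<close>: the product over
  \<open>i\<close> telescopes.\<close>

lemma even_ratio_Suc:
  assumes "k \<le> b" "k < c"
  shows "even_ratio a k b (Suc c) * ((real c - real k) * (2 * real a + real b + real c - 2 * real k)) =
         even_ratio a k b c * ((real c + real a - real k) * (real b + real c - 2 * real k))"
proof (induction a)
  case 0
  then show ?case by (simp add: even_ratio_def)
next
  case (Suc a)
  define X where "X = 2 * (real a + real b - real k) * (2 * real a + 2 * real k + 1)"
  define C where "C = real c + real a - real k"
  define D where "D = 2 * real a + real b + real c - 2 * real k"
  have C: "C > 0" and D: "D > 0" using assms by (simp_all add: C_def D_def)
  have f0: "even_step a k b c = X * C / ((real a + real k + 1) * (D * (D + 1)))"
    by (simp add: even_step_def X_def C_def D_def mult_ac add_ac)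
  have f1: "even_step a k b (Suc c) = X * (C + 1) / ((real a + real k + 1) * ((D + 1) * (D + 2)))"
    by (simp add: even_step_def X_def C_def D_def algebra_simps)
  have s: "even_step a k b (Suc c) * (C * (D + 2)) = even_step a k b c * ((C + 1) * D)"
    unfolding f0 f1 by (rule frac_shift) (use D in auto)
  have "(even_ratio a k b (Suc c) * even_step a k b (Suc c)) * ((real c - real k) * (D + 2)) =
        (even_ratio a k b c * even_step a k b c) * ((C + 1) * (real b + real c - 2 * real k))"
    by (rule telescope_step[OF _ s]) (use Suc.IH C D in \<open>auto simp: C_def D_def\<close>)
  then show ?case by (simp add: even_ratio_def C_def D_def algebra_simps)
qed

lemma odd_ratio_Suc:
  assumes "k < b" "k < c"
  shows "odd_ratio a k b (Suc c) * ((real c - real k) * (2 * real a + real b + real c + 1 - 2 * real k)) =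
         odd_ratio a k b c * ((real a + real c + 1 - real k) * (real b + real c - 2 * real k - 1))"
proof (induction a)
  case 0
  define X where "X = real b - real k"
  define C where "C = real c - real k"
  define D where "D = real b + real c - 2 * real k - 1"
  have D: "D > 0" using assms by (simp add: D_def)
  have f0: "odd_ratio 0 k b c = X * C / (1 * (D * (D + 1)))"
    by (simp add: odd_ratio_def X_def C_def D_def mult_ac add_ac)
  have f1: "odd_ratio 0 k b (Suc c) = X * (C + 1) / (1 * ((D + 1) * (D + 2)))"
    by (simp add: odd_ratio_def X_def C_def D_def algebra_simps)
  have "odd_ratio 0 k b (Suc c) * (C * (D + 2)) = odd_ratio 0 k b c * ((C + 1) * D)"
    unfolding f0 f1 by (rule frac_shift) (use D in auto)
  then show ?case by (simp add: C_def D_def algebra_simps)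
next
  case (Suc a)
  define X where "X = 2 * (real a + real b - real k + 1) * (2 * real a + 2 * real k + 3)"
  define C where "C = real a + real c + 1 - real k"
  define D where "D = 2 * real a + real b + real c + 1 - 2 * real k"
  have C: "C > 0" and D: "D > 0" using assms by (simp_all add: C_def D_def)
  have f0: "odd_step a k b c = X * C / ((real a + real k + 1) * (D * (D + 1)))"
    by (simp add: odd_step_def X_def C_def D_def algebra_simps)
  have f1: "odd_step a k b (Suc c) = X * (C + 1) / ((real a + real k + 1) * ((D + 1) * (D + 2)))"
    by (simp add: odd_step_def X_def C_def D_def algebra_simps)
  have s: "odd_step a k b (Suc c) * (C * (D + 2)) = odd_step a k b c * ((C + 1) * D)"
    unfolding f0 f1 by (rule frac_shift) (use D in auto)
  have r: "odd_ratio (Suc a) k b c = odd_ratio a k b c * odd_step a k b c" for c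
    by (simp add: odd_ratio_def)
  have "(odd_ratio a k b (Suc c) * odd_step a k b (Suc c)) * ((real c - real k) * (D + 2)) =
        (odd_ratio a k b c * odd_step a k b c) * ((C + 1) * (real b + real c - 2 * real k - 1))"
    by (rule telescope_step[OF _ s]) (use Suc.IH C D in \<open>auto simp: C_def D_def\<close>)
  then show ?case unfolding r by (simp add: C_def D_def algebra_simps)
qed

text \<open>Induction on \<open>d\<close> starting from MacMahon's case. At each depth the shifts of
  \<open>even_ratio\<close> and \<open>odd_ratio\<close> contain \<open>a\<close> only through
  \<open>?V\<close> and \<open>?W\<close>, and these cancel between the two.\<close>

lemma theta_same_depth:
  assumes "d \<le> b" "d \<le> c"
  shows "(real b + real c + 1 - 2 * real d) * (evens a d b (Suc (Suc c)) * odds a d b c) =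
         (real c + 1 - real d) * (evens a d b (Suc c) * odds a d b (Suc c))"
  using assms
proof (induction d)
  case 0
  show ?case using boxes_theta[of b c "2 * a"] by (simp add: evens_def odds_def)
next
  case (Suc d)
  let ?f1 = "even_ratio a d b (Suc (Suc c))" and ?f0 = "even_ratio a d b (Suc c)" and ?g1 = "odd_ratio a d b c" and ?g0 = "odd_ratio a d b (Suc c)"
  let ?W = "2 * real a + real b + real c + 1 - 2 * real d" and ?V = "real a + real c + 1 - real d"
  let ?n = "real b + real c + 1 - 2 * real d" and ?n2 = "real b + real c - 2 * real d - 1"
  let ?C1 = "real c + 1 - real d" and ?C0 = "real c - real d"
  have r1: "?f1 * (?C1 * ?W) = ?f0 * (?V * ?n)"
    using even_ratio_Suc[of d b "Suc c" a] Suc.prems by (simp add: algebra_simps)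
  have r2: "?g0 * (?C0 * ?W) = ?g1 * (?V * ?n2)"
    using odd_ratio_Suc[of d b c a] Suc.prems by simp
  have IH: "?n * (evens a d b (Suc (Suc c)) * odds a d b c) = ?C1 * (evens a d b (Suc c) * odds a d b (Suc c))"
    using Suc by simp
  have nz: "?C1 \<noteq> 0" "?W \<noteq> 0" "?V \<noteq> 0" using Suc.prems by auto
  let ?P = "evens a d b (Suc (Suc c)) * odds a d b c" and ?Q = "evens a d b (Suc c) * odds a d b (Suc c)"
  have "(?C1 * ?W * ?V) * (?n2 * (?P * (?f1 * ?g1))) = (?f1 * (?C1 * ?W)) * (?g1 * (?V * ?n2)) * ?P"
    by (simp only: mult_ac)
  also have "\<dots> = (?n * ?P) * (?f0 * ?V * ?g0 * ?C0 * ?W)"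
    unfolding r1 r2[symmetric] by (simp only: mult_ac)
  also have "\<dots> = (?C1 * ?Q) * (?f0 * ?V * ?g0 * ?C0 * ?W)"
    unfolding IH ..
  also have "\<dots> = (?C1 * ?W * ?V) * (?C0 * (?Q * (?f0 * ?g0)))"
    by (simp only: mult_ac)
  finally have "?n2 * (?P * (?f1 * ?g1)) = ?C0 * (?Q * (?f0 * ?g0))" using nz by simp
  moreover have "real b + real c + 1 - 2 * real (Suc d) = ?n2" "real c + 1 - real (Suc d) = ?C0"
    by simp_all
  ultimately show ?case by (simp only: evens_Suc odds_Suc mult_ac)
qed

text \<open>Here \<open>even_ratio\<close> advances without \<open>odd_ratio\<close>, so
  \<open>?V\<close> and \<open>?W\<close> survive; this is how \<open>a\<close> enters the
  fractions.\<close>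

lemma theta_next_depth:
  assumes "d \<le> b" "d \<le> c"
  shows "(2 * real a + real b + real c + 1 - 2 * real d) * (evens a (Suc d) b (Suc (Suc c)) * odds a d b c) =
         (real a + real c + 1 - real d) * (evens a (Suc d) b (Suc c) * odds a d b (Suc c))"
proof -
  let ?f1 = "even_ratio a d b (Suc (Suc c))" and ?f0 = "even_ratio a d b (Suc c)"
  let ?W = "2 * real a + real b + real c + 1 - 2 * real d" and ?V = "real a + real c + 1 - real d"
  let ?n = "real b + real c + 1 - 2 * real d" and ?C1 = "real c + 1 - real d"
  let ?P = "evens a d b (Suc (Suc c)) * odds a d b c" and ?Q = "evens a d b (Suc c) * odds a d b (Suc c)"
  have r1: "?f1 * (?C1 * ?W) = ?f0 * (?V * ?n)"
    using even_ratio_Suc[of d b "Suc c" a] assms by (simp add: algebra_simps)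
  have IH: "?n * ?P = ?C1 * ?Q" using theta_same_depth[OF assms] .
  have nz: "?C1 \<noteq> 0" using assms by auto
  have "?C1 * (?W * (?P * ?f1)) = (?f1 * (?C1 * ?W)) * ?P" by (simp only: mult_ac)
  also have "\<dots> = (?n * ?P) * (?f0 * ?V)" unfolding r1 by (simp only: mult_ac)
  also have "\<dots> = ?C1 * (?V * (?Q * ?f0))" unfolding IH by (simp only: mult_ac)
  finally have "?W * (?P * ?f1) = ?V * (?Q * ?f0)" using nz by simp
  then show ?thesis by (simp only: evens_Suc mult_ac)
qed

section \<open>Values of the product formulas on the starting row and at the corner\<close>

lemma odds_0:
  assumes "d \<le> c"
  shows "odds 0 d d c = 1"
proof -
  \<comment> \<open>\<open>box_ratio 0 b c\<close> is binomial(b+c, b), and each factor lowers both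
    \<open>b\<close> and \<open>c\<close> by one.\<close>
  have "box_ratio 0 b c * (\<Prod>k<n. odd_ratio 0 k b c) = box_ratio 0 (b - n) (c - n)" if "n \<le> b" "n \<le> c" for n b c
    using that
  proof (induction n)
    case (Suc n)
    define B where "B = b - Suc n"
    define C where "C = c - Suc n"
    have bc: "b - n = Suc B" "c - n = Suc C" "real b - real n = real B + 1" "real c - real n = real C + 1"
      "real b + real c - 2 * real n = real B + real C + 2"
      using Suc.prems by (auto simp: B_def C_def)
    have f: "(fact (0 + Suc B + Suc C) :: real) = (real B + real C + 2) * ((real B + real C + 1) * fact (0 + B + C))"
      "(fact (0 + Suc B) :: real) = (real B + 1) * fact (0 + B)" "(fact (0 + Suc C) :: real) = (real C + 1) * fact (0 + C)"
      by (simp_all add: algebra_simps)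
    have nz: "real B + real C + 2 \<noteq> 0" "real B + real C + 1 \<noteq> 0" "real B + 1 \<noteq> 0" "real C + 1 \<noteq> 0"
      by linarith+
    have r: "odd_ratio 0 n b c = (real B + 1) * (real C + 1) / ((real B + real C + 2) * (real B + real C + 1))"
      unfolding odd_ratio_def bc by simp
    have "box_ratio 0 b c * (\<Prod>k<Suc n. odd_ratio 0 k b c) = box_ratio 0 (Suc B) (Suc C) * odd_ratio 0 n b c"
      using Suc bc by simp
    also have "\<dots> = box_ratio 0 B C"
      unfolding box_ratio_def f r using nz by (simp add: divide_simps)
    finally show ?case by (simp add: B_def C_def)
  qed simp
  from this[of d d c] show ?thesis using assms by (simp add: odds_def boxes_Suc) (simp add: box_ratio_def)
qed

text \<open>The even step at \<open>Suc d\<close> and the odd step at \<open>d\<close> have the same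
  denominators, so their quotients telescope over \<open>k < d\<close>; the remaining factor
  \<open>k = d\<close> is inserted by hand.\<close>

lemma row_products:
  fixes a c d :: nat
  assumes "d < c"
  defines "s \<equiv> real c - real d"
  shows "(\<Prod>k<Suc d. even_step a k (Suc d) c) * ((real a + real c + 1) * (real a + real d + 1) * (2 * real a + s + 1) * (2 * real a + s + 2)) =
    (\<Prod>k<d. odd_step a k d c) * (2 * (real a + 1) * (real a + s) * (real a + s + 1) * (2 * real a + 1))"
proof -
  have *: "(\<Prod>k<n. even_step a k (Suc d) c) * ((real a + real c + 1) * (2 * real a + 2 * real n + 1)) =
        (\<Prod>k<n. odd_step a k d c) * ((real a + real c - real n + 1) * (2 * real a + 1))" if "n \<le> d" for n
    using that
  proof (induction n)
    case (Suc n)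
    define E where "E = 2 * real a + real d + 1 + real c - 2 * real n"
    define Y where "Y = 2 * (real a + real d + 1 - real n) / ((real a + real n + 1) * (E * (E + 1)))"
    have f: "even_step a n (Suc d) c = Y * ((real a + real c - real n) * (2 * real a + 2 * real n + 1))"
      by (simp add: even_step_def E_def Y_def algebra_simps)
    have g: "odd_step a n d c = Y * ((real a + real c - real n + 1) * (2 * real a + 2 * real n + 3))"
      by (simp add: odd_step_def E_def Y_def algebra_simps)
    have s: "even_step a n (Suc d) c * ((real a + real c - real n + 1) * (2 * real a + 2 * real n + 3)) =
        odd_step a n d c * ((real a + real c - real n) * (2 * real a + 2 * real n + 1))"
      unfolding f g by (simp only: mult_ac)
    have "((\<Prod>k<n. even_step a k (Suc d) c) * even_step a n (Suc d) c) * ((real a + real c + 1) * (2 * real a + 2 * real n + 3)) =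
        ((\<Prod>k<n. odd_step a k d c) * odd_step a n d c) * ((real a + real c - real n) * (2 * real a + 1))"
      by (rule telescope_step[OF _ s]) (use Suc assms in auto)
    then show ?case by (simp add: algebra_simps)
  qed simp
  have e: "even_step a d (Suc d) c = 2 * (real a + 1) * (real a + s) * (2 * real a + 2 * real d + 1) /
     ((real a + real d + 1) * ((2 * real a + s + 1) * (2 * real a + s + 2)))"
    unfolding even_step_def s_def by (simp add: algebra_simps)
  define A where "A = (\<Prod>k<d. even_step a k (Suc d) c)"
  define B where "B = (\<Prod>k<d. odd_step a k d c)"
  have AB: "A * ((real a + real c + 1) * (2 * real a + 2 * real d + 1)) = B * ((real a + s + 1) * (2 * real a + 1))"
    using *[of d] by (simp add: A_def B_def s_def algebra_simps)
  have s: "s > 0" using assms by (simp add: s_def)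
  define T where "T = (real a + real d + 1) * ((2 * real a + s + 1) * (2 * real a + s + 2))"
  have T: "T \<noteq> 0" using s by (simp add: T_def add_eq_0_iff)
  have "(\<Prod>k<Suc d. even_step a k (Suc d) c) * ((real a + real c + 1) * T) =
    (A * ((real a + real c + 1) * (2 * real a + 2 * real d + 1))) * (2 * (real a + 1) * (real a + s))"
    using T by (simp add: e A_def flip: T_def)
  also have "\<dots> = B * (2 * (real a + 1) * (real a + s) * (real a + s + 1) * (2 * real a + 1))"
    unfolding AB by (simp only: mult_ac)
  finally show ?thesis unfolding B_def T_def by (simp only: mult_ac)
qed

lemma boxes_add2: "boxes (2 * Suc a) b c = boxes (2 * a) b c * (box_ratio (2 * a) b c * box_ratio (2 * a + 1) b c)"
  "boxes (2 * Suc a + 1) b c = boxes (2 * a + 1) b c * (box_ratio (2 * a + 1) b c * box_ratio (2 * a + 2) b c)"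
  by (simp_all add: boxes_Suc)

lemma evens_Suc_a: "evens (Suc a) d b c = evens a d b c * (box_ratio (2 * a) b c * box_ratio (2 * a + 1) b c * (\<Prod>k<d. even_step a k b c))"
  unfolding evens_def boxes_add2 by (simp add: even_ratio_def prod.distrib)

lemma odds_Suc_a: "odds (Suc a) d b c = odds a d b c * (box_ratio (2 * a + 1) b c * box_ratio (2 * a + 2) b c * (\<Prod>k<d. odd_step a k b c))"
proof -
  have "odd_ratio (Suc a) k b c = odd_ratio a k b c * odd_step a k b c" for k by (simp add: odd_ratio_def)
  then show ?thesis unfolding odds_def boxes_add2 by (simp add: prod.distrib)
qed

lemma hl_ratio_row_shift:
  assumes "d \<le> c"
  defines "s \<equiv> real c + 1 - real d"
  shows "hl_ratio a c (Suc d) * ((real a + real c + 2) * (real a + real d + 1) * (2 * real a + s + 1) * (2 * real a + s + 2)) =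
         hl_ratio a (Suc c) d * ((2 * real a + real c + 2) * (2 * real a + real c + 3) * ((real a + s) * (real a + s + 1)))"
proof -
  have 1: "hl_ratio a c (Suc d) * ((real a + real d + 1) * (2 * real a + s + 1)) = hl_ratio a c d * ((real c + real d + 2 * real a + 2) * (real a + s))"
    using hl_ratio_Suc_v[of a c d] by (simp add: s_def algebra_simps)
  have 2: "hl_ratio a (Suc c) d * ((2 * real a + real c + 2) * (2 * real a + real c + 3) * (real a + s + 1)) =
    hl_ratio a c d * ((real c + real d + 2 * real a + 2) * (real a + real c + 2) * (2 * real a + s + 2))"
    using hl_ratio_Suc_u[of a c d] by (simp add: s_def algebra_simps)
  have "hl_ratio a c (Suc d) * ((real a + real c + 2) * (real a + real d + 1) * (2 * real a + s + 1) * (2 * real a + s + 2)) =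
    (hl_ratio a c (Suc d) * ((real a + real d + 1) * (2 * real a + s + 1))) * ((real a + real c + 2) * (2 * real a + s + 2))"
    by (simp only: mult_ac)
  also have "\<dots> = (hl_ratio a c d * ((real c + real d + 2 * real a + 2) * (real a + real c + 2) * (2 * real a + s + 2))) * (real a + s)"
    unfolding 1 by (simp only: mult_ac)
  also have "\<dots> = hl_ratio a (Suc c) d * ((2 * real a + real c + 2) * (2 * real a + real c + 3) * ((real a + s) * (real a + s + 1)))"
    unfolding 2[symmetric] by (simp only: mult_ac)
  finally show ?thesis .
qed

lemma box_ratio_pair_shift:
  "box_ratio (2 * a) (Suc d) c * box_ratio (2 * a + 1) (Suc d) c * ((2 * real a + 1) * (2 * real a + 2)) =
   box_ratio (2 * a + 1) d c * box_ratio (2 * a + 2) d c * ((2 * real a + real c + 1) * (2 * real a + real c + 2))"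
proof -
  define F1 :: real where "F1 = fact (2 * a + d + c + 1)"
  define F2 :: real where "F2 = fact (2 * a + d + c + 2)"
  define G :: real where "G = fact (2 * a)"
  define H1 :: real where "H1 = fact (2 * a + d + 1)"
  define H2 :: real where "H2 = fact (2 * a + d + 2)"
  define J :: real where "J = fact (2 * a + c)"
  have nz: "F1 \<noteq> 0" "F2 \<noteq> 0" "G \<noteq> 0" "H1 \<noteq> 0" "H2 \<noteq> 0" "J \<noteq> 0"
    by (simp_all add: F1_def F2_def G_def H1_def H2_def J_def)
  have c: "2 * real a + 1 \<noteq> 0" "2 * real a + 2 \<noteq> 0" "2 * real a + real c + 1 \<noteq> 0" "2 * real a + real c + 2 \<noteq> 0"
    by linarith+
  have g1: "(fact (2 * a + 1) :: real) = (2 * real a + 1) * G" and g2: "(fact (2 * a + 2) :: real) = (2 * real a + 2) * ((2 * real a + 1) * G)"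
    and j1: "(fact (2 * a + 1 + c) :: real) = (2 * real a + real c + 1) * J"
    and j2: "(fact (2 * a + 2 + c) :: real) = (2 * real a + real c + 2) * ((2 * real a + real c + 1) * J)"
    by (simp_all add: G_def J_def algebra_simps)
  have i: "(fact (2 * a + Suc d + c) :: real) = F1" "(fact (2 * a + 1 + Suc d + c) :: real) = F2"
    "(fact (2 * a + Suc d) :: real) = H1" "(fact (2 * a + 1 + Suc d) :: real) = H2" "(fact (2 * a + 1 + d + c) :: real) = F1"
    "(fact (2 * a + 2 + d + c) :: real) = F2" "(fact (2 * a + 1 + d) :: real) = H1" "(fact (2 * a + 2 + d) :: real) = H2"
    unfolding F1_def F2_def H1_def H2_def by (rule arg_cong[where f = fact], simp)+
  have m1: "box_ratio (2 * a) (Suc d) c = F1 * G / (H1 * J)"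
    unfolding box_ratio_def i G_def J_def ..
  have m2: "box_ratio (2 * a + 1) (Suc d) c = F2 * ((2 * real a + 1) * G) / (H2 * ((2 * real a + real c + 1) * J))"
    unfolding box_ratio_def i g1 j1 ..
  have m3: "box_ratio (2 * a + 1) d c = F1 * ((2 * real a + 1) * G) / (H1 * ((2 * real a + real c + 1) * J))"
    unfolding box_ratio_def i g1 j1 ..
  have m4: "box_ratio (2 * a + 2) d c = F2 * ((2 * real a + 2) * ((2 * real a + 1) * G)) / (H2 * ((2 * real a + real c + 2) * ((2 * real a + real c + 1) * J)))"
    unfolding box_ratio_def i g2 j2 ..
  have "F1 * G / (H1 * J) * (F2 * (p * G) / (H2 * (r * J))) * (p * q) =
     F1 * (p * G) / (H1 * (r * J)) * (F2 * (q * (p * G)) / (H2 * (t * (r * J)))) * (r * t)" if "r \<noteq> 0" "t \<noteq> 0" for p q r t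
    using nz that by (simp add: divide_simps)
  then show ?thesis unfolding m1 m2 m3 m4 using c by blast
qed

lemma row_combine:
  fixes A :: real
  assumes A: "A * al = B * be" and L: "L * ga = R * de" and f: "f2 * al = f1 * (de * e)"
    and be: "be = ga * e" and nz: "al \<noteq> 0" "ga \<noteq> 0"
  shows "L * A * f1 = R * B * f2"
proof -
  have "(al * ga) * (L * A * f1) = (A * al) * (L * ga) * f1" by (simp only: mult_ac)
  also have "\<dots> = ga * R * B * (f1 * (de * e))" unfolding A L be by (simp only: mult_ac)
  also have "\<dots> = (al * ga) * (R * B * f2)" unfolding f[symmetric] by (simp only: mult_ac)
  finally show ?thesis using nz by simp
qed

text \<open>The product formulas satisfy the relation that \<open>path_det_boundary_row\<close>
  proves for the determinants. Going from \<open>a\<close> to \<open>a + 1\<close> changes boxes,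
  step products and \<open>hl_ratio\<close> by rational factors that balance.\<close>

lemma boundary_row_closed:
  assumes "d \<le> c"
  shows "evens a (Suc d) (Suc d) (Suc c) * hl_count a (Suc c) d = odds a d d (Suc c) * hl_count a c (Suc d)"
proof (induction a)
  case 0
  have "evens 0 (Suc d) (Suc d) (Suc c) = 1" by (simp add: evens_def even_ratio_def)
  then show ?case using odds_0[of d "Suc c"] assms by simp
next
  case (Suc a)
  define s where "s = real c + 1 - real d"
  have s: "s > 0" using assms by (simp add: s_def)
  let ?L = "box_ratio (2 * a) (Suc d) (Suc c) * box_ratio (2 * a + 1) (Suc d) (Suc c)"
  let ?R = "box_ratio (2 * a + 1) d (Suc c) * box_ratio (2 * a + 2) d (Suc c)"
  let ?A = "\<Prod>k<Suc d. even_step a k (Suc d) (Suc c)" and ?B = "\<Prod>k<d. odd_step a k d (Suc c)"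
  let ?al = "(real a + real c + 2) * (real a + real d + 1) * (2 * real a + s + 1) * (2 * real a + s + 2)"
  let ?be = "2 * (real a + 1) * (real a + s) * (real a + s + 1) * (2 * real a + 1)"
  let ?ga = "(2 * real a + 1) * (2 * real a + 2)"
  let ?de = "(2 * real a + real c + 2) * (2 * real a + real c + 3)"
  have A: "?A * ?al = ?B * ?be"
    using row_products[of d "Suc c" a] assms by (simp add: s_def add_ac)
  have box_ratio: "?L * ?ga = ?R * ?de"
    using box_ratio_pair_shift[of a d "Suc c"] by (simp add: add_ac)
  have F: "hl_ratio a c (Suc d) * ?al = hl_ratio a (Suc c) d * (?de * ((real a + s) * (real a + s + 1)))"
    using hl_ratio_row_shift[OF assms, of a] by (simp add: s_def)
  have nz: "?al \<noteq> 0" "?ga \<noteq> 0" using s by (simp_all add: add_eq_0_iff)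
  have be: "?be = ?ga * ((real a + s) * (real a + s + 1))" by (simp add: algebra_simps)
  have step: "?L * ?A * hl_ratio a (Suc c) d = ?R * ?B * hl_ratio a c (Suc d)"
    by (rule row_combine[OF A box_ratio F be nz])
  have "evens (Suc a) (Suc d) (Suc d) (Suc c) * hl_count (Suc a) (Suc c) d =
     (evens a (Suc d) (Suc d) (Suc c) * hl_count a (Suc c) d) * (?L * ?A * hl_ratio a (Suc c) d)"
    unfolding evens_Suc_a hl_count_Suc by (simp only: mult_ac)
  also have "\<dots> = odds (Suc a) d d (Suc c) * hl_count (Suc a) c (Suc d)"
    unfolding Suc.IH step odds_Suc_a hl_count_Suc by (simp only: mult_ac)
  finally show ?case .
qed

text \<open>In terms of the reversed index \<open>d - Suc k\<close> the odd factors of numerator and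
  denominator form the same product in opposite orders and cancel; the rest telescopes.\<close>

lemma prod_roF_diag: "(\<Prod>k<d. odd_step a k d d) * (real a + 1) = real a + real d + 1"
proof -
  have e: "odd_step a k d d = (real a + real (d - Suc k) + 2) * (2 * real a + 2 * real k + 3) / ((real a + real k + 1) * (2 * real a + 2 * real (d - Suc k) + 3))"
    if "k < d" for k
  proof -
    define m where "m = real (d - Suc k)"
    have m: "real d = m + real k + 1" using that by (simp add: m_def)
    have "m \<ge> 0" by (simp add: m_def)
    then have nz: "real a + m + 2 \<noteq> 0" by linarith
    have "odd_step a k d d = (2 * (real a + m + 2)) * ((real a + m + 2) * (2 * real a + 2 * real k + 3)) /
       ((2 * (real a + m + 2)) * ((real a + real k + 1) * (2 * real a + 2 * m + 3)))"
      unfolding odd_step_def m by (simp add: algebra_simps)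
    then show ?thesis using nz by (simp only: m_def mult_divide_mult_cancel_left_if) simp
  qed
  have r1: "(\<Prod>k<d. real a + real (d - Suc k) + 2) = (\<Prod>k<d. real a + real k + 2)"
    by (rule prod.nat_diff_reindex)
  have r2: "(\<Prod>k<d. 2 * real a + 2 * real (d - Suc k) + 3) = (\<Prod>k<d. 2 * real a + 2 * real k + 3)"
    by (rule prod.nat_diff_reindex)
  have "(\<Prod>k<d. odd_step a k d d) = (\<Prod>k<d. (real a + real (d - Suc k) + 2) * (2 * real a + 2 * real k + 3) / ((real a + real k + 1) * (2 * real a + 2 * real (d - Suc k) + 3)))"
    by (rule prod.cong) (auto simp: e)
  also have "\<dots> = (\<Prod>k<d. real a + real k + 2) * (\<Prod>k<d. 2 * real a + 2 * real k + 3) / ((\<Prod>k<d. real a + real k + 1) * (\<Prod>k<d. 2 * real a + 2 * real k + 3))"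
    unfolding prod_dividef prod.distrib r1 r2 ..
  also have "\<dots> = (\<Prod>k<d. real a + real k + 2) / (\<Prod>k<d. real a + real k + 1)"
  proof -
    have "(\<Prod>k<d. 2 * real a + 2 * real k + 3) > 0" by (intro prod_pos) auto
    then show ?thesis by simp
  qed
  finally have P: "(\<Prod>k<d. odd_step a k d d) = (\<Prod>k<d. real a + real k + 2) / (\<Prod>k<d. real a + real k + 1)" .
  have "(\<Prod>k<d. real a + real k + 2) * (real a + 1) = (\<Prod>k<d. real a + real k + 1) * (real a + real d + 1)"
    by (induction d) (simp_all add: algebra_simps)
  moreover have "(\<Prod>k<d. real a + real k + 1) > 0" by (intro prod_pos) auto
  ultimately show ?thesis unfolding P by (simp add: divide_simps)
qed

lemma corner_closed: "odds a d d d = hl_count a d d ^ 2"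
proof (induction a)
  case 0
  then show ?case by (simp add: odds_0)
next
  case (Suc a)
  define F :: real where "F = fact (2 * a + 1 + 2 * d)"
  define G :: real where "G = fact (2 * a + 1)"
  define H1 :: real where "H1 = fact (2 * a + 1 + d)"
  define H2 :: real where "H2 = fact (2 * a + 2 + d)"
  have nz: "F \<noteq> 0" "G \<noteq> 0" "H1 \<noteq> 0" "H2 \<noteq> 0" by (simp_all add: F_def G_def H1_def H2_def)
  have a1: "real a + 1 \<noteq> 0" by linarith
  have f2: "(fact (2 * a + 2 + 2 * d) :: real) = 2 * (real a + real d + 1) * F"
    and g2: "(fact (2 * a + 2) :: real) = 2 * (real a + 1) * G"
    by (simp_all add: F_def G_def algebra_simps)
  have i: "(fact (2 * a + 1 + d + d) :: real) = F" "(fact (2 * a + 2 + d + d) :: real) = fact (2 * a + 2 + 2 * d)"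
     "(fact (d + d + 2 * a + 1) :: real) = F" "(fact (d + 2 * a + 1) :: real) = H1" "(fact (d + 2 * a + 2) :: real) = H2"
    unfolding F_def H1_def H2_def by (rule arg_cong[where f = fact], simp)+
  have m1: "box_ratio (2 * a + 1) d d = F * G / (H1 * H1)"
    unfolding box_ratio_def i G_def H1_def ..
  have m2: "box_ratio (2 * a + 2) d d = (2 * (real a + real d + 1) * F) * (2 * (real a + 1) * G) / (H2 * H2)"
    unfolding box_ratio_def i f2 g2 H2_def ..
  have P: "fact (a + 1) * (\<Prod>i<n. real a + 2 + real i) = fact (a + 1 + n)" for n
  proof (induction n)
    case (Suc n)
    have "(fact (a + 1 + Suc n) :: real) = fact (a + 1 + n) * (real a + 2 + real n)"
      using fact_Suc[of "a + 1 + n", where 'a = real] by (simp add: mult_ac add_ac)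
    then show ?case by (simp only: prod.lessThan_Suc mult.assoc[symmetric] Suc.IH)
  qed simp
  have "(fact (a + 1) :: real) = (real a + 1) * fact a" by simp
  moreover have "a + 1 + Suc a = 2 * a + 2" by simp
  ultimately have P': "(real a + 1) * (fact a * (\<Prod>i<Suc a. real a + 2 + real i)) = (real a + 1) * (2 * G)"
    using P[of "Suc a"] g2 by (metis mult.assoc mult.commute)
  then have P'': "fact a * (\<Prod>i<Suc a. real a + 2 + real i) = 2 * G" using a1 by (metis mult_left_cancel)
  have "hl_ratio a d d = (fact a * (\<Prod>i<Suc a. real a + 2 + real i)) * F * fact (d + a + 1) / (fact (d + a) * H1 * H2)"
    unfolding hl_ratio_def i by (simp only: diff_self add_0_left mult_ac)
  moreover have "(fact (d + a + 1) :: real) = (real a + real d + 1) * fact (d + a)"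
    by (simp add: algebra_simps)
  ultimately have hl_ratio: "hl_ratio a d d = 2 * G * F * (real a + real d + 1) / (H1 * H2)"
    unfolding P'' by (simp add: mult_ac)
  have "box_ratio (2 * a + 1) d d * box_ratio (2 * a + 2) d d * (\<Prod>k<d. odd_step a k d d) = hl_ratio a d d ^ 2"
  proof -
    have "(\<Prod>k<d. odd_step a k d d) = (real a + real d + 1) / (real a + 1)"
      using prod_roF_diag[of a d] a1 by (simp add: eq_divide_eq)
    moreover have "F * G / (H1 * H1) * ((2 * w * F) * (2 * x * G) / (H2 * H2)) * (w / x) = (2 * G * F * w / (H1 * H2))\<^sup>2"
      if "x \<noteq> 0" for w x
      using nz that by (simp add: power2_eq_square divide_simps)
    ultimately show ?thesis unfolding m1 m2 hl_ratio using a1 by metis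
  qed
  then show ?case unfolding odds_Suc_a hl_count_Suc Suc.IH power_mult_distrib by simp
qed

section \<open>The determinants satisfy the product formulas\<close>

lemma path_det_same_depth_three_term:
  assumes "2 * d \<le> Suc (b + c)"
  shows "path_det (2 * a) d (Suc b) (Suc c) * path_det (2 * a + 1) d (Suc b) (Suc c) =
   path_det (2 * a) d (Suc b) (Suc (Suc c)) * path_det (2 * a + 1) d (Suc b) c + path_det (2 * a) d (Suc (Suc b)) (Suc c) * path_det (2 * a + 1) d b (Suc c)"
proof -
  define N where "N = Suc (b + c) - 2 * d"
  have n: "Suc b + Suc c - 2 * d = Suc N" "Suc b + Suc (Suc c) - 2 * d = Suc (Suc N)" "Suc (Suc b) + Suc c - 2 * d = Suc (Suc N)"
    "Suc b + c - 2 * d = N" "b + Suc c - 2 * d = N" using assms by (simp_all add: N_def)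
  show ?thesis
    using rows_det_three_term_same_depth[of a d N "int b - int c - 1 - 2 * int a"]
    unfolding path_det_def n by (simp add: algebra_simps)
qed

lemma path_det_next_depth_three_term:
  assumes "2 * d \<le> b + c"
  shows "path_det (2 * a) (Suc d) (Suc b) (Suc c) * path_det (2 * a + 1) d (Suc b) (Suc c) =
   path_det (2 * a) (Suc d) (Suc b) (Suc (Suc c)) * path_det (2 * a + 1) d (Suc b) c + path_det (2 * a) (Suc d) (Suc (Suc b)) (Suc c) * path_det (2 * a + 1) d b (Suc c)"
proof -
  define N where "N = b + c - 2 * d"
  have n: "Suc b + Suc c - 2 * d = Suc (Suc N)" "Suc b + Suc c - 2 * Suc d = N"
    "Suc b + Suc (Suc c) - 2 * Suc d = Suc N" "Suc (Suc b) + Suc c - 2 * Suc d = Suc N"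
    "Suc b + c - 2 * d = Suc N" "b + Suc c - 2 * d = Suc N" using assms by (simp_all add: N_def)
  show ?thesis
    using rows_det_three_term_next_depth[of a d N "int b - int c - 1 - 2 * int a"]
    unfolding path_det_def n by (simp add: algebra_simps)
qed

text \<open>Boundary value one unit outside the range \<open>Suc d <= b\<close>, matching the zero
  of the fraction with numerator \<open>b - d\<close>.\<close>

lemma path_det_odd_vanish_b: "d \<le> c \<Longrightarrow> path_det (2 * a + 1) (Suc d) d (Suc (Suc c)) = 0"
  using rows_det_odd_vanish_up[of a "Suc d" "c - d"] by (simp add: path_det_def algebra_simps)

lemma path_det_odd_vanish_c: "d \<le> b \<Longrightarrow> path_det (2 * a + 1) (Suc d) (Suc (Suc b)) d = 0"
  using rows_det_odd_vanish_down[of a "Suc d" "b - d"] by (simp add: path_det_def algebra_simps)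

text \<open>For \<open>b = d + 1\<close> no path crosses the axis, and the determinant splits into walks on two half lines.\<close>

lemma path_det_boundary_row:
  assumes "d \<le> c"
  shows "path_det (2 * a) (Suc d) (Suc d) (Suc c) * hl_count a (Suc c) d = path_det (2 * a + 1) d d (Suc c) * hl_count a c (Suc d)"
proof -
  define N where "N = Suc c - d"
  have N: "N \<ge> 1" "int N = int c + 1 - int d" "N + 2 * d = Suc c + d" using assms by (auto simp: N_def)
  have E: "path_det (2 * a) (Suc d) (Suc d) (Suc c) = rows_det (2 * a) (Suc d) (N - 1) (2 - int N - 2 * int a)"
    unfolding path_det_def using assms N by (simp add: N_def algebra_simps)
  have O: "path_det (2 * a + 1) d d (Suc c) = rows_det (2 * a + 1) d N (- int N - 2 * int a)"
    unfolding path_det_def using assms N by (simp add: N_def algebra_simps)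
  have K1: "hl_det a (N + 2 * d) (int N + 2) = hl_count a (Suc c) d"
    unfolding N(2,3) using hl_det_closed_form[of d "Suc c" a] assms by (simp add: algebra_simps)
  have K2: "hl_det a (N + 2 * d) (int N) = hl_count a c (Suc d)"
    unfolding N(2,3) using hl_det_closed_form[of "Suc d" c a] assms by (simp add: algebra_simps)
  show ?thesis unfolding E O rows_det_even_split[OF N(1)] rows_det_odd_split K1 K2 by (simp only: mult_ac)
qed

text \<open>No step remains after the wall, so the tip path has length 0 and the paths above and
  below the axis are independent mirror images.\<close>

lemma path_det_corner: "path_det (2 * a + 1) d d d = hl_count a d d ^ 2"
proof -
  have "path_det (2 * a + 1) d d d = rows_det (2 * a + 1) d 0 (- int 0 - 2 * int a)"
    by (simp add: path_det_def)
  also have "\<dots> = hl_det a (2 * d) 2 * hl_det a (2 * d) 2"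
    unfolding rows_det_odd_split upper_block_0 by simp
  also have "hl_det a (2 * d) 2 = hl_count a d d"
    using hl_det_closed_form[of d d a] by (simp add: mult_2)
  finally show ?thesis by (simp add: power2_eq_square)
qed

theorem path_det_closed_forms:
  shows "\<forall>b c. d \<le> b \<longrightarrow> d \<le> c \<longrightarrow> path_det (2 * a) d b c = evens a d b c"
    and "\<forall>b c. d \<le> b \<longrightarrow> d \<le> c \<longrightarrow> path_det (2 * a + 1) d b c = odds a d b c"
proof (induction d)
  case 0
  {
    case 1
    show ?case by (simp add: macmahon_det evens_def)
  next
    case 2
    show ?case by (simp add: macmahon_det odds_def)
  }
next
  case (Suc d)
  note IHo = Suc.IH(2)
  \<comment> \<open>The odd determinants are those of depth \<open>d\<close> and known, while all
    three even ones are unknown. The relation is solved for the one with the largest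
    \<open>b\<close>, so the induction on \<open>b\<close> treats all \<open>c\<close> at once and
    starts from a complete row.\<close>
  have E: "path_det (2 * a) (Suc d) (Suc b) (Suc c) = evens a (Suc d) (Suc b) (Suc c)" if "d \<le> b" "d \<le> c" for b c
    using that
  proof (induction b arbitrary: c rule: nat_induct_at_least[of d])
    case base
    have "path_det (2 * a) (Suc d) (Suc d) (Suc c) * hl_count a (Suc c) d = evens a (Suc d) (Suc d) (Suc c) * hl_count a (Suc c) d"
      unfolding boundary_row_closed[OF base] path_det_boundary_row[OF base] using IHo base by simp
    moreover have "hl_count a (Suc c) d > 0" using base by (intro hl_count_pos) simp
    ultimately show ?case by simp
  next
    case (Suc b)
    have p: "path_det (2 * a + 1) d b' c' = odds a d b' c'" if "b \<le> b'" "d \<le> c'" for b' c'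
      using IHo Suc.hyps that by simp
    let ?W = "2 * real a + real b + real c + 2 - 2 * real d"
    have W: "?W > 0" using Suc by simp
    have "evens a (Suc d) (Suc b) (Suc c) * odds a d (Suc b) (Suc c) =
       evens a (Suc d) (Suc b) (Suc (Suc c)) * odds a d (Suc b) c + path_det (2 * a) (Suc d) (Suc (Suc b)) (Suc c) * odds a d b (Suc c)"
      using path_det_next_depth_three_term[of d b c a] Suc p by simp
    moreover have t1: "?W * (evens a (Suc d) (Suc b) (Suc (Suc c)) * odds a d (Suc b) c) =
        (real a + real c + 1 - real d) * (evens a (Suc d) (Suc b) (Suc c) * odds a d (Suc b) (Suc c))"
      using theta_next_depth[of d "Suc b" c a] Suc by (simp add: algebra_simps)
    moreover have t2: "?W * (evens a (Suc d) (Suc (Suc b)) (Suc c) * odds a d b (Suc c)) =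
        (real a + real b + 1 - real d) * (evens a (Suc d) (Suc b) (Suc c) * odds a d (Suc b) (Suc c))"
      using theta_next_depth[of d "Suc c" b a] Suc unfolding evens_sym[of _ _ "Suc c"] odds_sym[of _ _ "Suc c"]
      by (simp add: algebra_simps)
    ultimately have "?W * (path_det (2 * a) (Suc d) (Suc (Suc b)) (Suc c) * odds a d b (Suc c)) =
       ?W * (evens a (Suc d) (Suc (Suc b)) (Suc c) * odds a d b (Suc c))"
      by (simp add: algebra_simps)
    moreover have "odds a d b (Suc c) > 0" using Suc by (intro odds_pos) auto
    ultimately show ?case using W by simp
  qed
  {
    case 1
    show ?case using E by (metis Suc_le_D Suc_le_mono)
  next
    case 2
    \<comment> \<open>Now the even determinants are known and the relation is solved for its
      left-hand side. The corner is the only nonzero starting value; beyond the two edges of the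
      range the determinants vanish.\<close>
    have "path_det (2 * a + 1) (Suc d) (Suc b) (Suc c) = odds a (Suc d) (Suc b) (Suc c)" if "d \<le> b" "d \<le> c" for b c
      using that
    proof (induction "b + c" arbitrary: b c rule: less_induct)
      case less
      show ?case
      proof (cases "b = d \<and> c = d")
        case True
        then show ?thesis using path_det_corner[of a "Suc d"] corner_closed[of a "Suc d"] by simp
      next
        case False
        let ?n = "real b + real c - 2 * real d"
        have n: "?n > 0" using False less.prems by (auto simp: le_eq_less_or_eq)
        have T: "path_det (2 * a) (Suc d) (Suc b) (Suc c) * path_det (2 * a + 1) (Suc d) (Suc b) (Suc c) =
          path_det (2 * a) (Suc d) (Suc b) (Suc (Suc c)) * path_det (2 * a + 1) (Suc d) (Suc b) c + path_det (2 * a) (Suc d) (Suc (Suc b)) (Suc c) * path_det (2 * a + 1) (Suc d) b (Suc c)"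
          by (rule path_det_same_depth_three_term) (use False less.prems in auto)
        have t1: "?n * (path_det (2 * a) (Suc d) (Suc b) (Suc (Suc c)) * path_det (2 * a + 1) (Suc d) (Suc b) c) =
           (real c - real d) * (evens a (Suc d) (Suc b) (Suc c) * odds a (Suc d) (Suc b) (Suc c))"
        proof (cases "c = d")
          case True
          then obtain b' where "b = Suc b'" "d \<le> b'" using False less.prems by (cases b) auto
          then show ?thesis using True path_det_odd_vanish_c[of d b' a] by simp
        next
          case False
          then obtain c' where c': "c = Suc c'" "d \<le> c'" using less.prems by (cases c) auto
          then have "path_det (2 * a + 1) (Suc d) (Suc b) c = odds a (Suc d) (Suc b) c"
            using less by simp
          then show ?thesis using theta_same_depth[of "Suc d" "Suc b" c a] E c' less.prems by (simp add: algebra_simps)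
        qed
        have t2: "?n * (path_det (2 * a) (Suc d) (Suc (Suc b)) (Suc c) * path_det (2 * a + 1) (Suc d) b (Suc c)) =
           (real b - real d) * (evens a (Suc d) (Suc b) (Suc c) * odds a (Suc d) (Suc b) (Suc c))"
        proof (cases "b = d")
          case True
          then obtain c' where "c = Suc c'" "d \<le> c'" using False less.prems by (cases c) auto
          then show ?thesis using True path_det_odd_vanish_b[of d c' a] by simp
        next
          case False
          then obtain b' where b': "b = Suc b'" "d \<le> b'" using less.prems by (cases b) auto
          then have "path_det (2 * a + 1) (Suc d) b (Suc c) = odds a (Suc d) b (Suc c)"
            using less by simp
          then show ?thesis using theta_same_depth[of "Suc d" "Suc c" b a] E b' less.prems
            unfolding evens_sym[of _ _ "Suc c"] odds_sym[of _ _ "Suc c"] by (simp add: algebra_simps)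
        qed
        show ?thesis
        proof (rule solve_three_term[OF T, of ?n "real c - real d" _ "real b - real d"])
          show "path_det (2 * a) (Suc d) (Suc b) (Suc c) \<noteq> 0"
            using E[OF less.prems] evens_pos[of "Suc d" "Suc b" "Suc c" a] less.prems by simp
        qed (use n t1 t2 E[OF less.prems] in auto)
      qed
    qed
    then show ?case by (metis Suc_le_D Suc_le_mono)
  }
qed

section \<open>Tilings\<close>

definition adj :: "tri \<Rightarrow> tri \<Rightarrow> bool" where
  "adj t t' \<longleftrightarrow> card (verts t \<inter> verts t') = 2"

lemma adj_sym: "adj t t' \<longleftrightarrow> adj t' t"
  by (simp add: adj_def Int_commute)

lemma adj_Rt_Rt: "\<not> adj (Rt i j) (Rt k l)"
  unfolding adj_def by (auto simp: Int_insert_left card_insert_if)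

lemma adj_Lt_Lt: "\<not> adj (Lt i j) (Lt k l)"
  unfolding adj_def by (auto simp: Int_insert_left card_insert_if)

lemma adj_Rt_Lt: "adj (Rt i j) (Lt k l) \<longleftrightarrow> (k = i \<and> l = j) \<or> (k = i \<and> l = j - 1) \<or> (k = i - 1 \<and> l = j)"
  unfolding adj_def by (auto simp: Int_insert_left card_insert_if)

lemma adj_Lt_Rt: "adj (Lt i j) (Rt k l) \<longleftrightarrow> (k = i \<and> l = j) \<or> (k = i \<and> l = j + 1) \<or> (k = i + 1 \<and> l = j)"
  unfolding adj_sym[of "Lt i j"] adj_Rt_Lt by auto

lemma adj_neq: "adj t t' \<Longrightarrow> t \<noteq> t'"
  by (cases t) (auto simp: adj_Rt_Rt adj_Lt_Lt)

lemma is_lozenge_iff: "is_lozenge X \<longleftrightarrow> (\<exists>t t'. X = {t, t'} \<and> adj t t')"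
  by (simp add: is_lozenge_def adj_def)

lemma finite_tilings: "finite R \<Longrightarrow> finite (tilings R)"
  by (rule finite_subset[of _ "Pow (Pow R)"]) (auto simp: tilings_def)

lemma tilings_empty: "tilings {} = {{}}"
  by (auto simp: tilings_def is_lozenge_def)

lemma M_empty [simp]: "M {} = 1"
  by (simp add: M_def tilings_empty)

lemma tilings_split:
  assumes "t \<in> R"
  shows "tilings R = (\<Union>t'\<in>{t'\<in>R. adj t t'}. insert {t, t'} ` tilings (R - {t, t'}))"
proof (intro equalityI subsetI)
  fix T assume T: "T \<in> tilings R"
  then obtain X where X: "X \<in> T" "t \<in> X" using assms by (auto simp: tilings_def)
  then have "is_lozenge X" "X \<subseteq> R" using T by (auto simp: tilings_def)
  then obtain t' where t': "X = {t, t'}" "adj t t'"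
    using X(2) adj_sym unfolding is_lozenge_iff by auto
  have dj: "disjnt X Y" if "Y \<in> T" "Y \<noteq> X" for Y
    using T X(1) that by (auto simp: tilings_def pairwise_def disjnt_sym)
  have "T - {X} \<in> tilings (R - {t, t'})"
    unfolding tilings_def
  proof (intro CollectI conjI ballI)
    fix Y assume Y: "Y \<in> T - {X}"
    then show "is_lozenge Y" using T by (auto simp: tilings_def)
    show "Y \<subseteq> R - {t, t'}" using Y T dj[of Y] t' by (auto simp: tilings_def disjnt_def)
  next
    have "\<Union> T = R" using T by (simp add: tilings_def)
    moreover have "\<Union> (T - {X}) \<inter> X = {}" using dj by (auto simp: disjnt_def)
    ultimately show "\<Union> (T - {X}) = R - {t, t'}" using X(1) t'(1) by auto
  next
    show "pairwise disjnt (T - {X})" using T by (auto simp: tilings_def pairwise_def)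
  qed
  moreover have "T = insert {t, t'} (T - {X})" using X t' by auto
  moreover have "t' \<in> R" using \<open>X \<subseteq> R\<close> t' by auto
  ultimately show "T \<in> (\<Union>t'\<in>{t'\<in>R. adj t t'}. insert {t, t'} ` tilings (R - {t, t'}))"
    using t'(2) by blast
next
  fix T assume "T \<in> (\<Union>t'\<in>{t'\<in>R. adj t t'}. insert {t, t'} ` tilings (R - {t, t'}))"
  then obtain t' T' where t': "t' \<in> R" "adj t t'" "T' \<in> tilings (R - {t, t'})" "T = insert {t, t'} T'"
    by blast
  then have "is_lozenge {t, t'}" by (auto simp: is_lozenge_iff)
  moreover have "disjnt {t, t'} Y" "disjnt Y {t, t'}" if "Y \<in> T'" for Y
    using t'(3) that by (auto simp: tilings_def disjnt_def)
  ultimately show "T \<in> tilings R"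
    using t' assms unfolding tilings_def by (auto simp: pairwise_insert)
qed

lemma M_recursion:
  assumes "finite R" "t \<in> R"
  shows "M R = (\<Sum>t'\<in>{t'\<in>R. adj t t'}. M (R - {t, t'}))"
proof -
  have notin: "{t, t'} \<notin> T" if "T \<in> tilings (R - {t, t''})" for t' t'' T
    using that by (auto simp: tilings_def)
  have inj: "inj_on (insert {t, t'}) (tilings (R - {t, t'}))" for t'
    by (rule inj_onI) (metis notin Diff_insert_absorb)
  have "M R = (\<Sum>t'\<in>{t'\<in>R. adj t t'}. card (insert {t, t'} ` tilings (R - {t, t'})))"
    unfolding M_def tilings_split[OF assms(2)]
  proof (rule card_UN_disjoint)
    show "finite {t'\<in>R. adj t t'}" using assms by simp
    show "\<forall>t'\<in>{t'\<in>R. adj t t'}. finite (insert {t, t'} ` tilings (R - {t, t'}))"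
      using assms by (auto intro!: finite_tilings)
    show "\<forall>i\<in>{t'\<in>R. adj t t'}. \<forall>j\<in>{t'\<in>R. adj t t'}. i \<noteq> j \<longrightarrow>
       insert {t, i} ` tilings (R - {t, i}) \<inter> insert {t, j} ` tilings (R - {t, j}) = {}"
    proof (intro ballI impI)
      fix i j assume ij: "i \<in> {t'\<in>R. adj t t'}" "j \<in> {t'\<in>R. adj t t'}" "i \<noteq> j"
      then have ne: "{t, i} \<noteq> {t, j}" using adj_neq by (auto simp: doubleton_eq_iff)
      have False if T: "T1 \<in> tilings (R - {t, i})" "T2 \<in> tilings (R - {t, j})" "insert {t, i} T1 = insert {t, j} T2" for T1 T2
      proof -
        have "{t, i} \<in> T2" using T(3) ne by (metis insertE insertI1)
        then show False using notin[OF T(2)] by simp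
      qed
      then show "insert {t, i} ` tilings (R - {t, i}) \<inter> insert {t, j} ` tilings (R - {t, j}) = {}"
        by (simp add: disjoint_iff image_iff) metis
    qed
  qed
  also have "\<dots> = (\<Sum>t'\<in>{t'\<in>R. adj t t'}. M (R - {t, t'}))"
    by (rule sum.cong) (auto simp: M_def card_image[OF inj])
  finally show ?thesis .
qed

lemma M_no_neighbour: "finite R \<Longrightarrow> t \<in> R \<Longrightarrow> (\<And>t'. t' \<in> R \<Longrightarrow> \<not> adj t t') \<Longrightarrow> M R = 0"
  by (auto simp: M_recursion[of R t] intro!: sum.neutral)

lemma M_forced:
  assumes "finite R" "t \<in> R" "u \<in> R" "adj t u" "\<And>t'. t' \<in> R \<Longrightarrow> adj t t' \<Longrightarrow> t' = u"
  shows "M R = M (R - {t, u})"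
proof -
  have "{t'\<in>R. adj t t'} = {u}" using assms(3-5) by blast
  then show ?thesis unfolding M_recursion[OF assms(1,2)] by simp
qed

section \<open>Peeling a region column by column\<close>

definition below :: "(nat \<Rightarrow> int set) \<Rightarrow> (nat \<Rightarrow> int set) \<Rightarrow> nat \<Rightarrow> tri set" where
  "below A B x = (\<Union>y<x. Rt (int y) ` A y \<union> Lt (int y - 1) ` B y)"

text \<open>Triangles are sorted by the abscissa of their vertical edge. While column
  \<open>x\<close> is being processed, \<open>S\<close> holds the triangles
  \<open>Lt (int x)\<close> still to be matched and \<open>I\<close> the triangles
  \<open>Rt (int x)\<close> already used.\<close>

definition partial :: "(nat \<Rightarrow> int set) \<Rightarrow> (nat \<Rightarrow> int set) \<Rightarrow> nat \<Rightarrow> int set \<Rightarrow> int set \<Rightarrow> tri set" where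
  "partial A B x I S = below A B x \<union> Lt (int x - 1) ` B x \<union> Rt (int x) ` (A x - I) \<union> Lt (int x) ` S"

lemma finite_below: "(\<And>x. finite (A x)) \<Longrightarrow> (\<And>x. finite (B x)) \<Longrightarrow> finite (below A B x)"
  by (simp add: below_def)

text \<open>The third neighbour of \<open>Lt (int x) j\<close>, across its vertical edge, lies to
  the right of the remaining region.\<close>

lemma M_partial_step:
  assumes fin: "\<And>x. finite (A x)" "\<And>x. finite (B x)" "finite S" and j: "j \<notin> S"
  shows "M (partial A B x I (insert j S)) =
    (if j \<in> A x - I then M (partial A B x (insert j I) S) else 0) +
    (if j + 1 \<in> A x - I then M (partial A B x (insert (j + 1) I) S) else 0)"
proof -
  let ?R = "partial A B x I (insert j S)"
  have f: "finite ?R" using fin by (simp add: partial_def finite_below)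
  have nb: "{t'\<in>?R. adj (Lt (int x) j) t'} = Rt (int x) ` ({j, j + 1} \<inter> (A x - I))" (is "?X = ?Y")
  proof (intro equalityI subsetI)
    fix t' assume "t' \<in> ?X"
    then show "t' \<in> ?Y"
      by (cases t') (auto simp: partial_def below_def adj_Lt_Lt adj_Lt_Rt)
  qed (auto simp: partial_def adj_Lt_Rt)
  have d: "?R - {Lt (int x) j, Rt (int x) k} = partial A B x (insert k I) S" for k
    using j by (auto simp: partial_def below_def)
  have "M ?R = (\<Sum>t'\<in>Rt (int x) ` ({j, j + 1} \<inter> (A x - I)). M (?R - {Lt (int x) j, t'}))"
    using M_recursion[OF f, of "Lt (int x) j"] unfolding nb by (simp add: partial_def)
  also have "\<dots> = (\<Sum>k\<in>{j, j + 1} \<inter> (A x - I). M (partial A B x (insert k I) S))"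
    by (subst sum.reindex) (auto simp: inj_on_def d)
  also have "\<dots> = (\<Sum>k\<in>{j, j + 1}. if k \<in> A x - I then M (partial A B x (insert k I) S) else 0)"
    by (rule sum.mono_neutral_cong_left) auto
  finally show ?thesis by simp
qed

text \<open>The right frontier now consists of triangles \<open>Rt (int x) k\<close> whose only
  possible partner is \<open>Lt (int x - 1) k\<close>. The resulting lozenges cover the edges that
  no path crosses.\<close>

lemma M_horizontal_forced:
  assumes fin: "\<And>x. finite (A x)" "\<And>x. finite (B x)" "finite D" "finite C"
  shows "C \<subseteq> D \<Longrightarrow> M (below A B x \<union> Lt (int x - 1) ` D \<union> Rt (int x) ` C) = M (below A B x \<union> Lt (int x - 1) ` (D - C))"
    and "\<not> C \<subseteq> D \<Longrightarrow> M (below A B x \<union> Lt (int x - 1) ` D \<union> Rt (int x) ` C) = 0"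
proof -
  have nb: "t' = Lt (int x - 1) k" if "t' \<in> below A B x \<union> Lt (int x - 1) ` D \<union> Rt (int x) ` C" "adj (Rt (int x) k) t'" for t' k C D
    using that by (cases t') (auto simp: below_def adj_Rt_Rt adj_Rt_Lt)
  show "\<not> C \<subseteq> D \<Longrightarrow> M (below A B x \<union> Lt (int x - 1) ` D \<union> Rt (int x) ` C) = 0"
  proof -
    assume "\<not> C \<subseteq> D"
    then obtain k where k: "k \<in> C" "k \<notin> D" by auto
    let ?R = "below A B x \<union> Lt (int x - 1) ` D \<union> Rt (int x) ` C"
    have n: "Lt (int x - 1) k \<notin> ?R" using k by (auto simp: below_def)
    show ?thesis
    proof (rule M_no_neighbour)
      show "finite ?R" using fin by (simp add: finite_below)
      show "Rt (int x) k \<in> ?R" using k by blast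
      show "\<not> adj (Rt (int x) k) t'" if "t' \<in> ?R" for t' using nb[OF that] n that by metis
    qed
  qed
  show "C \<subseteq> D \<Longrightarrow> M (below A B x \<union> Lt (int x - 1) ` D \<union> Rt (int x) ` C) = M (below A B x \<union> Lt (int x - 1) ` (D - C))"
    using fin(4,3)
  proof (induction C arbitrary: D rule: finite_induct)
    case empty
    then show ?case by simp
  next
    case (insert k C)
    let ?R = "below A B x \<union> Lt (int x - 1) ` D \<union> Rt (int x) ` insert k C"
    have "M ?R = M (?R - {Rt (int x) k, Lt (int x - 1) k})"
    proof (rule M_forced)
      show "finite ?R" using fin insert by (simp add: finite_below)
      show "t' = Lt (int x - 1) k" if "t' \<in> ?R" "adj (Rt (int x) k) t'" for t' using nb that by blast
    qed (use insert.prems in \<open>auto simp: adj_Rt_Lt\<close>)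
    also have "?R - {Rt (int x) k, Lt (int x - 1) k} = below A B x \<union> Lt (int x - 1) ` (D - {k}) \<union> Rt (int x) ` C"
      using insert.hyps by (auto simp: below_def)
    also have "M \<dots> = M (below A B x \<union> Lt (int x - 1) ` (D - {k} - C))"
      using insert by (intro insert.IH) auto
    also have "D - {k} - C = D - insert k C" by auto
    finally show ?case .
  qed
qed

section \<open>Alternating forms in a list of columns\<close>

definition cdet :: "(nat \<Rightarrow> real) list \<Rightarrow> real" where
  "cdet vs = fdet (length vs) (\<lambda>i j. (vs ! j) i)"

text \<open>What the peeling argument uses about determinants, abstracted so that it applies to
  \<open>cdet\<close> and to \<open>cdet_with\<close> alike.\<close>

definition alternating :: "((nat \<Rightarrow> real) list \<Rightarrow> real) \<Rightarrow> bool" where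
  "alternating D \<longleftrightarrow> (\<forall>xs u v ys. D (xs @ (\<lambda>i. u i + v i) # ys) = D (xs @ u # ys) + D (xs @ v # ys)) \<and>
     (\<forall>xs u ys zs. D (xs @ u # ys @ u # zs) = 0)"

lemma alternating_add: "alternating D \<Longrightarrow> D (xs @ (\<lambda>i. u i + v i) # ys) = D (xs @ u # ys) + D (xs @ v # ys)"
  by (simp add: alternating_def)

lemma alternating_same: "alternating D \<Longrightarrow> D (xs @ u # ys @ u # zs) = 0"
  by (simp add: alternating_def)

lemma alternating_zero: "alternating D \<Longrightarrow> D (xs @ (\<lambda>i. 0) # ys) = 0"
  using alternating_add[of D xs "\<lambda>i. 0" "\<lambda>i. 0" ys] by simp

lemma alternating_cdet: "alternating cdet"
  unfolding alternating_def
proof (intro conjI allI)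
  fix xs ys :: "(nat \<Rightarrow> real) list" and u v
  show "cdet (xs @ (\<lambda>i. u i + v i) # ys) = cdet (xs @ u # ys) + cdet (xs @ v # ys)"
  proof -
    have l: "length (xs @ w # ys) = length xs + Suc (length ys)" for w :: "nat \<Rightarrow> real" by simp
    show ?thesis unfolding cdet_def l
      by (rule fdet_column_add[of "length xs"]) (auto simp: nth_append nth_Cons')
  qed
next
  fix xs ys zs :: "(nat \<Rightarrow> real) list" and u
  show "cdet (xs @ u # ys @ u # zs) = 0"
    unfolding cdet_def
    by (rule fdet_identical_columns[of "length xs" "length xs + Suc (length ys)"]) (auto simp: nth_append)
qed

text \<open>Serves the columns before the tip: the path born there has no edge yet, and its later
  column \<open>e\<close> is supplied at position \<open>l\<close>.\<close>

definition cdet_with :: "nat \<Rightarrow> (nat \<Rightarrow> real) \<Rightarrow> (nat \<Rightarrow> real) list \<Rightarrow> real" where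
  "cdet_with l e vs = cdet (take l vs @ e # drop l vs)"

lemma alternating_cdet_with: "alternating (cdet_with l e)"
  unfolding alternating_def
proof (intro conjI allI)
  fix xs ys :: "(nat \<Rightarrow> real) list" and u v
  show "cdet_with l e (xs @ (\<lambda>i. u i + v i) # ys) = cdet_with l e (xs @ u # ys) + cdet_with l e (xs @ v # ys)"
  proof (cases "l \<le> length xs")
    case True
    then show ?thesis
      using alternating_add[OF alternating_cdet, of "take l xs @ e # drop l xs" u v ys] by (simp add: cdet_with_def)
  next
    case False
    then obtain m where m: "l - length xs = Suc m" by (cases "l - length xs") auto
    show ?thesis
      using alternating_add[OF alternating_cdet, of xs u v "take m ys @ e # drop m ys"] False
      by (simp add: cdet_with_def m)
  qed
next
  fix xs ys zs :: "(nat \<Rightarrow> real) list" and u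
  show "cdet_with l e (xs @ u # ys @ u # zs) = 0"
  proof (cases "l \<le> length xs")
    case True
    then show ?thesis
      using alternating_same[OF alternating_cdet, of "take l xs @ e # drop l xs" u ys zs] by (simp add: cdet_with_def)
  next
    case False
    then obtain m where m: "l - length xs = Suc m" by (cases "l - length xs") auto
    show ?thesis
    proof (cases "m \<le> length ys")
      case True
      then show ?thesis
        using alternating_same[OF alternating_cdet, of xs u "take m ys @ e # drop m ys" zs] False
        by (simp add: cdet_with_def m)
    next
      case F: False
      then obtain k where k: "m - length ys = Suc k" by (cases "m - length ys") auto
      show ?thesis
        using alternating_same[OF alternating_cdet, of xs u ys "take k zs @ e # drop k zs"] False F
        by (simp add: cdet_with_def m k)
    qed
  qed
qed

text \<open>The triangles \<open>Lt (int x) j\<close> are matched one at a time from the bottom: each choice of a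
  partner corresponds to one summand in the expansion of the column of \<open>j\<close>, and the choices
  that are not available correspond to vanishing determinants.\<close>

lemma M_partial_alternating:
  fixes f g :: "int \<Rightarrow> nat \<Rightarrow> real"
  assumes alt: "alternating D" and fin: "\<And>x. finite (A x)" "\<And>x. finite (B x)"
    and inv_right: "\<And>js. sorted_wrt (<) js \<Longrightarrow> length js = m \<Longrightarrow> (\<forall>i<m. js ! i \<in> S i) \<Longrightarrow> real (M (partial A B x (set js) {})) = D (map f js)"
    and S: "\<And>i j j'. j \<in> SL i \<Longrightarrow> j' = j \<or> j' = j + 1 \<Longrightarrow> j' \<in> A x \<Longrightarrow> j' \<in> S i"
    and g: "\<And>i j. j \<in> SL i \<Longrightarrow> g j = (\<lambda>r. (if j \<in> A x then f j r else 0) + (if j + 1 \<in> A x then f (j + 1) r else 0))"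
  shows "sorted_wrt (<) js \<Longrightarrow> sorted_wrt (<) ts \<Longrightarrow> (\<forall>i\<in>set js. \<forall>t\<in>set ts. i \<le> t) \<Longrightarrow> length js + length ts = m \<Longrightarrow>
    (\<forall>i<length js. js ! i \<in> S i) \<Longrightarrow> (\<forall>i<length ts. ts ! i \<in> SL (length js + i)) \<Longrightarrow>
    real (M (partial A B x (set js) (set ts))) = D (map f js @ map g ts)"
proof (induction ts arbitrary: js)
  case Nil
  then show ?case using inv_right[of js] by simp
next
  case (Cons j ts)
  have j: "j \<in> SL (length js)" using Cons.prems(6) by force
  have jts: "j \<notin> set ts" using Cons.prems(2) by auto
  have choice: "real (if k \<in> A x - set js then M (partial A B x (insert k (set js)) (set ts)) else 0) =
     D (map f js @ (\<lambda>r. if k \<in> A x then f k r else 0) # map g ts)" if k: "k = j \<or> k = j + 1" for k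
  proof (cases "k \<in> A x")
    case False
    then show ?thesis using alternating_zero[OF alt] by simp
  next
    case True
    show ?thesis
    proof (cases "k \<in> set js")
      case in_js: True
      then obtain us vs where "js = us @ k # vs" by (meson split_list)
      then show ?thesis
        using True alternating_same[OF alt, of "map f us" "f k" "map f vs" "map g ts"] by simp
    next
      case False
      have "real (M (partial A B x (set (js @ [k])) (set ts))) = D (map f (js @ [k]) @ map g ts)"
      proof (rule Cons.IH)
        \<comment> \<open>Every member of \<open>js\<close> is at most \<open>j\<close>, so
          \<open>k\<close> can be appended without disturbing the order, and no sign arises.\<close>
        have le: "i < k" if "i \<in> set js" for i
          using Cons.prems(3) that k False by (metis insert_iff list.simps(15) order_le_less zle_add1_eq_le)
        then show "sorted_wrt (<) (js @ [k])" using Cons.prems(1) by (simp add: sorted_wrt_append)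
        show "sorted_wrt (<) ts" using Cons.prems(2) by simp
        show "\<forall>i\<in>set (js @ [k]). \<forall>t\<in>set ts. i \<le> t"
          using Cons.prems(2,3) k by fastforce
        show "length (js @ [k]) + length ts = m" using Cons.prems(4) by simp
        show "\<forall>i<length (js @ [k]). (js @ [k]) ! i \<in> S i"
          using Cons.prems(5) S[OF j k True] by (auto simp: nth_append less_Suc_eq)
        show "\<forall>i<length ts. ts ! i \<in> SL (length (js @ [k]) + i)"
          using Cons.prems(6) by fastforce
      qed
      then show ?thesis using True False by simp
    qed
  qed
  have "real (M (partial A B x (set js) (set (j # ts)))) =
    real (if j \<in> A x - set js then M (partial A B x (insert j (set js)) (set ts)) else 0) +
    real (if j + 1 \<in> A x - set js then M (partial A B x (insert (j + 1) (set js)) (set ts)) else 0)"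
    using M_partial_step[of A B "set ts" j x "set js", OF fin _ jts] by simp
  also have "\<dots> = D (map f js @ (\<lambda>r. (if j \<in> A x then f j r else 0) + (if j + 1 \<in> A x then f (j + 1) r else 0)) # map g ts)"
    unfolding alternating_add[OF alt] using choice[of j] choice[of "j + 1"] by simp
  also have "\<dots> = D (map f js @ map g (j # ts))"
    using g[OF j] by simp
  finally show ?case .
qed

section \<open>The dented hexagon\<close>

lemma Rt_in_hexagon: "Rt i j \<in> hexagon p b c \<longleftrightarrow>
    0 \<le> i \<and> i < int b + int c \<and> - int c \<le> j \<and> j < int p \<and> 0 \<le> i + j \<and> i + j < int b + int p"
  by (auto simp: hexagon_def in_hex_def)

lemma Lt_in_hexagon: "Lt i j \<in> hexagon p b c \<longleftrightarrow>
    0 \<le> i \<and> i < int b + int c \<and> - int c \<le> j \<and> j < int p \<and> 0 \<le> i + 1 + j \<and> i + 1 + j < int b + int p"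
  by (auto simp: hexagon_def in_hex_def)

lemma meets_line_Rt: "meets_line p (Rt i j) \<longleftrightarrow> int p = i + 2 * j + 1"
  by (auto simp: meets_line_def)

lemma meets_line_Lt: "meets_line p (Lt i j) \<longleftrightarrow> int p = i + 2 * j + 2"
  by (auto simp: meets_line_def)

lemma finite_hexagon: "finite (hexagon p b c)"
proof (rule finite_subset)
  let ?I = "{0..int b + int c} \<times> {- int c..int p}"
  show "hexagon p b c \<subseteq> case_prod Rt ` ?I \<union> case_prod Lt ` ?I"
  proof
    fix t assume "t \<in> hexagon p b c"
    then show "t \<in> case_prod Rt ` ?I \<union> case_prod Lt ` ?I"
      by (cases t) (auto simp: Rt_in_hexagon Lt_in_hexagon image_iff)
  qed
qed simp

locale dented_hexagon =
  fixes p b c d :: nat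
  assumes db: "d \<le> b" and bc: "b \<le> c"
begin

lemma line_tris_col_inj: "inj_on Defs.col (line_tris p b c)"
proof (rule inj_onI)
  fix t t' assume t: "t \<in> line_tris p b c" "t' \<in> line_tris p b c" "Defs.col t = Defs.col t'"
  then show "t = t'"
    by (cases t; cases t') (auto simp: line_tris_def meets_line_Rt meets_line_Lt; presburger)+
qed

lemma line_tris_ex:
  assumes "0 \<le> i" "i < 2 * int d"
  shows "\<exists>t\<in>line_tris p b c. Defs.col t = i"
proof (cases "even (int p - i)")
  case True
  then obtain k where k: "int p - i = 2 * k" by blast
  have "Lt i (k - 1) \<in> line_tris p b c"
    using assms k db bc by (auto simp: line_tris_def meets_line_Lt Lt_in_hexagon)
  then show ?thesis by force
next
  case False
  then obtain k where k: "int p - i = 2 * k + 1" using oddE by blast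
  have "Rt i k \<in> line_tris p b c"
    using assms k db bc by (auto simp: line_tris_def meets_line_Rt Rt_in_hexagon)
  then show ?thesis by force
qed

text \<open>The bisector meets at most one triangle of the hexagon in each column and exactly one in
  each of the first \<open>2 * d\<close>, so that labels there count columns.\<close>

lemma deleted_eq: "deleted p b c d = {t \<in> line_tris p b c. Defs.col t < 2 * int d}"
proof -
  have fin: "finite (line_tris p b c)" using finite_hexagon by (simp add: line_tris_def)
  have cnt: "card {t' \<in> line_tris p b c. Defs.col t' < i} = nat i" if "0 \<le> i" "i \<le> 2 * int d" for i
  proof -
    have "Defs.col ` {t' \<in> line_tris p b c. Defs.col t' < i} = {0..<i}"
    proof (intro equalityI subsetI)
      fix k assume "k \<in> Defs.col ` {t' \<in> line_tris p b c. Defs.col t' < i}"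
      then obtain t where "t \<in> line_tris p b c" "k = Defs.col t" "k < i" by auto
      then show "k \<in> {0..<i}" by (cases t) (auto simp: line_tris_def Rt_in_hexagon Lt_in_hexagon)
    next
      fix k assume "k \<in> {0..<i}"
      then show "k \<in> Defs.col ` {t' \<in> line_tris p b c. Defs.col t' < i}"
        using line_tris_ex[of k] that by force
    qed
    moreover have "inj_on Defs.col {t' \<in> line_tris p b c. Defs.col t' < i}"
      using line_tris_col_inj by (rule inj_on_subset) auto
    then have "card (Defs.col ` {t' \<in> line_tris p b c. Defs.col t' < i}) = card {t' \<in> line_tris p b c. Defs.col t' < i}"
      by (rule card_image)
    ultimately show ?thesis by simp
  qed
  have "card {t' \<in> line_tris p b c. Defs.col t' < Defs.col t} < 2 * d \<longleftrightarrow> Defs.col t < 2 * int d"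
    if t: "t \<in> line_tris p b c" for t
  proof (cases "Defs.col t < 2 * int d")
    case True
    have "0 \<le> Defs.col t" using t by (cases t) (auto simp: line_tris_def Rt_in_hexagon Lt_in_hexagon)
    then show ?thesis using True cnt[of "Defs.col t"] by auto
  next
    case False
    have "2 * d = card {t' \<in> line_tris p b c. Defs.col t' < 2 * int d}"
      using cnt[of "2 * int d"] by simp
    also have "\<dots> \<le> card {t' \<in> line_tris p b c. Defs.col t' < Defs.col t}"
      by (rule card_mono) (use fin False in auto)
    finally show ?thesis using False by auto
  qed
  then show ?thesis unfolding deleted_def by blast
qed

definition edges :: "nat \<Rightarrow> int set" where
  "edges x = {j. - int x \<le> j \<and> - int c \<le> j \<and> j < int p \<and> j + int x < int b + int p}"

text \<open>Measured from the axis to the midpoint of the edge, and doubled.\<close>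

definition height2 :: "nat \<Rightarrow> int \<Rightarrow> int" where
  "height2 x j = int x + 2 * j + 1 - int p"

text \<open>\<open>A x\<close> and \<open>B x\<close> are the vertical edges at abscissa \<open>x\<close> whose right, respectively left, triangle lies
  in the region. They differ on the two vertical sides of the hexagon and at the tip of the row of
  bowties, where a path starts.\<close>

definition A :: "nat \<Rightarrow> int set" where
  "A x = (if x < b + c then {j \<in> edges x. \<not> (x < 2 * d \<and> height2 x j = 0)} else {})"

definition B :: "nat \<Rightarrow> int set" where
  "B x = (if 0 < x \<and> x \<le> b + c then {j \<in> edges x. \<not> (x \<le> 2 * d \<and> height2 x j = 0)} else {})"

lemma finite_V: "finite (edges x)"
  by (rule finite_subset[of _ "{- int c..int p}"]) (auto simp: edges_def)

lemma finite_A: "finite (A x)" and finite_B: "finite (B x)"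
  by (auto simp: A_def B_def finite_V)

lemma hexagon_del_eq: "hexagon_del p b c d = below A B (b + c) \<union> Lt (int (b + c) - 1) ` B (b + c)"
proof (rule Set.set_eqI)
  fix t
  show "t \<in> hexagon_del p b c d \<longleftrightarrow> t \<in> below A B (b + c) \<union> Lt (int (b + c) - 1) ` B (b + c)"
  proof (cases t)
    case (Rt i j)
    have "t \<in> hexagon_del p b c d \<longleftrightarrow> Rt i j \<in> hexagon p b c \<and> \<not> (i < 2 * int d \<and> int p = i + 2 * j + 1)"
      unfolding hexagon_del_def deleted_eq Rt by (auto simp: line_tris_def meets_line_Rt)
    also have "\<dots> \<longleftrightarrow> (\<exists>y<b + c. i = int y \<and> j \<in> A y)"
    proof
      assume r: "Rt i j \<in> hexagon p b c \<and> \<not> (i < 2 * int d \<and> int p = i + 2 * j + 1)"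
      then have "nat i < b + c \<and> i = int (nat i) \<and> j \<in> A (nat i)"
        by (auto simp: Rt_in_hexagon A_def edges_def height2_def)
      then show "\<exists>y<b + c. i = int y \<and> j \<in> A y" by blast
    qed (auto simp: Rt_in_hexagon A_def edges_def height2_def)
    also have "\<dots> \<longleftrightarrow> t \<in> below A B (b + c) \<union> Lt (int (b + c) - 1) ` B (b + c)"
      unfolding Rt by (auto simp: below_def)
    finally show ?thesis .
  next
    case (Lt i j)
    have "t \<in> hexagon_del p b c d \<longleftrightarrow> Lt i j \<in> hexagon p b c \<and> \<not> (i < 2 * int d \<and> int p = i + 2 * j + 2)"
      unfolding hexagon_del_def deleted_eq Lt by (auto simp: line_tris_def meets_line_Lt)
    also have "\<dots> \<longleftrightarrow> (\<exists>y\<le>b + c. i = int y - 1 \<and> j \<in> B y)"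
    proof
      assume r: "Lt i j \<in> hexagon p b c \<and> \<not> (i < 2 * int d \<and> int p = i + 2 * j + 2)"
      then have "nat (i + 1) \<le> b + c \<and> i = int (nat (i + 1)) - 1 \<and> j \<in> B (nat (i + 1))"
        by (auto simp: Lt_in_hexagon B_def edges_def height2_def)
      then show "\<exists>y\<le>b + c. i = int y - 1 \<and> j \<in> B y" by blast
    next
      assume "\<exists>y\<le>b + c. i = int y - 1 \<and> j \<in> B y"
      then obtain y where y: "y \<le> b + c" "i = int y - 1" "j \<in> B y" by blast
      then have "0 < y" "j \<in> edges y" "\<not> (y \<le> 2 * d \<and> height2 y j = 0)" by (auto simp: B_def split: if_splits)
      then show "Lt i j \<in> hexagon p b c \<and> \<not> (i < 2 * int d \<and> int p = i + 2 * j + 2)"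
        using y by (auto simp: Lt_in_hexagon edges_def height2_def)
    qed
    also have "\<dots> \<longleftrightarrow> t \<in> below A B (b + c) \<union> Lt (int (b + c) - 1) ` B (b + c)"
      unfolding Lt below_def by (auto simp: le_less)
    finally show ?thesis .
  qed
qed

end

text \<open>The start \<open>s = 0\<close> stands for the path born at the tip, which does not exist
  before abscissa \<open>2 * d\<close>.\<close>

definition walk_count :: "nat \<Rightarrow> int \<Rightarrow> nat \<Rightarrow> int \<Rightarrow> real" where
  "walk_count d s x z = (if s = 0 \<and> x < 2 * d then 0 else if x \<le> 2 * d then walled x s z else (hop ^^ (x - 2 * d)) (walled (2 * d) s) z)"

lemma walled_step:
  assumes "z \<noteq> 0" "s \<noteq> 0"
  shows "walled (Suc x) s z = walled x s (z - 1) + walled x s (z + 1)"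
proof -
  have pos: "walled (Suc x) s z = walled x s (z - 1) + walled x s (z + 1)" if "s > 0" "z \<noteq> 0" for s z
    using hop_Psi_pos[OF that(1), of x z] that by (auto simp: hop_def[of "walled x s"] walled_def[of "Suc x"] zero_less_mult_iff simp del: funpow.simps)
  show ?thesis
  proof (cases "s > 0")
    case True
    then show ?thesis using pos assms by simp
  next
    case False
    have "walled (Suc x) s z = walled (Suc x) (- s) (- z)" using walled_uminus[of "Suc x" "- s"] by simp
    also have "\<dots> = walled x (- s) (- z - 1) + walled x (- s) (- z + 1)" using False assms by (intro pos) auto
    also have "\<dots> = walled x s (z - 1) + walled x s (z + 1)"
    proof -
      have "- z - 1 = - (z + 1)" "- z + 1 = - (z - 1)" by simp_all
      then show ?thesis unfolding walled_uminus by (simp add: add.commute)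
    qed
    finally show ?thesis .
  qed
qed

text \<open>The excluded heights are those on the wall. At its last point the recursion indeed fails
  for \<open>s = 0\<close>, because a path starts there.\<close>

lemma walk_count_step:
  assumes "x < 2 * d \<Longrightarrow> z \<noteq> 0"
  shows "walk_count d s (Suc x) z = walk_count d s x (z - 1) + walk_count d s x (z + 1)"
proof (cases "x < 2 * d")
  case True
  show ?thesis
  proof (cases "s = 0")
    case s: True
    show ?thesis using True assms s by (auto simp: walk_count_def walled_def delta_def)
  next
    case False
    then show ?thesis using True assms walled_step[of z s x] by (simp add: walk_count_def)
  qed
next
  case False
  then have e: "walk_count d s x w = (hop ^^ (x - 2 * d)) (walled (2 * d) s) w" for w
    by (auto simp: walk_count_def)
  have "Suc x - 2 * d = Suc (x - 2 * d)" using False by simp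
  then have "walk_count d s (Suc x) z = (hop ^^ Suc (x - 2 * d)) (walled (2 * d) s) z"
    using False by (simp add: walk_count_def del: funpow.simps)
  then show ?thesis unfolding hop_pow_Suc e .
qed

lemma walk_count_support:
  assumes "\<bar>z\<bar> > int x + \<bar>s\<bar>"
  shows "walk_count d s x z = 0"
proof -
  have P: "walled x s z = 0" if "\<bar>z\<bar> > int x + \<bar>s\<bar>" for x z
  proof -
    have "(hop ^^ x) (odd_pair s) z = 0"
      by (rule hop_pow_outside) (use that in \<open>auto simp: odd_pair_def delta_def\<close>)
    then show ?thesis using that by (auto simp: walled_def delta_def)
  qed
  have "(hop ^^ (x - 2 * d)) (walled (2 * d) s) z = 0" if "x > 2 * d"
  proof (rule hop_pow_outside)
    fix w assume "\<bar>w - z\<bar> \<le> int (x - 2 * d)"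
    then show "walled (2 * d) s w = 0" using assms that by (intro P) auto
  qed
  then show ?thesis using P[OF assms] by (auto simp: walk_count_def)
qed

lemma walk_count_at_0: "x < 2 * d \<Longrightarrow> walk_count d s x 0 = 0"
  by (auto simp: walk_count_def walled_def)

context dented_hexagon
begin

definition walk_col :: "nat \<Rightarrow> int \<Rightarrow> nat \<Rightarrow> real" where
  "walk_col x j = (\<lambda>r. if r < p then walk_count d (2 * int r + 1 - int p) x (height2 x j) else 0)"

text \<open>A missing neighbour lies on the wall, where the counts vanish, or just outside one of
  the two sides adjacent to the left side. In the latter case its doubled distance from the axis is
  \<open>x + p + 1\<close>, more than any walk covers in \<open>x\<close> steps.\<close>

lemma walk_col_outside:
  assumes j: "j \<in> edges (Suc x)" and x: "x < b + c" and k: "k = j \<or> k = j + 1" and kA: "k \<notin> A x"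
  shows "walk_col x k r = 0"
proof (cases "r < p")
  case True
  show ?thesis
  proof (cases "k \<in> edges x")
    case kV: True
    then have "x < 2 * d" "height2 x k = 0" using kA x by (auto simp: A_def)
    then show ?thesis by (simp add: walk_col_def walk_count_at_0)
  next
    case False
    then have "k = - int x - 1 \<or> k = int p" using j k by (auto simp: edges_def)
    then have "\<bar>height2 x k\<bar> = int x + int p + 1" by (auto simp: height2_def)
    moreover have "\<bar>2 * int r + 1 - int p\<bar> < int p" using True by linarith
    ultimately show ?thesis by (simp add: walk_col_def walk_count_support)
  qed
qed (simp add: walk_col_def)

lemma walk_col_step:
  assumes j: "j \<in> B (Suc x)"
  shows "walk_col (Suc x) j = (\<lambda>r. (if j \<in> A x then walk_col x j r else 0) + (if j + 1 \<in> A x then walk_col x (j + 1) r else 0))"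
proof
  fix r
  have x: "x < b + c" and jV: "j \<in> edges (Suc x)" and nz: "x < 2 * d \<Longrightarrow> height2 (Suc x) j \<noteq> 0"
    using j by (auto simp: B_def split: if_splits)
  have z: "height2 x j = height2 (Suc x) j - 1" "height2 x (j + 1) = height2 (Suc x) j + 1" by (simp_all add: height2_def)
  have "walk_col (Suc x) j r = walk_col x j r + walk_col x (j + 1) r"
    unfolding walk_col_def z using walk_count_step[OF nz] by simp
  then show "walk_col (Suc x) j r = (if j \<in> A x then walk_col x j r else 0) + (if j + 1 \<in> A x then walk_col x (j + 1) r else 0)"
    using walk_col_outside[OF jV x, of j r] walk_col_outside[OF jV x, of "j + 1" r] by simp
qed

text \<open>The determinant formula for the region cut off just to the right of abscissa
  \<open>x\<close>, with \<open>js\<close> the edges crossed by the \<open>m\<close> paths;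
  \<open>inv_left\<close> is the version just to the left. \<open>S i\<close> confines the
  \<open>i\<close>-th edge, for use along the wall.\<close>

definition inv_right :: "nat \<Rightarrow> nat \<Rightarrow> ((nat \<Rightarrow> real) list \<Rightarrow> real) \<Rightarrow> (nat \<Rightarrow> int set) \<Rightarrow> bool" where
  "inv_right x m D S \<longleftrightarrow> (\<forall>js. sorted_wrt (<) js \<longrightarrow> length js = m \<longrightarrow> (\<forall>i<m. js ! i \<in> S i) \<longrightarrow>
     real (M (partial A B x (set js) {})) = D (map (walk_col x) js))"

definition inv_left :: "nat \<Rightarrow> nat \<Rightarrow> ((nat \<Rightarrow> real) list \<Rightarrow> real) \<Rightarrow> (nat \<Rightarrow> int set) \<Rightarrow> bool" where
  "inv_left x m D S \<longleftrightarrow> (\<forall>js. sorted_wrt (<) js \<longrightarrow> length js = m \<longrightarrow> (\<forall>i<m. js ! i \<in> S i) \<longrightarrow>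
     real (M (below A B x \<union> Lt (int x - 1) ` set js)) = D (map (walk_col x) js))"

lemma inv_right_HL:
  assumes H: "inv_right x m D S" and alt: "alternating D" and SL: "\<And>i j. j \<in> SL i \<Longrightarrow> j \<in> B (Suc x)"
    and S: "\<And>i j k. j \<in> SL i \<Longrightarrow> k = j \<or> k = j + 1 \<Longrightarrow> k \<in> A x \<Longrightarrow> k \<in> S i"
  shows "inv_left (Suc x) m D SL"
  unfolding inv_left_def
proof (intro allI impI)
  fix ts assume ts: "sorted_wrt (<) ts" "length ts = m" "\<forall>i<m. ts ! i \<in> SL i"
  have "real (M (partial A B x (set []) (set ts))) = D (map (walk_col x) [] @ map (walk_col (Suc x)) ts)"
  proof (rule M_partial_alternating[OF alt, where S = S and SL = SL and m = m])
    show "real (M (partial A B x (set js) {})) = D (map (walk_col x) js)"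
      if "sorted_wrt (<) js" "length js = m" "\<forall>i<m. js ! i \<in> S i" for js
      using H that by (simp add: inv_right_def)
    show "walk_col (Suc x) j = (\<lambda>r. (if j \<in> A x then walk_col x j r else 0) + (if j + 1 \<in> A x then walk_col x (j + 1) r else 0))"
      if "j \<in> SL i" for i j using SL[OF that] by (rule walk_col_step)
    show "j' \<in> S i" if "j \<in> SL i" "j' = j \<or> j' = j + 1" "j' \<in> A x" for i j j' using S that by blast
  qed (use ts in \<open>auto simp: finite_A finite_B\<close>)
  moreover have "partial A B x (set []) (set ts) = below A B (Suc x) \<union> Lt (int (Suc x) - 1) ` set ts"
    by (auto simp: partial_def below_def lessThan_Suc)
  ultimately show "real (M (below A B (Suc x) \<union> Lt (int (Suc x) - 1) ` set ts)) = D (map (walk_col (Suc x)) ts)"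
    by simp
qed

text \<open>Where no path starts or ends, the uncrossed edges are covered by horizontal lozenges,
  and the same list \<open>js\<close> serves on both sides of the line.\<close>

lemma inv_left_HR:
  assumes H: "inv_left x m D S" and AB: "A x = B x" and S: "\<And>i. S i \<subseteq> A x"
  shows "inv_right x m D S"
  unfolding inv_right_def
proof (intro allI impI)
  fix js assume js: "sorted_wrt (<) js" "length js = m" "\<forall>i<m. js ! i \<in> S i"
  have sub: "set js \<subseteq> A x" using js(2,3) S by (force simp: in_set_conv_nth)
  have "M (partial A B x (set js) {}) = M (below A B x \<union> Lt (int x - 1) ` B x \<union> Rt (int x) ` (A x - set js))"
    by (simp add: partial_def)
  also have "\<dots> = M (below A B x \<union> Lt (int x - 1) ` (B x - (A x - set js)))"
    by (rule M_horizontal_forced(1)) (auto simp: AB finite_B finite_A)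
  also have "B x - (A x - set js) = set js" using sub AB by auto
  finally show "real (M (partial A B x (set js) {})) = D (map (walk_col x) js)"
    using H js by (simp add: inv_left_def)
qed

lemma A_eq_B: "0 < x \<Longrightarrow> x < b + c \<Longrightarrow> x \<noteq> 2 * d \<or> even p \<Longrightarrow> A x = B x"
proof -
  assume x: "0 < x" "x < b + c" "x \<noteq> 2 * d \<or> even p"
  have "height2 (2 * d) j \<noteq> 0" if "even p" for j using that by (auto simp: height2_def) presburger
  then show "A x = B x" using x by (auto simp: A_def B_def le_less)
qed

lemma inv_right_chain:
  assumes H: "inv_right x0 p cdet (\<lambda>_. A x0)" and AB: "\<And>y. x0 < y \<Longrightarrow> y < b + c \<Longrightarrow> A y = B y"
  shows "x0 \<le> x \<Longrightarrow> x < b + c \<Longrightarrow> inv_right x p cdet (\<lambda>_. A x)"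
proof (induction x rule: nat_induct_at_least[of x0])
  case base
  show ?case by (rule H)
next
  case (Suc x)
  have e: "A (Suc x) = B (Suc x)" using Suc AB by simp
  have "inv_left (Suc x) p cdet (\<lambda>_. A (Suc x))"
    by (rule inv_right_HL[OF Suc.IH alternating_cdet]) (use Suc e in auto)
  then show ?case by (rule inv_left_HR[OF _ e]) simp
qed

definition ends :: "int list" where
  "ends = map (\<lambda>k. int k - int c) [0..<p]"

lemma sorted_ends: "sorted_wrt (<) ends"
  unfolding ends_def by (simp add: sorted_wrt_map sorted_wrt_iff_nth_less)

lemma set_ends: "set ends = edges (b + c)"
proof (intro equalityI subsetI)
  fix j assume j: "j \<in> edges (b + c)"
  then have "j = int (nat (j + int c)) - int c" "nat (j + int c) < p" by (auto simp: edges_def)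
  then show "j \<in> set ends" unfolding ends_def by force
qed (auto simp: ends_def edges_def)

lemma cdet_ends: "cdet (map (walk_col (b + c)) ends) = path_det p d b c"
proof -
  have n: "2 * d \<le> b + c" using db bc by simp
  have g: "walk_count d s (b + c) z = (hop ^^ (b + c - 2 * d)) (walled (2 * d) s) z" for s z
    using n by (auto simp: walk_count_def)
  have "cdet (map (walk_col (b + c)) ends) = fdet p (\<lambda>i k. walk_col (b + c) (int k - int c) i)"
    unfolding cdet_def ends_def by (simp, intro fdet_cong) auto
  also have "\<dots> = path_det p d b c"
    unfolding path_det_def rows_det_def wdet_def
  proof (rule fdet_cong)
    fix i k assume "i < p"
    moreover have "height2 (b + c) (int k - int c) = int b - int c + 1 - int p + 2 * int k" by (simp add: height2_def)
    ultimately show "walk_col (b + c) (int k - int c) i =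
      (hop ^^ (b + c - 2 * d)) (rowstate p (2 * d) i) (int b - int c + 1 - int p + 2 * int k)"
      by (simp add: walk_col_def g rowstate_def)
  qed
  finally show ?thesis .
qed

lemma M_from_HR:
  assumes H: "inv_right x0 p cdet (\<lambda>_. A x0)" and x0: "x0 < b + c" and AB: "\<And>y. x0 < y \<Longrightarrow> y < b + c \<Longrightarrow> A y = B y"
    and Bn: "B (b + c) = edges (b + c)"
  shows "real (M (hexagon_del p b c d)) = path_det p d b c"
proof -
  obtain n where n: "b + c = Suc n" using x0 by (cases "b + c") auto
  have "inv_right n p cdet (\<lambda>_. A n)" by (rule inv_right_chain[OF H AB]) (use x0 n in auto)
  then have "inv_left (Suc n) p cdet (\<lambda>_. B (Suc n))"
    by (rule inv_right_HL[OF _ alternating_cdet]) auto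
  moreover have "length ends = p" by (simp add: ends_def)
  moreover have "ends ! i \<in> B (Suc n)" if "i < p" for i
    using that set_ends Bn n \<open>length ends = p\<close> by (metis nth_mem)
  ultimately have "real (M (below A B (Suc n) \<union> Lt (int (Suc n) - 1) ` set ends)) = cdet (map (walk_col (Suc n)) ends)"
    using sorted_ends by (simp add: inv_left_def)
  then show ?thesis unfolding hexagon_del_eq Bn set_ends[symmetric] cdet_ends[symmetric] unfolding n .
qed

lemma edges_0: "edges 0 = {0..<int p}"
  using bc by (auto simp: edges_def)

lemma M_eq_Md_no_source:
  assumes "even p \<or> d = 0" "0 < b + c"
  shows "real (M (hexagon_del p b c d)) = path_det p d b c"
proof (rule M_from_HR)
  \<comment> \<open>For even \<open>p\<close> the axis passes through midpoints of vertical edges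
    only at odd abscissas, so neither the left side nor the end of the wall at \<open>2 * d\<close>
    has a gap.\<close>
  have height2: "height2 x j \<noteq> 0" if "even p" "even x" for x j using that by (auto simp: height2_def) presburger
  have A0: "A 0 = {0..<int p}" using assms height2[of 0] by (auto simp: A_def edges_0)
  show "inv_right 0 p cdet (\<lambda>_. A 0)"
    unfolding inv_right_def
  proof (intro allI impI)
    fix js assume js: "sorted_wrt (<) js" "length js = p" "\<forall>i<p. js ! i \<in> A 0"
    have sub: "set js \<subseteq> A 0" using js by (force simp: in_set_conv_nth)
    have "card (set js) = p" using js by (metis distinct_card strict_sorted_iff)
    then have set: "set js = A 0" using sub by (intro card_subset_eq) (auto simp: A0)
    have "js = map int [0..<p]"
    proof (rule strict_sorted_equal)
      show "set js = set (map int [0..<p])" unfolding set A0 using image_int_atLeastLessThan[of 0 p] by simp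
    qed (use js in \<open>auto simp: sorted_wrt_map sorted_wrt_iff_nth_less\<close>)
    moreover have "cdet (map (walk_col 0) (map int [0..<p])) = 1"
    proof -
      have "walk_col 0 (int k) i = (if i = k then 1 else 0)" if "i < p" "k < p" for i k
      proof -
        have "walk_count d s 0 z = delta s z" if "s \<noteq> 0 \<or> d = 0" for s z using that by (auto simp: walk_count_def walled_0)
        moreover have "2 * int i + 1 - int p \<noteq> 0 \<or> d = 0" using assms by presburger
        ultimately show ?thesis using that by (auto simp: walk_col_def height2_def delta_def)
      qed
      then show ?thesis unfolding cdet_def by (simp, intro fdet_lower_unitriangular) auto
    qed
    moreover have "partial A B 0 (set js) {} = {}" unfolding set by (simp add: partial_def below_def B_def)
    ultimately show "real (M (partial A B 0 (set js) {})) = cdet (map (walk_col 0) js)" by simp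
  qed
  show "A y = B y" if "0 < y" "y < b + c" for y using A_eq_B[of y] that assms by auto
  show "B (b + c) = edges (b + c)"
  proof -
    have "\<not> (b + c \<le> 2 * d \<and> height2 (b + c) j = 0)" for j
    proof
      assume h: "b + c \<le> 2 * d \<and> height2 (b + c) j = 0"
      then have "b + c = 2 * d" "even p" using db bc assms by auto
      then show False using height2[of "b + c" j] h by simp
    qed
    then show ?thesis using assms by (auto simp: B_def)
  qed
qed (use assms in auto)

end

section \<open>The odd hexagon, where a path is born at the tip\<close>

locale bowtie_hexagon = dented_hexagon +
  fixes a :: nat
  assumes p: "p = 2 * a + 1" and d: "0 < d"
begin

lemma ip: "int p = 2 * int a + 1" by (simp add: p)

lemma a_less: "a < p" by (simp add: p)

definition source_col :: "nat \<Rightarrow> real" where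
  "source_col r = (if r = a then 1 else 0)"

text \<open>Prescribes that exactly the first \<open>l\<close> paths run below the axis. The number
  \<open>l\<close> is free because at the tip it has to be the position of the tip edge in an
  arbitrary list of crossed edges.\<close>

definition side :: "nat \<Rightarrow> nat \<Rightarrow> nat \<Rightarrow> int set" where
  "side l x i = {j. if i < l then height2 x j < 0 else height2 x j > 0}"

definition others :: "nat list" where
  "others = [0..<a] @ [Suc a..<2 * a + 1]"

lemma nth_others: "i < 2 * a \<Longrightarrow> others ! i = skip a i"
  by (auto simp: others_def nth_append skip_def)

lemma cdet_with_others:
  assumes "h a = source_col"
  shows "cdet_with a source_col (map h others) = cdet (map h [0..<p])"
proof -
  have "[0..<p] = [0..<a] @ a # [Suc a..<2 * a + 1]"
  proof -
    have "p = a + Suc a" "2 * a + 1 = a + Suc a" by (simp_all add: p)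
    then show ?thesis using upt_add_eq_append[of 0 a "Suc a"] upt_conv_Cons[of a "a + Suc a"]
      by (simp only: le0 less_add_Suc1)
  qed
  then show ?thesis using assms by (simp add: cdet_with_def others_def)
qed

lemma sorted_others: "sorted_wrt (<) others"
  by (auto simp: others_def sorted_wrt_append)

lemma set_others: "set others = {0..<p} - {a}"
  by (auto simp: others_def p)

lemma inv_right_start: "inv_right 0 (2 * a) (cdet_with l source_col) (\<lambda>i. A 0 \<inter> side l 0 i)"
  unfolding inv_right_def
proof (intro allI impI)
  fix js assume js: "sorted_wrt (<) js" "length js = 2 * a" "\<forall>i<2 * a. js ! i \<in> A 0 \<inter> side l 0 i"
  have n: "0 < b + c" using d db by simp
  have A0: "A 0 = {0..<int p} - {int a}" using d n by (auto simp: A_def edges_0 height2_def ip)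
  have sub: "set js \<subseteq> A 0" using js by (force simp: in_set_conv_nth)
  have "card (set js) = 2 * a" using js by (metis distinct_card strict_sorted_iff)
  moreover have "card ({0..<int p} - {int a}) = 2 * a" by (simp add: p)
  ultimately have set: "set js = A 0" using sub by (intro card_subset_eq) (auto simp: A0)
  have jse: "js = map int others"
  proof (rule strict_sorted_equal)
    have "set (map int others) = int ` {0..<p} - {int a}" by (auto simp: set_others)
    also have "int ` {0..<p} = {0..<int p}" using image_int_atLeastLessThan[of 0 p] by simp
    finally show "set js = set (map int others)" unfolding set A0 by simp
  qed (use js sorted_others in \<open>auto simp: sorted_wrt_map sorted_wrt_iff_nth_less\<close>)
  have z: "height2 0 k = 2 * k - 2 * int a" for k by (simp add: height2_def ip)
  have side: "int (skip a i) \<in> side l 0 i" if "i < 2 * a" for i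
    using js(3) that nth_others[OF that] jse by (simp add: js(2)) (metis IntD2 js(2) length_map nth_map)
  \<comment> \<open>On the left side exactly \<open>a\<close> starting edges lie below the axis, so
    for any other \<open>l\<close> the side conditions are contradictory. For \<open>a = 0\<close>
    the list is empty and the position of the inserted column is immaterial.\<close>
  have la: "a = 0 \<or> l = a"
  proof (rule ccontr)
    assume h: "\<not> (a = 0 \<or> l = a)"
    show False
    proof (cases "l < a")
      case True
      then show False using side[of l] h by (simp add: side_def z skip_def)
    next
      case False
      then show False using side[of a] h by (simp add: side_def z skip_def)
    qed
  qed
  have ce: "cdet_with l source_col (map (walk_col 0) js) = cdet_with a source_col (map (walk_col 0) js)"
    using la by (auto simp: jse others_def cdet_with_def)
  define h where "h k = (if k = a then source_col else walk_col 0 (int k))" for k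
  have "map (walk_col 0) js = map h others"
    unfolding jse using set_others by (auto simp: h_def)
  then have "cdet_with a source_col (map (walk_col 0) js) = cdet (map h [0..<p])"
    using cdet_with_others[of h] by (simp add: h_def)
  also have "\<dots> = 1"
  proof -
    have "h k i = (if i = k then 1 else 0)" if "i < p" "k < p" for i k
      using that d by (auto simp: h_def source_col_def walk_col_def walk_count_def walled_0 delta_def height2_def ip)
    then show ?thesis unfolding cdet_def by (simp, intro fdet_lower_unitriangular) auto
  qed
  finally have "cdet_with l source_col (map (walk_col 0) js) = 1" using ce by simp
  moreover have "partial A B 0 (set js) {} = {}" unfolding set by (simp add: partial_def below_def B_def)
  ultimately show "real (M (partial A B 0 (set js) {})) = cdet_with l source_col (map (walk_col 0) js)" by simp
qed

text \<open>Heights change by one at each step and avoid 0 along the wall, so a path cannot change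
  sides there.\<close>

lemma side_step:
  assumes "x < 2 * d" "x < b + c" "j \<in> side l (Suc x) i" "k = j \<or> k = j + 1" "k \<in> A x"
  shows "k \<in> side l x i"
proof -
  have "height2 x k = height2 (Suc x) j - 1 \<or> height2 x k = height2 (Suc x) j + 1" using assms(4) by (auto simp: height2_def)
  moreover have "height2 x k \<noteq> 0" using assms by (auto simp: A_def)
  ultimately show ?thesis using assms(3) by (auto simp: side_def split: if_splits)
qed

lemma n_ge: "2 * d \<le> b + c" using db bc by simp

lemma inv_right_walled: "x < 2 * d \<Longrightarrow> inv_right x (2 * a) (cdet_with l source_col) (\<lambda>i. A x \<inter> side l x i)"
proof (induction x)
  case 0
  show ?case by (rule inv_right_start)
next
  case (Suc x)
  have e: "A (Suc x) = B (Suc x)" using Suc.prems n_ge by (intro A_eq_B) auto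
  have "inv_left (Suc x) (2 * a) (cdet_with l source_col) (\<lambda>i. A (Suc x) \<inter> side l (Suc x) i)"
    by (rule inv_right_HL[OF Suc.IH alternating_cdet_with]) (use Suc.prems n_ge e side_step[of x] in auto)
  then show ?case by (rule inv_left_HR[OF _ e]) simp
qed

lemma inv_left_tip: "inv_left (2 * d) (2 * a) (cdet_with l source_col) (\<lambda>i. B (2 * d) \<inter> side l (2 * d) i)"
proof -
  obtain x where x: "2 * d = Suc x" using d by (cases "2 * d") auto
  show ?thesis unfolding x
    by (rule inv_right_HL[OF inv_right_walled alternating_cdet_with]) (use x n_ge side_step[of x] in auto)
qed

lemma walk_col_tip: "height2 (2 * d) j = 0 \<Longrightarrow> walk_col (2 * d) j = source_col"
  using a_less by (auto simp: walk_col_def walk_count_def walled_def delta_def source_col_def ip fun_eq_iff)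

lemma inv_right_tip:
  assumes n: "2 * d < b + c"
  shows "inv_right (2 * d) p cdet (\<lambda>_. A (2 * d))"
  unfolding inv_right_def
proof (intro allI impI)
  fix js assume js: "sorted_wrt (<) js" "length js = p" "\<forall>i<p. js ! i \<in> A (2 * d)"
  have sub: "set js \<subseteq> A (2 * d)" using js by (force simp: in_set_conv_nth)
  define j0 where "j0 = int a - int d"
  have z: "height2 (2 * d) j = 2 * (j - j0)" for j by (simp add: height2_def ip j0_def)
  have j0A: "j0 \<in> A (2 * d)" using n db bc by (auto simp: A_def edges_def j0_def ip)
  have BA: "B (2 * d) = A (2 * d) - {j0}" using d n by (auto simp: A_def B_def z)
  show "real (M (partial A B (2 * d) (set js) {})) = cdet (map (walk_col (2 * d)) js)"
  \<comment> \<open>If the tip edge \<open>j0\<close> is not crossed, its right triangle has no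
    partner and row \<open>a\<close> of the matrix is zero. If it is crossed, its column is
    \<open>source_col\<close>, and its position in \<open>js\<close> is the \<open>l\<close> for
    which the invariant left of the tip is used.\<close>
  proof (cases "j0 \<in> set js")
    case False
    have "M (partial A B (2 * d) (set js) {}) =
       M (below A B (2 * d) \<union> Lt (int (2 * d) - 1) ` B (2 * d) \<union> Rt (int (2 * d)) ` (A (2 * d) - set js))"
      by (simp add: partial_def)
    also have "\<dots> = 0"
      by (rule M_horizontal_forced(2)) (use False j0A BA in \<open>auto simp: finite_A finite_B\<close>)
    finally have "M (partial A B (2 * d) (set js) {}) = 0" .
    moreover have "cdet (map (walk_col (2 * d)) js) = 0"
      unfolding cdet_def
    proof (rule fdet_zero_row[of a])
      show "a < length (map (walk_col (2 * d)) js)" by (simp add: js p)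
      fix k assume k: "k < length (map (walk_col (2 * d)) js)"
      then have "js ! k \<noteq> j0" using False by auto
      then show "(map (walk_col (2 * d)) js ! k) a = 0"
        using k by (simp add: walk_col_def walk_count_def walled_def delta_def z ip)
    qed
    ultimately show ?thesis by simp
  next
    case True
    then obtain us vs where split: "js = us @ j0 # vs" by (meson split_list)
    have sorted: "sorted_wrt (<) (us @ vs)" and lt: "\<And>u. u \<in> set us \<Longrightarrow> u < j0" and gt: "\<And>v. v \<in> set vs \<Longrightarrow> j0 < v"
      using js(1) by (auto simp: split sorted_wrt_append)
    have C: "A (2 * d) - set js \<subseteq> B (2 * d)" using True BA by auto
    have "M (partial A B (2 * d) (set js) {}) =
       M (below A B (2 * d) \<union> Lt (int (2 * d) - 1) ` B (2 * d) \<union> Rt (int (2 * d)) ` (A (2 * d) - set js))"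
      by (simp add: partial_def)
    also have "\<dots> = M (below A B (2 * d) \<union> Lt (int (2 * d) - 1) ` (B (2 * d) - (A (2 * d) - set js)))"
      by (rule M_horizontal_forced(1)[OF finite_A finite_B _ _ C]) (auto simp: finite_A finite_B)
    also have "B (2 * d) - (A (2 * d) - set js) = set (us @ vs)"
      using sub BA lt gt by (fastforce simp: split)
    finally have "real (M (partial A B (2 * d) (set js) {})) = real (M (below A B (2 * d) \<union> Lt (int (2 * d) - 1) ` set (us @ vs)))"
      by simp
    also have "\<dots> = cdet_with (length us) source_col (map (walk_col (2 * d)) (us @ vs))"
    proof -
      have "(us @ vs) ! i \<in> B (2 * d) \<inter> side (length us) (2 * d) i" if "i < length (us @ vs)" for i
      proof
        have "(us @ vs) ! i \<in> set (us @ vs)" using that by (rule nth_mem)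
        then show "(us @ vs) ! i \<in> B (2 * d)" using sub BA lt gt by (fastforce simp: split)
        show "(us @ vs) ! i \<in> side (length us) (2 * d) i"
        proof (cases "i < length us")
          case True
          then show ?thesis using lt[of "us ! i"] by (simp add: side_def z nth_append)
        next
          case False
          then have "i - length us < length vs" using that by simp
          then show ?thesis using gt[of "vs ! (i - length us)"] False by (simp add: side_def z nth_append)
        qed
      qed
      moreover have "length (us @ vs) = 2 * a" using js(2) by (simp add: split p)
      ultimately show ?thesis
        using inv_left_tip[of "length us", unfolded inv_left_def, rule_format, OF sorted] by simp
    qed
    also have "\<dots> = cdet (map (walk_col (2 * d)) js)"
      using walk_col_tip[of j0] by (simp add: cdet_with_def split z)
    finally show ?thesis .
  qed
qed

lemma M_eq_Md_source: "real (M (hexagon_del p b c d)) = path_det p d b c"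
proof (cases "2 * d < b + c")
  case True
  show ?thesis
  proof (rule M_from_HR[OF inv_right_tip[OF True] True])
    show "A y = B y" if "2 * d < y" "y < b + c" for y using A_eq_B[of y] that by auto
    show "B (b + c) = edges (b + c)" using True by (auto simp: B_def)
  qed
next
  case False
  \<comment> \<open>Here \<open>b = c = d\<close> and the wall reaches the right side. The tip edge
    belongs to \<open>ends\<close> although its left triangle is deleted; its column is
    \<open>source_col\<close>, so the invariant left of the tip already gives the full
    determinant.\<close>
  then have eq: "b + c = 2 * d" "c = d" using db bc by auto
  define js where "js = map (\<lambda>k. int k - int c) others"
  have z: "height2 (2 * d) (int k - int c) = 2 * int k - 2 * int a" for k
    using eq by (simp add: height2_def ip)
  have len: "length js = 2 * a" by (simp add: js_def others_def)
  have nth: "js ! i = int (skip a i) - int c" if "i < 2 * a" for i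
    using that nth_others[OF that] len by (simp add: js_def)
  have sorted: "sorted_wrt (<) js"
    using sorted_others unfolding js_def by (simp add: sorted_wrt_map)
  have setjs: "set js = B (2 * d)"
  proof -
    have le: "b + c \<le> 2 * d" "0 < b + c" using False d db by auto
    have "B (b + c) = {j \<in> edges (b + c). height2 (b + c) j \<noteq> 0}" using le by (auto simp: B_def)
    then have "B (2 * d) = {j \<in> set ends. height2 (2 * d) j \<noteq> 0}" unfolding set_ends eq(1) .
    also have "\<dots> = set js" by (auto simp: ends_def js_def set_others z)
    finally show ?thesis ..
  qed
  have "real (M (hexagon_del p b c d)) = real (M (below A B (2 * d) \<union> Lt (int (2 * d) - 1) ` set js))"
    unfolding hexagon_del_eq setjs eq(1) ..
  also have "\<dots> = cdet_with a source_col (map (walk_col (2 * d)) js)"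
  proof -
    have "js ! i \<in> B (2 * d) \<inter> side a (2 * d) i" if "i < 2 * a" for i
    proof
      show "js ! i \<in> B (2 * d)" using setjs nth_mem[of i js] that len by auto
      show "js ! i \<in> side a (2 * d) i" unfolding side_def nth[OF that] mem_Collect_eq z by (auto simp: skip_def)
    qed
    then show ?thesis
      using inv_left_tip[of a, unfolded inv_left_def, rule_format, OF sorted len] by simp
  qed
  also have "\<dots> = cdet (map (walk_col (2 * d)) ends)"
  proof -
    have "cdet_with a source_col (map (\<lambda>k. walk_col (2 * d) (int k - int c)) others) = cdet (map (\<lambda>k. walk_col (2 * d) (int k - int c)) [0..<p])"
      by (rule cdet_with_others) (simp add: walk_col_tip z)
    then show ?thesis by (simp add: js_def ends_def comp_def)
  qed
  also have "\<dots> = path_det p d b c" using cdet_ends unfolding eq(1) .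
  finally show ?thesis .
qed

end

theorem M_hexagon_del:
  assumes "d \<le> b" "b \<le> c"
  shows "real (M (hexagon_del p b c d)) = path_det p d b c"
proof -
  interpret dented_hexagon p b c d by unfold_locales (use assms in auto)
  consider "b + c = 0" | "even p \<or> d = 0" "0 < b + c" | "odd p" "0 < d" by (metis gr0I)
  then show ?thesis
  proof cases
    case 1
    have "hexagon_del p b c d = {}"
      unfolding hexagon_del_eq 1 by (simp add: below_def B_def)
    moreover have "path_det p d b c = 1" using 1 assms macmahon_det[of p 0 0] by (simp add: boxes_c0)
    ultimately show ?thesis by simp
  next
    case 2
    then show ?thesis by (rule M_eq_Md_no_source)
  next
    case 3
    then obtain a where a: "p = 2 * a + 1" using oddE by blast
    interpret bowtie_hexagon p b c d a by unfold_locales (use 3 a in auto)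
    show ?thesis by (rule M_eq_Md_source)
  qed
qed

section \<open>Shifted factorials and the theorem\<close>

lemma prod_shift_neg:
  fixes x :: real
  shows "(\<Prod>i=1..m. x + 1 - real i) * (x - real m) = x * (\<Prod>i=1..m. x - real i)"
  by (induction m) (simp_all add: algebra_simps prod.nat_ivl_Suc')

lemma sfact_neg: "sfact x (- int (Suc m)) = 1 / (\<Prod>i=1..Suc m. x - real i)"
  by (simp add: sfact_def nat_add_distrib del: prod.cl_ivl_Suc)

lemma sfact_neg_prod_pos:
  fixes x :: real
  assumes "x - real m > 0"
  shows "(\<Prod>i=1..m. x - real i) > 0"
  by (rule prod_pos) (use assms in auto)

lemma sfact_cases [case_names nonneg neg]:
  obtains m where "n = int m" | m where "n = - int (Suc m)"
  by (metis int_cases)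

lemma sfact_pos:
  assumes "x > 0" "x + of_int n > 0"
  shows "sfact x n > 0"
proof (cases n rule: sfact_cases)
  case (nonneg m)
  then show ?thesis using assms by (simp add: sfact_def pochhammer_pos)
next
  case (neg m)
  then have "x - real (Suc m) > 0" using assms by simp
  then show ?thesis unfolding neg sfact_neg using sfact_neg_prod_pos[of x "Suc m"] by simp
qed

lemma sfact_shift:
  assumes "x > 0" "x + of_int n > 0"
  shows "sfact (x + 1) n * x = sfact x n * (x + of_int n)"
proof (cases n rule: sfact_cases)
  case (nonneg m)
  have "pochhammer (x + 1) m * x = pochhammer x (Suc m)" by (simp add: pochhammer_rec mult.commute)
  also have "\<dots> = pochhammer x m * (x + real m)" by (simp add: pochhammer_Suc)
  finally show ?thesis using nonneg by (simp add: sfact_def)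
next
  case (neg m)
  have p: "x - real (Suc m) > 0" using assms neg by simp
  have P: "(\<Prod>i=1..Suc m. x - real i) > 0" "(\<Prod>i=1..Suc m. x + 1 - real i) > 0"
    by (rule sfact_neg_prod_pos, use p in simp)+
  have e: "x + of_int n = x - real (Suc m)" using neg by simp
  have "1 / Q * x = 1 / P * y" if "Q * y = x * P" "P > 0" "Q > 0" for P Q y :: real
    using that by (simp add: field_simps)
  then show ?thesis unfolding e unfolding neg sfact_neg using prod_shift_neg[of x "Suc m"] P by blast
qed

lemma sfact_Suc:
  assumes "x > 0" "x + of_int n > 0"
  shows "sfact x (n + 1) = sfact x n * (x + of_int n)"
proof (cases n rule: sfact_cases)
  case (nonneg m)
  then show ?thesis by (simp add: sfact_def nat_add_distrib pochhammer_Suc)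
next
  case (neg m)
  have p: "x - real (Suc m) > 0" using assms neg by simp
  have P: "(\<Prod>i=1..m. x - real i) > 0" by (rule sfact_neg_prod_pos) (use p in simp)
  have "sfact x (n + 1) = 1 / (\<Prod>i=1..m. x - real i)"
    using neg by (cases m) (simp_all add: sfact_def nat_add_distrib)
  moreover have "1 / P = 1 / (P * y) * y" if "P > 0" "y > 0" for P y :: real using that by simp
  moreover have "(\<Prod>i=1..Suc m. x - real i) = (\<Prod>i=1..m. x - real i) * (x - real (Suc m))" by simp
  moreover have "x + of_int n = x - real (Suc m)" using neg by simp
  ultimately show ?thesis using p P unfolding neg sfact_neg by metis
qed

lemma quotient_step:
  fixes S1 :: real
  assumes "S1' * q1 = S1 * p1" "S2' * q2 = S2 * p2" "S3' * q3 = S3 * p3" "S4' * q4 = S4 * p4"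
    and "q1 \<noteq> 0" "q2 \<noteq> 0" "q3 \<noteq> 0" "q4 \<noteq> 0"
  shows "N * S1' / (D * S2' * S3' * S4') = N * S1 / (D * S2 * S3 * S4) * (p1 * q2 * q3 * q4 / (q1 * p2 * p3 * p4))"
proof -
  have "S1' = S1 * p1 / q1" "S2' = S2 * p2 / q2" "S3' = S3 * p3 / q3" "S4' = S4 * p4 / q4"
    using assms by (simp_all add: eq_divide_eq)
  then show ?thesis using assms(5-8) by (simp add: mult_ac)
qed

lemma four_cancel:
  fixes x :: real
  assumes "w \<noteq> 0"
  shows "2 * x * y * (2 * z) / (q * (4 * (s * t))) = x * z * w * y / (q * w * s * t)"
    and "2 * y * x * (2 * z) / (q * (4 * (s * t))) = x * z * y * w / (q * w * s * t)"
  using assms by (simp_all add: mult_ac)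

text \<open>Doubling the two factors on the left gives the two on the right; the parity of
  \<open>c - b\<close> only decides which is which.\<close>

lemma half_diff_product:
  fixes b c :: nat and t :: real
  assumes "b \<le> c"
  defines "e \<equiv> real ((c - b) div 2)"
  shows "4 * ((t + real b + 1/2 + e) * (t + real c - e)) = (2 * t + real b + real c) * (2 * t + real b + real c + 1)"
    and "4 * ((t + real b + 1 + e) * (t + real c + 1/2 - e)) = (2 * t + real b + real c + 1) * (2 * t + real b + real c + 2)"
proof -
  have "c = b + 2 * ((c - b) div 2) \<or> c = b + 2 * ((c - b) div 2) + 1" using assms(1) by presburger
  then have "real c = real b + 2 * e \<or> real c = real b + 2 * e + 1" unfolding e_def by linarith
  then show "4 * ((t + real b + 1/2 + e) * (t + real c - e)) = (2 * t + real b + real c) * (2 * t + real b + real c + 1)"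
    "4 * ((t + real b + 1 + e) * (t + real c + 1/2 - e)) = (2 * t + real b + real c + 1) * (2 * t + real b + real c + 2)"
    by (auto simp: algebra_simps)
qed

text \<open>Induction on \<open>a\<close>: at \<open>a = 0\<close> numerator and denominator
  coincide, and by \<open>sfact_shift\<close> raising \<open>a\<close> by one multiplies the
  quotient by \<open>even_step\<close>.\<close>

lemma even_factor:
  assumes "k < b" "b \<le> c"
  defines "e \<equiv> (c - b) div 2"
  shows "(sfact (real k + 1/2) (int b - 2 * int k)
          * sfact (real a + real k + 1) (int b - 2 * int k - 1)
          * sfact (real b - real k + 1/2) (int e)
          * sfact (real c - real k) (- int e))
       / (sfact (real a + real k + 1/2) (int b - 2 * int k)
          * sfact (real k + 1) (int b - 2 * int k - 1)
          * sfact (real a + real b - real k + 1/2) (int e)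
          * sfact (real a + real c - real k) (- int e)) = even_ratio a k b c"
proof -
  have ce: "real b + real e \<le> real c" using assms by (simp add: e_def)
  define S1 where "S1 a = sfact (real a + real k + 1) (int b - 2 * int k - 1)" for a
  define S2 where "S2 a = sfact (real a + real k + 1/2) (int b - 2 * int k)" for a
  define S3 where "S3 a = sfact (real a + real b - real k + 1/2) (int e)" for a
  define S4 where "S4 a = sfact (real a + real c - real k) (- int e)" for a
  have pos: "S1 a > 0" "S2 a > 0" "S3 a > 0" "S4 a > 0" for a
    unfolding S1_def S2_def S3_def S4_def by (rule sfact_pos; use assms(1,2) ce in simp)+
  define N where "N = S2 0 * S3 0 * S4 0"
  define D where "D = S1 0"
  have *: "N * S1 a / (D * S2 a * S3 a * S4 a) = even_ratio a k b c"
  proof (induction a)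
    case 0
    show ?case using pos[of 0] by (simp add: N_def D_def even_ratio_def)
  next
    case (Suc a)
    let ?p1 = "real a + real b - real k" and ?q1 = "real a + real k + 1"
    let ?p2 = "real a + real b - real k + 1/2" and ?q2 = "real a + real k + 1/2"
    let ?p3 = "real a + real b - real k + 1/2 + real e" and ?q4 = "real a + real c - real k" and ?p4 = "real a + real c - real k - real e"
    have s1: "S1 (Suc a) * ?q1 = S1 a * ?p1"
      using sfact_shift[of "real a + real k + 1" "int b - 2 * int k - 1"] assms(1) by (simp add: S1_def add_ac)
    have s2: "S2 (Suc a) * ?q2 = S2 a * ?p2"
      using sfact_shift[of "real a + real k + 1/2" "int b - 2 * int k"] assms(1) by (simp add: S2_def algebra_simps)
    have s3: "S3 (Suc a) * ?p2 = S3 a * ?p3"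
      using sfact_shift[of "real a + real b - real k + 1/2" "int e"] assms(1) by (simp add: S3_def algebra_simps)
    have s4: "S4 (Suc a) * ?q4 = S4 a * ?p4"
      using sfact_shift[of "real a + real c - real k" "- int e"] assms(1,2) ce by (simp add: S4_def algebra_simps)
    have nz: "?q1 \<noteq> 0" "?q2 \<noteq> 0" "?p2 \<noteq> 0" "?q4 \<noteq> 0" using assms(1,2) by linarith+
    have "N * S1 (Suc a) / (D * S2 (Suc a) * S3 (Suc a) * S4 (Suc a)) =
       even_ratio a k b c * (?p1 * ?q2 * ?p2 * ?q4 / (?q1 * ?p2 * ?p3 * ?p4))"
      unfolding quotient_step[OF s1 s2 s3 s4 nz] Suc.IH ..
    also have "?p1 * ?q2 * ?p2 * ?q4 / (?q1 * ?p2 * ?p3 * ?p4) = even_step a k b c"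
    proof -
      have h: "4 * (?p3 * ?p4) = (2 * real a + real b + real c - 2 * real k) * (2 * real a + real b + real c - 2 * real k + 1)"
        using half_diff_product(1)[OF assms(2), of "real a - real k"] by (simp add: e_def algebra_simps)
      have q: "2 * ?q2 = 2 * real a + 2 * real k + 1" by simp
      have "even_step a k b c = 2 * ?p1 * ?q4 * (2 * ?q2) / (?q1 * (4 * (?p3 * ?p4)))"
        unfolding even_step_def h q ..
      also have "\<dots> = ?p1 * ?q2 * ?p2 * ?q4 / (?q1 * ?p2 * ?p3 * ?p4)"
        by (rule four_cancel(1)[OF nz(3)])
      finally show ?thesis ..
    qed
    finally show ?case by (simp add: even_ratio_def)
  qed
  show ?thesis unfolding *[symmetric] N_def D_def S1_def S2_def S3_def S4_def
    by (simp add: mult_ac)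
qed

lemma odd_factor:
  assumes "k < b" "b \<le> c"
  defines "e \<equiv> (c - b) div 2"
  shows "1 / 4 * ((sfact (real a + real k + 1) (int c - 2 * int k)
          * sfact (real k + 3/2) (int c - 2 * int k - 2)
          * sfact (real b - real k) (int e)
          * sfact (real c - real k - 1/2) (- int e))
       / (sfact (real k + 1) (int c - 2 * int k - 1)
          * sfact (real a + real k + 3/2) (int c - 2 * int k - 1)
          * sfact (real a + real b - real k + 1) (int e)
          * sfact (real a + real c - real k + 1/2) (- int e))) = odd_ratio a k b c"
proof -
  have ce: "real b + real e \<le> real c" using assms by (simp add: e_def)
  define S1 where "S1 a = sfact (real a + real k + 1) (int c - 2 * int k)" for a
  define S2 where "S2 a = sfact (real a + real k + 3/2) (int c - 2 * int k - 1)" for a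
  define S3 where "S3 a = sfact (real a + real b - real k + 1) (int e)" for a
  define S4 where "S4 a = sfact (real a + real c - real k + 1/2) (- int e)" for a
  have pos: "S2 a > 0" "S3 a > 0" "S4 a > 0" for a
    unfolding S2_def S3_def S4_def by (rule sfact_pos; use assms(1,2) ce in simp)+
  define T1 where "T1 = sfact (real k + 3/2) (int c - 2 * int k - 2)"
  define T2 where "T2 = sfact (real b - real k) (int e)"
  define T3 where "T3 = sfact (real c - real k - 1/2) (- int e)"
  define D where "D = sfact (real k + 1) (int c - 2 * int k - 1)"
  have Dpos: "D > 0" unfolding D_def by (rule sfact_pos) (use assms(1,2) in simp_all)
  define N where "N = 1 / 4 * (T1 * T2 * T3)"
  have *: "N * S1 a / (D * S2 a * S3 a * S4 a) = odd_ratio a k b c"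
  proof (induction a)
    case 0
    \<comment> \<open>Unlike in the even case the value at \<open>a = 0\<close> is not 1: matching
      shifted factorials differ by one in argument or length. What remains is the prefactor of
      \<open>odd_ratio\<close>, with the \<open>1 / 4\<close> clearing the two halves in
      \<open>P * Q\<close>.\<close>
    have s1: "S1 0 = D * (real c - real k)"
      using sfact_Suc[of "real k + 1" "int c - 2 * int k - 1"] assms(1,2) by (simp add: S1_def D_def)
    have s2: "S2 0 = T1 * (real c - real k - 1/2)"
      using sfact_Suc[of "real k + 3/2" "int c - 2 * int k - 2"] assms(1,2) by (simp add: S2_def T1_def)
    have s3: "S3 0 * (real b - real k) = T2 * (real b - real k + real e)"
      using sfact_shift[of "real b - real k" "int e"] assms(1) by (simp add: S3_def T2_def)
    have s4: "S4 0 * (real c - real k - 1/2) = T3 * (real c - real k - 1/2 - real e)"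
      using sfact_shift[of "real c - real k - 1/2" "- int e"] assms(1,2) ce by (simp add: S4_def T3_def add.commute)
    define B where "B = real b - real k"
    define C where "C = real c - real k"
    define H where "H = real c - real k - 1/2"
    define P where "P = real b - real k + real e"
    define Q where "Q = real c - real k - 1/2 - real e"
    have nz: "B > 0" "C > 0" "H > 0" "P > 0" "Q > 0" using assms(1,2) ce by (simp_all add: B_def C_def H_def P_def Q_def)
    have PQ: "4 * (P * Q) = (real b + real c - 2 * real k - 1) * (real b + real c - 2 * real k)"
      using half_diff_product(2)[OF assms(2), of "- real k - 1"] by (simp add: P_def Q_def e_def algebra_simps)
    have t1: "T1 = S2 0 / H" using s2 nz by (simp add: H_def)
    have t2: "T2 = S3 0 * B / P" using s3 nz by (simp add: B_def P_def eq_divide_eq)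
    have t3: "T3 = S4 0 * H / Q" using s4 nz by (simp add: H_def Q_def eq_divide_eq)
    have "N * S1 0 / (D * S2 0 * S3 0 * S4 0) = B * C / (4 * (P * Q))"
      unfolding N_def t1 t2 t3 s1 C_def[symmetric] using pos[of 0] Dpos nz by (simp add: mult_ac)
    then show ?case unfolding PQ by (simp add: odd_ratio_def B_def C_def mult_ac)
  next
    case (Suc a)
    let ?p1 = "real a + real c - real k + 1" and ?q1 = "real a + real k + 1"
    let ?p2 = "real a + real c - real k + 1/2" and ?q2 = "real a + real k + 3/2"
    let ?p3 = "real a + real b - real k + 1 + real e" and ?q3 = "real a + real b - real k + 1" and ?p4 = "real a + real c - real k + 1/2 - real e"
    have s1: "S1 (Suc a) * ?q1 = S1 a * ?p1"
      using sfact_shift[of "real a + real k + 1" "int c - 2 * int k"] assms(1,2) by (simp add: S1_def algebra_simps)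
    have s2: "S2 (Suc a) * ?q2 = S2 a * ?p2"
      using sfact_shift[of "real a + real k + 3/2" "int c - 2 * int k - 1"] assms(1,2) by (simp add: S2_def algebra_simps)
    have s3: "S3 (Suc a) * ?q3 = S3 a * ?p3"
      using sfact_shift[of "real a + real b - real k + 1" "int e"] assms(1) by (simp add: S3_def algebra_simps)
    have s4: "S4 (Suc a) * ?p2 = S4 a * ?p4"
      using sfact_shift[of "real a + real c - real k + 1/2" "- int e"] assms(1,2) ce by (simp add: S4_def algebra_simps)
    have nz: "?q1 \<noteq> 0" "?q2 \<noteq> 0" "?q3 \<noteq> 0" "?p2 \<noteq> 0" using assms(1,2) by linarith+
    have "N * S1 (Suc a) / (D * S2 (Suc a) * S3 (Suc a) * S4 (Suc a)) =
       odd_ratio a k b c * (?p1 * ?q2 * ?q3 * ?p2 / (?q1 * ?p2 * ?p3 * ?p4))"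
      unfolding quotient_step[OF s1 s2 s3 s4 nz] Suc.IH ..
    also have "?p1 * ?q2 * ?q3 * ?p2 / (?q1 * ?p2 * ?p3 * ?p4) = odd_step a k b c"
    proof -
      have h: "4 * (?p3 * ?p4) = (2 * real a + real b + real c - 2 * real k + 1) * (2 * real a + real b + real c - 2 * real k + 2)"
        using half_diff_product(2)[OF assms(2), of "real a - real k"] by (simp add: e_def algebra_simps)
      have q: "2 * ?q2 = 2 * real a + 2 * real k + 3" by simp
      have "odd_step a k b c = 2 * ?q3 * ?p1 * (2 * ?q2) / (?q1 * (4 * (?p3 * ?p4)))"
        unfolding odd_step_def h q ..
      also have "\<dots> = ?p1 * ?q2 * ?q3 * ?p2 / (?q1 * ?p2 * ?p3 * ?p4)"
        by (rule four_cancel(2)[OF nz(4)])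
      finally show ?thesis ..
    qed
    finally show ?case by (simp add: odd_ratio_def)
  qed
  show ?thesis unfolding *[symmetric] N_def D_def S1_def S2_def S3_def S4_def T1_def T2_def T3_def
    by (simp add: mult_ac)
qed

lemma M_hexagon: "b \<le> c \<Longrightarrow> real (M (hexagon p b c)) = boxes p b c"
  using M_hexagon_del[of 0 b c p] by (simp add: hexagon_del_def deleted_def macmahon_det)

theorem theorem2p1:
  fixes a b c d :: nat
  assumes "d \<le> b" and "b \<le> c"
  shows "real (M (hexagon_del (2*a) b c d)) / real (M (hexagon (2*a) b c)) =
      (\<Prod>k<d.
         (sfact (real k + 1/2) (int b - 2 * int k)
          * sfact (real a + real k + 1) (int b - 2 * int k - 1)
          * sfact (real b - real k + 1/2) (int ((c - b) div 2))
          * sfact (real c - real k) (- int ((c - b) div 2)))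
       / (sfact (real a + real k + 1/2) (int b - 2 * int k)
          * sfact (real k + 1) (int b - 2 * int k - 1)
          * sfact (real a + real b - real k + 1/2) (int ((c - b) div 2))
          * sfact (real a + real c - real k) (- int ((c - b) div 2))))
    \<and> real (M (hexagon_del (2*a+1) b c d)) / real (M (hexagon (2*a+1) b c)) =
      1 / 4 ^ d *
      (\<Prod>k<d.
         (sfact (real a + real k + 1) (int c - 2 * int k)
          * sfact (real k + 3/2) (int c - 2 * int k - 2)
          * sfact (real b - real k) (int ((c - b) div 2))
          * sfact (real c - real k - 1/2) (- int ((c - b) div 2)))
       / (sfact (real k + 1) (int c - 2 * int k - 1)
          * sfact (real a + real k + 3/2) (int c - 2 * int k - 1)
          * sfact (real a + real b - real k + 1) (int ((c - b) div 2))
          * sfact (real a + real c - real k + 1/2) (- int ((c - b) div 2))))"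
    (is "?L1 = (\<Prod>k<d. ?F k) \<and> ?L2 = 1 / 4 ^ d * (\<Prod>k<d. ?G k)")
proof
  have dc: "d \<le> c" using assms by simp
  have "?L1 = (\<Prod>k<d. even_ratio a k b c)"
    unfolding M_hexagon_del[OF assms] M_hexagon[OF assms(2)]
    using path_det_closed_forms(1)[of d a] assms dc boxes_pos[of "2 * a" b c] by (simp add: evens_def)
  also have "\<dots> = (\<Prod>k<d. ?F k)"
    by (rule prod.cong[OF refl], rule even_factor[symmetric]) (use assms in auto)
  finally show "?L1 = (\<Prod>k<d. ?F k)" .
  have "?L2 = (\<Prod>k<d. odd_ratio a k b c)"
    unfolding M_hexagon_del[OF assms] M_hexagon[OF assms(2)]
    using path_det_closed_forms(2)[of d a] assms dc boxes_pos[of "2 * a + 1" b c] by (simp add: odds_def)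
  also have "\<dots> = (\<Prod>k<d. 1 / 4 * ?G k)"
    by (rule prod.cong[OF refl], rule odd_factor[symmetric]) (use assms in auto)
  also have "\<dots> = 1 / 4 ^ d * (\<Prod>k<d. ?G k)"
    unfolding prod.distrib by (simp add: power_one_over)
  finally show "?L2 = 1 / 4 ^ d * (\<Prod>k<d. ?G k)" .
qed

end
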